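(* Let $m,n\in\mathbb R$, $\mathcal B>0$, $q=m-n+1$. Assume $1<q<2$ and that there exists $\alpha_{crit}\in(0,1)$ with $E'(\alpha)<0$ on $(0,\alpha_{crit})$ and $E'(\alpha)>0$ on $(\alpha_{crit},1)$, and assume $\alpha\mapsto\alpha P(\alpha)^{2/(q-1)}$ is strictly increasing for $\alpha\in(0,1)$. Suppose $h_{\rm ss1}$ and $h_{\rm ss2}$ are non-constant positive periodic steady states of $h_t=-(h^nh_{xxx})_x-\mathcal B(h^mh_x)_x$ having the same least period $X$ and the same area $\int_0^Xh_{\rm ss1}\,dx=\int_0^Xh_{\rm ss2}\,dx$. If $h_{\rm ss1}$ has lower minimum value than $h_{\rm ss2}$, then $h_{\rm ss1}$ is energy stable, $h_{\rm ss2}$ is energy unstable (both at period $X$), and $\mathcal E(h_{\rm ss1})<\mathcal E(h_{\rm ss2})$. Furthermore, $\mathcal E(h_{\rm ss2})>\mathcal E(\overline{h_{\rm ss2}})$, where $\overline{h_{\rm ss2}}=\frac1X\int_0^Xh_{\rm ss2}\,dx$ is regarded as a constant function.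
   Context: A positive periodic steady state is a positive periodic $C^4$ function with $(h^nh'''+\mathcal B h^mh')'=0$ classically. For $\alpha\in(0,1)$, $k_\alpha$ is the unique smooth positive periodic solution of $k''+\frac{k^q-1}{q}=0$ with $k(0)=\alpha$, $k'(0)=0$. $P(\alpha)$ is its least period, $A(\alpha)=\int_0^{P(\alpha)}k_\alpha\,dx$, and $E(\alpha)=P(\alpha)^{3-q}A(\alpha)^{q-1}$; these are smooth functions of $\alpha\in(0,1)$. Energy at period $X$: for positive $\ell\in H^1(\mathbb T_X)$ ($\mathbb T_X$ the circle of circumference $X$), $\mathcal E(\ell)=\int_0^X[\frac12(\ell')^2-H(\ell)]dx$, where $H$ is a fixed function on $(0,\infty)$ with $H''(y)=\mathcal B y^{q-1}$. A steady state $h_{\rm ss}$ is energy unstable (at period $X$) if there is a smooth $X$-periodic $u$ with mean value zero such that $\mathcal E(h_{\rm ss}+\varepsilon u)<\mathcal E(h_{\rm ss})$ for all sufficiently small $\varepsilon>0$. It is energy stable (at period $X$) if for each $u\in H^1(\mathbb T_X)\setminus\{0\}$ with $\int_0^Xu\,dx=0$ one has $\mathcal E(h_{\rm ss}+\varepsilon u)>\mathcal E(h_{\rm ss})$ for all sufficiently small $\varepsilon>0$ (how small may depend on $u$). *)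

theory Defs
  imports "HOL-Analysis.Analysis"
begin

definition C_k :: "nat \<Rightarrow> (real \<Rightarrow> real) \<Rightarrow> bool" where
  "C_k k f \<longleftrightarrow> (\<forall>i<k. \<forall>x. (deriv ^^ i) f differentiable (at x)) \<and>
                 continuous_on UNIV ((deriv ^^ k) f)"

definition smooth :: "(real \<Rightarrow> real) \<Rightarrow> bool" where
  "smooth f \<longleftrightarrow> (\<forall>k. C_k k f)"

definition periodic :: "real \<Rightarrow> (real \<Rightarrow> real) \<Rightarrow> bool" where
  "periodic T f \<longleftrightarrow> (\<forall>x. f (x + T) = f x)"

definition is_least_period :: "(real \<Rightarrow> real) \<Rightarrow> real \<Rightarrow> bool" where
  "is_least_period f T \<longleftrightarrow>
     T > 0 \<and> periodic T f \<and> (\<forall>S>0. periodic S f \<longrightarrow> T \<le> S)"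

definition pos_periodic_steady_state ::
    "real \<Rightarrow> real \<Rightarrow> real \<Rightarrow> (real \<Rightarrow> real) \<Rightarrow> bool" where
  "pos_periodic_steady_state m n B h \<longleftrightarrow>
     (\<forall>x. h x > 0) \<and> (\<exists>T>0. periodic T h) \<and> C_k 4 h \<and>
     (\<forall>x. ((\<lambda>y. h y powr n * (deriv ^^ 3) h y + B * h y powr m * deriv h y)
             has_real_derivative 0) (at x))"

definition is_profile :: "real \<Rightarrow> real \<Rightarrow> (real \<Rightarrow> real) \<Rightarrow> bool" where
  "is_profile q \<alpha> k \<longleftrightarrow>
     smooth k \<and> (\<forall>x. k x > 0) \<and> (\<exists>T>0. periodic T k) \<and>
     (\<forall>x. deriv (deriv k) x + (k x powr q - 1) / q = 0) \<and>
     k 0 = \<alpha> \<and> deriv k 0 = 0"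

definition profile :: "real \<Rightarrow> real \<Rightarrow> real \<Rightarrow> real" where
  "profile q \<alpha> = (THE k. is_profile q \<alpha> k)"

definition profile_period :: "real \<Rightarrow> real \<Rightarrow> real" where
  "profile_period q \<alpha> = (THE T. is_least_period (profile q \<alpha>) T)"

definition profile_area :: "real \<Rightarrow> real \<Rightarrow> real" where
  "profile_area q \<alpha> = integral {0..profile_period q \<alpha>} (profile q \<alpha>)"

definition profile_E :: "real \<Rightarrow> real \<Rightarrow> real" where
  "profile_E q \<alpha> = profile_period q \<alpha> powr (3 - q) * profile_area q \<alpha> powr (q - 1)"

text \<open>Functions on the circle of circumference \<open>X\<close> are represented by \<open>X\<close>-periodic functions on the
  line. Elements of \<open>L2_circle X\<close> and \<open>H1_circle X\<close> are individual representatives, so that equality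
  in these spaces is equality almost everywhere.\<close>

definition L2_circle :: "real \<Rightarrow> (real \<Rightarrow> real) set" where
  "L2_circle X = {u. u \<in> borel_measurable lebesgue \<and> periodic X u \<and>
                     (\<lambda>x. (u x)\<^sup>2) absolutely_integrable_on {0..X}}"

definition has_weak_deriv :: "real \<Rightarrow> (real \<Rightarrow> real) \<Rightarrow> (real \<Rightarrow> real) \<Rightarrow> bool" where
  "has_weak_deriv X u v \<longleftrightarrow>
     (\<forall>\<phi>. smooth \<phi> \<and> periodic X \<phi> \<longrightarrow>
        integral {0..X} (\<lambda>x. u x * deriv \<phi> x) = - integral {0..X} (\<lambda>x. v x * \<phi> x))"

definition H1_circle :: "real \<Rightarrow> (real \<Rightarrow> real) set" where
  "H1_circle X = {u \<in> L2_circle X. \<exists>v \<in> L2_circle X. has_weak_deriv X u v}"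

text \<open>The choice below is determined only up to a null set; the energy does not depend on it.\<close>

definition weak_deriv :: "real \<Rightarrow> (real \<Rightarrow> real) \<Rightarrow> real \<Rightarrow> real" where
  "weak_deriv X u = (SOME v. v \<in> L2_circle X \<and> has_weak_deriv X u v)"

text \<open>The potential is only constrained on \<open>(0, \<infinity>)\<close>, where it is fixed up to an affine function.\<close>

definition energy_potential :: "real \<Rightarrow> real \<Rightarrow> (real \<Rightarrow> real) \<Rightarrow> bool" where
  "energy_potential B q H \<longleftrightarrow>
     (\<forall>y>0. H differentiable (at y) \<and>
            (deriv H has_real_derivative B * y powr (q - 1)) (at y))"

text \<open>Meaningful for \<open>l \<in> H1_circle X\<close> that are positive (almost everywhere).\<close>

definition energy :: "(real \<Rightarrow> real) \<Rightarrow> real \<Rightarrow> (real \<Rightarrow> real) \<Rightarrow> real" where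
  "energy H X l = integral {0..X} (\<lambda>x. (weak_deriv X l x)\<^sup>2 / 2 - H (l x))"

definition energy_unstable :: "(real \<Rightarrow> real) \<Rightarrow> real \<Rightarrow> (real \<Rightarrow> real) \<Rightarrow> bool" where
  "energy_unstable H X h \<longleftrightarrow>
     (\<exists>u. smooth u \<and> periodic X u \<and> integral {0..X} u = 0 \<and>
        (\<forall>\<^sub>F \<epsilon> in at_right 0. energy H X (\<lambda>x. h x + \<epsilon> * u x) < energy H X h))"

definition energy_stable :: "(real \<Rightarrow> real) \<Rightarrow> real \<Rightarrow> (real \<Rightarrow> real) \<Rightarrow> bool" where
  "energy_stable H X h \<longleftrightarrow>
     (\<forall>u \<in> H1_circle X. \<not> (AE x in lebesgue. u x = 0) \<and> integral {0..X} u = 0 \<longrightarrow>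
        (\<forall>\<^sub>F \<epsilon> in at_right 0. energy H X (\<lambda>x. h x + \<epsilon> * u x) > energy H X h))"

end

theory Submission
  imports Defs
begin

text \<open>Steady states are rescalings of the orbits of \<open>k'' + f(k) = 0\<close> with \<open>f(k) = (k\<^sup>q - 1)/q\<close>. With \<open>V' = f\<close>, \<open>V(1) = 0\<close> and
  \<open>\<gamma>\<close> the inverse of \<open>k \<mapsto> sgn(k - 1) \<surd>(2V(k))\<close>, the orbit of amplitude \<open>r\<close> is \<open>k = \<gamma>(- r cos \<phi>)\<close>, where
  \<open>dx/d\<phi> = \<gamma>'(- r cos \<phi>)\<close>. In this parametrisation period and area are integrals over a fixed interval with smooth integrands,
  the kernel of the linearisation \<open>L = - d\<^sup>2/dx\<^sup>2 - k\<^bsup>q-1\<^esup>\<close> is explicit, and the period increases with \<open>r\<close> because \<open>\<gamma>'' \<close>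
  is increasing for \<open>1 < q < 2\<close>.

  At fixed period \<open>X\<close> let \<open>M(r)\<close> be the mass of the steady state of amplitude \<open>r\<close>; up to a constant factor \<open>E = M\<^bsup>q-1\<^esup>\<close>. There is
  a periodic \<open>w\<close> with \<open>L w = -1\<close> and \<open>\<integral> w\<close> has the sign of \<open>M'(r)\<close>. If it is positive, adding multiples of \<open>w\<close> and \<open>k'\<close> to
  a mean-zero \<open>u\<close> produces a function vanishing at two conjugate points, so the second variation of \<open>u\<close> is positive unless \<open>u\<close> is
  a multiple of \<open>k'\<close>; in that direction the fourth-order term decides, and it is positive as \<open>q < 2\<close>. If it is negative, \<open>1 - s w\<close>
  is a destabilising direction. The energy \<open>F(r)\<close> of the family satisfies \<open>F' = - D M'\<close>, where the Lagrange multiplier \<open>D\<close> increases with \<open>r\<close>;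
  integrating this between the two steady states, and from \<open>r = 0\<close> (the constant) to the second one, gives the energy comparisons.\<close>

section \<open>Primitives of integrable functions and periodic integrals\<close>

text \<open>Both steady states have the period \<open>X\<close>, so the wave number is
  \<open>per r / X\<close> and the height is proportional to
  \<open>per r powr (2 / (q - 1))\<close>. The assumed monotonicity in \<alpha> therefore concerns
  the true minimum of the steady state: a lower minimum means a larger amplitude. The assumption on
  the derivative of E makes the mass first fall and then rise with the amplitude, so two states of
  equal mass lie on opposite sides of the turning point.

  The obstacle is that the second variation is not positive without the mass constraint. What can be
  controlled directly are functions with prescribed zeros, through positive solutions of the
  linearised equation on two complementary arcs; such solutions are found because the period
  increases with the amplitude. The function \<open>w\<close> is, up to a factor, the tangent to the
  family of steady states at fixed period: the scaling symmetry mixed with the amplitude derivative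
  so that the period stays put. This is why its integral carries the sign of the derivative of the
  mass. Competitors are given only through weak derivatives, so their continuous representatives
  have to be recovered by testing with periodic functions.\<close>

lemma antiderivative_exists:
  fixes f :: "real \<Rightarrow> real"
  assumes "continuous_on UNIV f"
  obtains F where "F 0 = 0" "\<And>x. (F has_real_derivative f x) (at x)"
proof -
  have "\<exists>F. \<forall>x::real. -\<infinity> < ereal x \<longrightarrow> ereal x < \<infinity> \<longrightarrow> (F has_vector_derivative f x) (at x)"
    by (rule einterval_antiderivative) (use assms continuous_on_eq_continuous_at in auto)
  then obtain G where G: "\<And>x. (G has_real_derivative f x) (at x)"
    by (auto simp: has_real_derivative_iff_has_vector_derivative)
  show ?thesis
  proof (rule that[of "\<lambda>x. G x - G 0"])
    show "((\<lambda>x. G x - G 0) has_real_derivative f x) (at x)" for x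
      using DERIV_diff[OF G[of x] DERIV_const[of "G 0"]] by simp
  qed simp
qed

lemma has_integral_of_derivative:
  fixes F :: "real \<Rightarrow> real"
  assumes "a \<le> b" "\<And>x. a \<le> x \<Longrightarrow> x \<le> b \<Longrightarrow> (F has_real_derivative f x) (at x)"
  shows "(f has_integral F b - F a) {a..b}"
  by (rule fundamental_theorem_of_calculus)
     (use assms in \<open>auto simp: has_real_derivative_iff_has_vector_derivative[symmetric] intro: has_field_derivative_at_within\<close>)

lemma periodic_int:
  assumes "periodic X f"
  shows "f (x + of_int k * X) = f x"
proof -
  have nat: "f (x + real n * X) = f x" for n x
  proof (induction n)
    case (Suc n)
    have "f (x + real (Suc n) * X) = f ((x + real n * X) + X)"
      by (simp add: algebra_simps)
    then show ?case using Suc assms by (simp add: periodic_def)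
  qed simp
  show ?thesis
  proof (cases "k \<ge> 0")
    case True
    then show ?thesis using nat[of x "nat k"] by simp
  next
    case False
    then show ?thesis using nat[of "x + of_int k * X" "nat (-k)"] by (simp add: algebra_simps)
  qed
qed

lemma periodic_representative:
  fixes X :: real
  assumes "X > 0"
  obtains k :: int where "a \<le> x + of_int k * X" "x + of_int k * X < a + X"
proof
  let ?k = "- \<lfloor>(x - a) / X\<rfloor>"
  have "of_int \<lfloor>(x - a) / X\<rfloor> \<le> (x - a) / X" "(x - a) / X < of_int \<lfloor>(x - a) / X\<rfloor> + 1"
    by linarith+
  then have "of_int \<lfloor>(x - a) / X\<rfloor> * X \<le> x - a" "x - a < (of_int \<lfloor>(x - a) / X\<rfloor> + 1) * X"
    using assms pos_le_divide_eq[OF assms] pos_divide_less_eq[OF assms] by blast+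
  then show "a \<le> x + of_int ?k * X" "x + of_int ?k * X < a + X"
    by (simp_all add: algebra_simps)
qed

lemma has_integral_translate:
  fixes f :: "real \<Rightarrow> real"
  assumes "(f has_integral I) {a..b}"
  shows "((\<lambda>x. f (x + c)) has_integral I) {a - c..b - c}"
  using has_integral_affinity'[of f I a b 1 c] assms by (simp add: cbox_interval)

text \<open>The base point is moved to a point \<open>?b\<close> of the first period; the period is
  cut there and the left piece is carried one period to the right.\<close>

lemma periodic_has_integral_shift:
  fixes f :: "real \<Rightarrow> real"
  assumes X: "X > 0" and p: "periodic X f" and I: "(f has_integral I) {0..X}"
  shows "(f has_integral I) {a..a + X}"
proof -
  obtain k :: int where k: "0 \<le> a + of_int k * X" "a + of_int k * X < 0 + X"
    using periodic_representative[OF X] by blast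
  let ?b = "a + of_int k * X"
  have int: "f integrable_on {0..X}" using I by blast
  have 1: "(f has_integral integral {?b..X} f) {?b..X}"
    by (intro integrable_integral integrable_subinterval_real[OF int]) (use k in auto)
  have 2: "(f has_integral integral {0..?b} f) {0..?b}"
    by (intro integrable_integral integrable_subinterval_real[OF int]) (use k in auto)
  have eq: "integral {0..?b} f + integral {?b..X} f = I"
    using Henstock_Kurzweil_Integration.integral_combine[OF _ _ int, of ?b] k I by (simp add: integral_unique)
  have "((\<lambda>x. f (x + - X)) has_integral integral {0..?b} f) {0 - -X..?b - -X}"
    by (rule has_integral_translate[OF 2])
  moreover have "(\<lambda>x. f (x + - X)) = f"
  proof
    fix x show "f (x + - X) = f x" using p[unfolded periodic_def, rule_format, of "x - X"] by simp
  qed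
  ultimately have "(f has_integral integral {0..?b} f) {X..?b + X}" by simp
  from has_integral_combine[OF _ _ 1 this] k eq
  have "(f has_integral I) {?b..?b + X}" by (simp add: add.commute)
  from has_integral_translate[OF this, of "of_int k * X"]
  show ?thesis using periodic_int[OF p] by simp
qed

lemma periodic_absolutely_integrable_shift:
  fixes f :: "real \<Rightarrow> real"
  assumes X: "X > 0" and p: "periodic X f" and f: "f absolutely_integrable_on {0..X}"
  shows "f absolutely_integrable_on {a..a + X}"
proof -
  have "(f has_integral integral {0..X} f) {0..X}" "((\<lambda>x. norm (f x)) has_integral integral {0..X} (\<lambda>x. norm (f x))) {0..X}"
    using f unfolding absolutely_integrable_on_def by auto
  then have "f integrable_on {a..a + X}" "(\<lambda>x. norm (f x)) integrable_on {a..a + X}"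
    using periodic_has_integral_shift[OF X p, of _ a] periodic_has_integral_shift[OF X, of "\<lambda>x. norm (f x)" _ a] p
    unfolding periodic_def integrable_on_def by (blast, metis)
  then show ?thesis unfolding absolutely_integrable_on_def by simp
qed

lemma absolutely_integrable_continuous_mult:
  fixes u v :: "real \<Rightarrow> real"
  assumes "continuous_on {a..b} u" "v absolutely_integrable_on {a..b}"
  shows "(\<lambda>x. u x * v x) absolutely_integrable_on {a..b}"
  by (rule absolutely_integrable_bounded_measurable_product_real)
     (use assms in \<open>auto intro!: continuous_imp_measurable_on_sets_lebesgue compact_imp_bounded
        compact_continuous_image\<close>)

text \<open>Absolute continuity, phrased through integrals over all subintervals. It avoids
  derivatives that exist only almost everywhere, and still permits the product rule and integration
  by parts.\<close>

definition primitive_on :: "real \<Rightarrow> real \<Rightarrow> (real \<Rightarrow> real) \<Rightarrow> (real \<Rightarrow> real) \<Rightarrow> bool" where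
  "primitive_on a b F f \<longleftrightarrow> f absolutely_integrable_on {a..b} \<and>
     (\<forall>c d. a \<le> c \<and> c \<le> d \<and> d \<le> b \<longrightarrow> (f has_integral F d - F c) {c..d})"

lemma primitive_on_integral:
  "primitive_on a b F f \<Longrightarrow> a \<le> c \<Longrightarrow> c \<le> d \<Longrightarrow> d \<le> b \<Longrightarrow> (f has_integral F d - F c) {c..d}"
  unfolding primitive_on_def by blast

lemma primitive_on_subset:
  "primitive_on a b F f \<Longrightarrow> a \<le> c \<Longrightarrow> d \<le> b \<Longrightarrow> primitive_on c d F f"
  unfolding primitive_on_def
  by (auto intro: set_integrable_subset)

lemma primitive_on_derivative:
  assumes "\<And>x. a \<le> x \<Longrightarrow> x \<le> b \<Longrightarrow> (F has_real_derivative f x) (at x)" "continuous_on {a..b} f"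
  shows "primitive_on a b F f"
  unfolding primitive_on_def
  using assms by (auto intro!: absolutely_integrable_continuous_real has_integral_of_derivative)

lemma primitive_on_add:
  "primitive_on a b F f \<Longrightarrow> primitive_on a b G g \<Longrightarrow>
   primitive_on a b (\<lambda>x. F x + G x) (\<lambda>x. f x + g x)"
  unfolding primitive_on_def
  by (auto simp: add_diff_add intro!: has_integral_add set_integral_add)

lemma primitive_on_continuous:
  assumes "primitive_on a b F f"
  shows "continuous_on {a..b} F"
proof (cases "a \<le> b")
  case True
  have "continuous_on {a..b} (\<lambda>x. F a + integral {a..x} f)"
    using assms True unfolding primitive_on_def
    by (intro continuous_intros indefinite_integral_continuous_1) auto
  moreover have "F a + integral {a..x} f = F x" if "x \<in> {a..b}" for x
  proof -
    have "(f has_integral F x - F a) {a..x}" using assms that unfolding primitive_on_def by auto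
    then show ?thesis by (simp add: integral_unique)
  qed
  ultimately show ?thesis using continuous_on_cong[of "{a..b}" "{a..b}" "\<lambda>x. F a + integral {a..x} f" F] by blast
qed auto

text \<open>On a short interval both increments differ from the product rule by at most the oscillation of
  the factors times the total variation; the Bolzano argument adds this up, and the
  oscillation is arbitrarily small.\<close>

lemma primitive_on_mult:
  assumes F: "primitive_on a b F f" and G: "primitive_on a b G g"
  shows "primitive_on a b (\<lambda>x. F x * G x) (\<lambda>x. f x * G x + F x * g x)"
proof -
  have cF: "continuous_on {a..b} F" and cG: "continuous_on {a..b} G"
    using primitive_on_continuous F G by auto
  have f: "f absolutely_integrable_on {a..b}" and g: "g absolutely_integrable_on {a..b}"
    using F G unfolding primitive_on_def by auto
  let ?h = "\<lambda>x. f x * G x + F x * g x"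
  have h: "?h absolutely_integrable_on {a..b}"
    using absolutely_integrable_continuous_mult[OF cG f] absolutely_integrable_continuous_mult[OF cF g] by (intro set_integral_add) (simp_all add: mult.commute)
  have "(?h has_integral F d * G d - F c * G c) {c..d}" if cd: "a \<le> c" "c \<le> d" "d \<le> b" for c d
  proof -
    have sub: "u integrable_on {p..q}" if "u absolutely_integrable_on {a..b}" "c \<le> p" "q \<le> d" for u :: "real \<Rightarrow> real" and p q
      by (rule integrable_subinterval_real[of u a b]) (use that cd in \<open>auto intro: set_lebesgue_integral_eq_integral(1)\<close>)
    define \<Phi> where "\<Phi> p q = F q * G q - F p * G p - integral {p..q} ?h" for p q
    define N where "N p q = integral {p..q} (\<lambda>x. \<bar>f x\<bar> + \<bar>g x\<bar>)" for p q
    have fg: "(\<lambda>x. \<bar>f x\<bar> + \<bar>g x\<bar>) absolutely_integrable_on {a..b}"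
      using absolutely_integrable_norm[OF f] absolutely_integrable_norm[OF g]
      by (intro set_integral_add) (simp_all add: o_def)
    have small: "\<bar>\<Phi> c d\<bar> \<le> e * N c d" if e: "e > 0" for e
    proof -
      have "uniformly_continuous_on {a..b} F" "uniformly_continuous_on {a..b} G"
        using cF cG by (auto intro: compact_uniformly_continuous)
      then obtain \<delta>1 \<delta>2 where \<delta>: "\<delta>1 > 0" "\<delta>2 > 0"
        "\<And>x y. x \<in> {a..b} \<Longrightarrow> y \<in> {a..b} \<Longrightarrow> dist y x < \<delta>1 \<Longrightarrow> dist (F y) (F x) < e"
        "\<And>x y. x \<in> {a..b} \<Longrightarrow> y \<in> {a..b} \<Longrightarrow> dist y x < \<delta>2 \<Longrightarrow> dist (G y) (G x) < e"
        unfolding uniformly_continuous_on_def using e by metis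
      have "c \<le> c \<and> c \<le> d \<and> d \<le> d \<longrightarrow> \<bar>\<Phi> c d\<bar> \<le> e * N c d"
      proof (rule Bolzano[of c d "\<lambda>p q. c \<le> p \<and> p \<le> q \<and> q \<le> d \<longrightarrow> \<bar>\<Phi> p q\<bar> \<le> e * N p q"])
        show "c \<le> d" by fact
      next
        fix p q r assume pq: "c \<le> p \<and> p \<le> q \<and> q \<le> d \<longrightarrow> \<bar>\<Phi> p q\<bar> \<le> e * N p q"
          and qr: "c \<le> q \<and> q \<le> r \<and> r \<le> d \<longrightarrow> \<bar>\<Phi> q r\<bar> \<le> e * N q r" and le: "p \<le> q" "q \<le> r"
        show "c \<le> p \<and> p \<le> r \<and> r \<le> d \<longrightarrow> \<bar>\<Phi> p r\<bar> \<le> e * N p r"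
        proof safe
          assume "c \<le> p" "r \<le> d"
          have "\<Phi> p r = \<Phi> p q + \<Phi> q r" "N p r = N p q + N q r"
            unfolding \<Phi>_def N_def
            using Henstock_Kurzweil_Integration.integral_combine[OF le sub[OF h \<open>c \<le> p\<close> \<open>r \<le> d\<close>]]
              Henstock_Kurzweil_Integration.integral_combine[OF le sub[OF fg \<open>c \<le> p\<close> \<open>r \<le> d\<close>]]
            by (simp_all only: algebra_simps)
          then show "\<bar>\<Phi> p r\<bar> \<le> e * N p r"
            using pq qr le \<open>c \<le> p\<close> \<open>r \<le> d\<close> by (simp add: algebra_simps)
        qed
      next
        fix x assume "c \<le> x" "x \<le> d"
        show "\<exists>\<delta>>0. \<forall>p q. p \<le> x \<and> x \<le> q \<and> q - p < \<delta> \<longrightarrow>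
           (c \<le> p \<and> p \<le> q \<and> q \<le> d \<longrightarrow> \<bar>\<Phi> p q\<bar> \<le> e * N p q)"
        proof (intro exI[of _ "min \<delta>1 \<delta>2"] conjI allI impI; (elim conjE)?)
          fix p q assume pq: "q - p < min \<delta>1 \<delta>2" "c \<le> p" "p \<le> q" "q \<le> d"
          have i: "(f has_integral F q - F p) {p..q}" "(g has_integral G q - G p) {p..q}"
            using F G pq cd unfolding primitive_on_def by auto
          \<comment> \<open>Splitting the increment as
            \<open>(F q - F p) * G q + F p * (G q - G p)\<close> turns it into an exact integral;
            only the oscillations of \<open>F\<close> and \<open>G\<close> on the short interval
            remain to be estimated.\<close>
          have "((\<lambda>x. f x * G q + F p * g x - ?h x) has_integral \<Phi> p q) {p..q}"
          proof -
            have "((\<lambda>x. f x * G q + F p * g x - ?h x) has_integral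
                ((F q - F p) * G q + F p * (G q - G p)) - integral {p..q} ?h) {p..q}"
              by (intro has_integral_diff has_integral_add has_integral_mult_left has_integral_mult_right i
                   integrable_integral sub[OF h]) (use pq in auto)
            then show ?thesis by (simp add: \<Phi>_def algebra_simps)
          qed
          moreover have "((\<lambda>x. e * (\<bar>f x\<bar> + \<bar>g x\<bar>)) has_integral e * N p q) {p..q}"
            unfolding N_def
            by (intro has_integral_mult_right integrable_integral sub[OF fg]) (use pq in auto)
          moreover have "norm (f x * G q + F p * g x - ?h x) \<le> e * (\<bar>f x\<bar> + \<bar>g x\<bar>)" if "x \<in> {p..q}" for x
          proof -
            have "dist (G q) (G x) < e" "dist (F p) (F x) < e"
              by (auto intro!: \<delta>) (use that pq cd in \<open>auto simp: dist_real_def\<close>)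
            then have "\<bar>f x\<bar> * \<bar>G q - G x\<bar> \<le> \<bar>f x\<bar> * e" "\<bar>F p - F x\<bar> * \<bar>g x\<bar> \<le> e * \<bar>g x\<bar>"
              by (auto simp: dist_real_def intro!: mult_left_mono mult_right_mono)
            moreover have "f x * G q + F p * g x - ?h x = f x * (G q - G x) + (F p - F x) * g x"
              by (simp add: algebra_simps)
            moreover have "\<bar>f x * (G q - G x) + (F p - F x) * g x\<bar> \<le> \<bar>f x\<bar> * \<bar>G q - G x\<bar> + \<bar>F p - F x\<bar> * \<bar>g x\<bar>"
              by (metis abs_mult abs_triangle_ineq)
            ultimately show ?thesis
              unfolding real_norm_def distrib_left by (simp add: mult.commute)
          qed
          ultimately show "\<bar>\<Phi> p q\<bar> \<le> e * N p q"
            using integral_norm_bound_integral[of "\<lambda>x. f x * G q + F p * g x - ?h x" "{p..q}" "\<lambda>x. e * (\<bar>f x\<bar> + \<bar>g x\<bar>)"]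
            by (auto simp: has_integral_iff)
        qed (use \<delta> in auto)
      qed
      then show ?thesis using cd by auto
    qed
    have "\<bar>\<Phi> c d\<bar> \<le> 0 + e" if "e > 0" for e
    proof -
      have "N c d \<ge> 0" unfolding N_def
        by (intro integral_nonneg sub[OF fg]) auto
      then have "e / (N c d + 1) * N c d \<le> e" using that by (simp add: field_simps)
      then show ?thesis using small[of "e / (N c d + 1)"] that \<open>N c d \<ge> 0\<close> by auto
    qed
    then have "\<Phi> c d = 0" using field_le_epsilon[of "\<bar>\<Phi> c d\<bar>" 0] by auto
    then have "integral {c..d} ?h = F d * G d - F c * G c" by (simp add: \<Phi>_def)
    then show ?thesis using sub[OF h, of c d] cd by (auto simp: has_integral_iff)
  qed
  then show ?thesis unfolding primitive_on_def using h by auto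
qed

section \<open>Trigonometric polynomials\<close>

text \<open>Smoothness by a coinductive argument: in a set that is closed under differentiation all
  iterated derivatives stay in the set, hence are differentiable. Suited to functions known only
  through formulas or differential equations.\<close>

lemma smooth_closed_family:
  assumes "f \<in> G" and step: "\<And>g. g \<in> G \<Longrightarrow> \<exists>g'\<in>G. \<forall>x. (g has_real_derivative g' x) (at x)"
  shows "smooth f"
proof -
  have in_G: "(deriv ^^ i) f \<in> G" for i
  proof (induction i)
    case (Suc i)
    obtain g' where "g' \<in> G" "\<And>x. ((deriv ^^ i) f has_real_derivative g' x) (at x)"
      using step[OF Suc] by blast
    then have "deriv ((deriv ^^ i) f) = g'" using DERIV_imp_deriv by blast
    then show ?case using \<open>g' \<in> G\<close> by simp
  qed (use assms in simp)
  have diff: "(deriv ^^ i) f differentiable (at x)" for i x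
    using step[OF in_G[of i]] unfolding real_differentiable_def by blast
  have "continuous_on UNIV ((deriv ^^ k) f)" for k
    using diff differentiable_imp_continuous_within continuous_at_imp_continuous_on by blast
  then show ?thesis unfolding smooth_def C_k_def using diff by blast
qed

section \<open>Derivatives of smooth and of periodic functions\<close>

lemma C_k_derivative:
  assumes "C_k k f" "i < k"
  shows "((deriv ^^ i) f has_real_derivative (deriv ^^ Suc i) f x) (at x)"
  using assms DERIV_deriv_iff_real_differentiable[of "(deriv ^^ i) f" x] unfolding C_k_def by simp

lemma smooth_derivative:
  assumes "smooth f"
  shows "((deriv ^^ i) f has_real_derivative (deriv ^^ Suc i) f x) (at x)"
  by (rule C_k_derivative[of "Suc i"]) (use assms in \<open>simp_all add: smooth_def\<close>)

lemma smooth_has_derivative: "smooth f \<Longrightarrow> (f has_real_derivative deriv f x) (at x)"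
  using smooth_derivative[of f 0] by simp

lemma smooth_continuous_deriv: "smooth f \<Longrightarrow> continuous_on UNIV (deriv f)"
  using smooth_derivative[of f 1] by (auto intro!: continuous_at_imp_continuous_on DERIV_isCont)

lemma periodic_derivative:
  assumes "periodic X f" "\<And>x. (f has_real_derivative f' x) (at x)"
  shows "periodic X f'"
  unfolding periodic_def
proof
  fix x
  have "((\<lambda>x. f (x + X)) has_real_derivative f' (x + X)) (at x)"
    using DERIV_shift[of f "f' (x + X)" x X] assms(2) by simp
  moreover have "(\<lambda>x. f (x + X)) = f" using assms(1) by (auto simp: periodic_def)
  ultimately show "f' (x + X) = f' x" using DERIV_unique assms(2) by metis
qed

lemma smooth_continuous: "smooth f \<Longrightarrow> continuous_on S f"
  using smooth_has_derivative by (meson DERIV_isCont continuous_at_imp_continuous_on)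

lemma smooth_const: "smooth (\<lambda>_. c)"
  by (rule smooth_closed_family[of _ "range (\<lambda>c _. c)"]) (auto intro!: exI[of _ 0])

text \<open>Removing the mean makes the primitive periodic. Thus any test function is, up to a
  constant, the derivative of another test function, which is the starting point of the du
  Bois-Reymond arguments below.\<close>

lemma smooth_periodic_primitive:
  assumes X: "X > 0" and psi: "smooth \<psi>" "periodic X \<psi>"
  obtains \<Psi> where "smooth \<Psi>" "periodic X \<Psi>"
    "\<And>x. (\<Psi> has_real_derivative \<psi> x - integral {0..X} \<psi> / X) (at x)"
proof -
  define a where "a = integral {0..X} \<psi> / X"
  note cpsi = smooth_continuous[OF psi(1)]
  obtain \<Psi> where Psi: "\<Psi> 0 = 0" "\<And>x. (\<Psi> has_real_derivative \<psi> x - a) (at x)"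
    by (rule antiderivative_exists[OF continuous_on_diff[OF cpsi[of UNIV] continuous_on_const[of _ a]]]) (rule that)
  have h: "((\<lambda>x. \<psi> x - a) has_integral 0) {0..X}"
    using has_integral_diff[OF integrable_integral[OF integrable_continuous_real[OF cpsi]] has_integral_const_real[of a 0 X]] X
    by (simp add: a_def)
  have "periodic X \<Psi>"
    unfolding periodic_def
  proof
    fix x
    have "((\<lambda>x. \<psi> x - a) has_integral 0) {x..x + X}"
      by (rule periodic_has_integral_shift) (use X psi h in \<open>auto simp: periodic_def\<close>)
    moreover have "((\<lambda>x. \<psi> x - a) has_integral \<Psi> (x + X) - \<Psi> x) {x..x + X}"
      by (rule has_integral_of_derivative) (use X Psi in auto)
    ultimately have "\<Psi> (x + X) - \<Psi> x = 0" by (rule has_integral_unique[symmetric])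
    then show "\<Psi> (x + X) = \<Psi> x" by simp
  qed
  moreover have "smooth \<Psi>"
  proof (rule smooth_closed_family[of _ "insert \<Psi> (insert (\<lambda>x. \<psi> x - a) (range (\<lambda>i. (deriv ^^ Suc i) \<psi>)))"])
    fix g assume g: "g \<in> insert \<Psi> (insert (\<lambda>x. \<psi> x - a) (range (\<lambda>i. (deriv ^^ Suc i) \<psi>)))"
    have d: "\<forall>x. ((\<lambda>x. \<psi> x - a) has_real_derivative (deriv ^^ Suc 0) \<psi> x) (at x)"
      using smooth_derivative[OF psi(1), of 0] by (auto intro!: derivative_eq_intros)
    from g consider "g = \<Psi>" | "g = (\<lambda>x. \<psi> x - a)" | i where "g = (deriv ^^ Suc i) \<psi>" by auto
    then show "\<exists>g'\<in>insert \<Psi> (insert (\<lambda>x. \<psi> x - a) (range (\<lambda>i. (deriv ^^ Suc i) \<psi>))). \<forall>x. (g has_real_derivative g' x) (at x)"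
    proof cases
      case 1
      then show ?thesis using Psi(2) by (intro bexI[of _ "\<lambda>x. \<psi> x - a"]) auto
    next
      case 2
      then show ?thesis using d rangeI[of "\<lambda>i. (deriv ^^ Suc i) \<psi>" 0] by blast
    next
      case 3
      then show ?thesis using smooth_derivative[OF psi(1), of "Suc i"] rangeI[of "\<lambda>i. (deriv ^^ Suc i) \<psi>" "Suc i"] by blast
    qed
  qed simp
  ultimately show ?thesis using that Psi(2) unfolding a_def by blast
qed

text \<open>Polynomials in cosine and sine are written as real polynomials restricted to the unit
  circle, the form in which the Stone-Weierstrass theorem applies.\<close>

definition trig_polys :: "real \<Rightarrow> (real \<Rightarrow> real) set" where
  "trig_polys X = {\<lambda>x. p (cis (2 * pi * x / X)) | p. real_polynomial_function p}"

text \<open>Differentiating \<open>cis\<close> multiplies it by an imaginary constant, which turns a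
  linear functional into another linear functional; sums and products follow from the usual
  rules.\<close>

lemma trig_polys_derivative:
  assumes "g \<in> trig_polys X"
  shows "\<exists>g'\<in>trig_polys X. \<forall>x. (g has_real_derivative g' x) (at x)"
proof -
  let ?e = "\<lambda>x. cis (2 * pi * x / X)"
  obtain p where p: "real_polynomial_function p" "g = (\<lambda>x. p (?e x))"
    using assms unfolding trig_polys_def by blast
  have "\<exists>p'. real_polynomial_function p' \<and> (\<forall>x. ((\<lambda>x. p (?e x)) has_real_derivative p' (?e x)) (at x))"
    using p(1)
  proof (induction p rule: real_polynomial_function.induct)
    case (linear f)
    have "bounded_linear (\<lambda>z. f (complex_of_real (2 * pi / X) * \<i> * z))"
      by (rule bounded_linear_compose[OF linear bounded_linear_mult_right])
    moreover have "((\<lambda>x. f (?e x)) has_real_derivative f (complex_of_real (2 * pi / X) * \<i> * ?e x)) (at x)" for x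
    proof -
      have "(?e has_vector_derivative complex_of_real (2 * pi / X) * \<i> * ?e x) (at x)"
        using exp_scaleR_has_vector_derivative_right[of "complex_of_real (2 * pi / X) * \<i>" x UNIV]
        by (simp add: cis_conv_exp scaleR_conv_of_real mult_ac)
      from bounded_linear.has_vector_derivative[OF linear this]
      show ?thesis by (simp add: has_real_derivative_iff_has_vector_derivative o_def)
    qed
    ultimately show ?case
      by (intro exI[of _ "\<lambda>z. f (complex_of_real (2 * pi / X) * \<i> * z)"] conjI allI real_polynomial_function.intros(1))
  next
    case (const c)
    then show ?case by (intro exI[of _ "\<lambda>_. 0"]) (auto intro: real_polynomial_function.intros(2))
  next
    case (add f g)
    then obtain f' g' where "real_polynomial_function f'" "real_polynomial_function g'"
      "\<And>x. ((\<lambda>x. f (?e x)) has_real_derivative f' (?e x)) (at x)"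
      "\<And>x. ((\<lambda>x. g (?e x)) has_real_derivative g' (?e x)) (at x)" by blast
    then show ?case
      by (intro exI[of _ "\<lambda>z. f' z + g' z"]) (auto intro!: derivative_intros real_polynomial_function.intros(3))
  next
    case (mult f g)
    then obtain f' g' where "real_polynomial_function f'" "real_polynomial_function g'"
      "\<And>x. ((\<lambda>x. f (?e x)) has_real_derivative f' (?e x)) (at x)"
      "\<And>x. ((\<lambda>x. g (?e x)) has_real_derivative g' (?e x)) (at x)" by blast
    then show ?case using mult.hyps
      by (intro exI[of _ "\<lambda>z. f z * g' z + f' z * g z"])
         (auto intro!: derivative_eq_intros real_polynomial_function.intros(3,4))
  qed
  then obtain p' where "real_polynomial_function p'"
    "\<And>x. ((\<lambda>x. p (?e x)) has_real_derivative p' (?e x)) (at x)" by blast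
  then show ?thesis unfolding p(2) trig_polys_def
    by (intro bexI[of _ "\<lambda>x. p' (?e x)"]) auto
qed

lemma trig_polys_smooth: "g \<in> trig_polys X \<Longrightarrow> smooth g"
  by (rule smooth_closed_family) (use trig_polys_derivative in auto)

lemma trig_polys_periodic:
  assumes "g \<in> trig_polys X" "X \<noteq> 0"
  shows "periodic X g"
proof -
  have "2 * pi * (x + X) / X = 2 * pi * x / X + 2 * pi" for x using assms by (simp add: field_simps)
  then have "cis (2 * pi * (x + X) / X) = cis (2 * pi * x / X)" for x by (simp flip: cis_mult)
  then show ?thesis using assms unfolding trig_polys_def periodic_def by auto
qed

lemma trig_polys_dense:
  assumes X: "X > 0" and f: "continuous_on {0..X} f" "f 0 = f X" and "e > 0"
  obtains g where "g \<in> trig_polys X" "\<And>x. x \<in> {0..X} \<Longrightarrow> \<bar>f x - g x\<bar> < e"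
proof -
  let ?p = "\<lambda>t. f (X * t)"
  have "path ?p" unfolding path_def
    by (intro continuous_on_compose2[OF f(1)] continuous_intros) (use X in \<open>auto intro: mult_left_le\<close>)
  \<comment> \<open>A loop is homotopic to itself; read as a statement about maps of the circle,
    this gives continuity of the induced function also at the point 1, where \<open>Arg2pi\<close>
    jumps.\<close>
  then have "homotopic_loops UNIV ?p ?p"
    using f(2) by (simp add: homotopic_loops_refl pathfinish_def pathstart_def)
  then have c: "continuous_on (sphere (0::complex) 1) (?p \<circ> (\<lambda>z. Arg2pi z / (2 * pi)))"
    by (metis homotopic_loops_imp_homotopic_circlemaps homotopic_with_imp_continuous)
  obtain g where g: "real_polynomial_function g"
    "\<And>z. z \<in> sphere 0 1 \<Longrightarrow> \<bar>(?p \<circ> (\<lambda>z. Arg2pi z / (2 * pi))) z - g z\<bar> < e"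
    using Stone_Weierstrass_real_polynomial_function[OF compact_sphere c \<open>e > 0\<close>] by blast
  show ?thesis
  proof (rule that[of "\<lambda>x. g (cis (2 * pi * x / X))"])
    show "(\<lambda>x. g (cis (2 * pi * x / X))) \<in> trig_polys X" unfolding trig_polys_def using g(1) by blast
    fix x assume x: "x \<in> {0..X}"
    show "\<bar>f x - g (cis (2 * pi * x / X))\<bar> < e"
    \<comment> \<open>At \<open>X\<close> the argument has jumped back to 0, and
      \<open>f 0 = f X\<close> is what saves the estimate.\<close>
    proof (cases "x = X")
      case True
      have "cis (2 * pi * x / X) = 1" using X True by simp
      moreover have "Arg2pi 1 = 0" using Arg2pi_of_real[of 1] by simp
      ultimately show ?thesis using g(2)[of 1] True f(2) by simp
    next
      case False
      then have "0 \<le> 2 * pi * x / X" "2 * pi * x / X < 2 * pi" using x X by (auto simp: field_simps)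
      then have "Arg2pi (cis (2 * pi * x / X)) = 2 * pi * x / X"
        by (intro Arg2pi_unique[of 1]) (auto simp: cis_conv_exp)
      then show ?thesis using g(2)[of "cis (2 * pi * x / X)"] X by simp
    qed
  qed
qed

text \<open>Lebesgue differentiation: off a null set the function is the limit of its averages, all
  of which vanish. It is cut off outside the interval so that averages reaching beyond the end point
  vanish as well.\<close>

lemma zero_primitive_imp_zero_ae:
  fixes v :: "real \<Rightarrow> real"
  assumes "\<And>c d. a \<le> c \<Longrightarrow> c \<le> d \<Longrightarrow> d \<le> b \<Longrightarrow> (v has_integral 0) {c..d}"
  obtains N where "negligible N" "\<And>x. x \<in> {a..b} \<Longrightarrow> x \<notin> N \<Longrightarrow> v x = 0"
proof -
  let ?w = "\<lambda>x. if x \<in> {a..b} then v x else 0"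
  have w: "(?w has_integral 0) {c..d}" for c d
  proof -
    have "{a..b} \<inter> {c..d} = {max a c..min b d}" by auto
    moreover have "(v has_integral 0) {max a c..min b d}"
      by (cases "max a c \<le> min b d") (auto intro: assms)
    ultimately show ?thesis using has_integral_restrict_Int[of "{a..b}" v 0 "{c..d}"] by simp
  qed
  then have "\<And>c d. ?w integrable_on cbox c d" by (auto simp: integrable_on_def)
  then obtain N where N: "negligible N"
    "\<And>x e. x \<notin> N \<Longrightarrow> 0 < e \<Longrightarrow> \<exists>d>0. \<forall>h. 0 < h \<and> h < d \<longrightarrow>
        norm (integral (cbox x (x + h *\<^sub>R One)) ?w /\<^sub>R h ^ DIM(real) - ?w x) < e"
    using integrable_ccontinuous_explicit[of ?w] by auto
  show ?thesis
  proof (rule that[OF N(1)])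
    fix x assume x: "x \<in> {a..b}" "x \<notin> N"
    have "\<bar>?w x\<bar> < e" if "e > 0" for e
    proof -
      obtain d where d: "d > 0" "\<And>h. 0 < h \<Longrightarrow> h < d \<Longrightarrow> norm (integral (cbox x (x + h *\<^sub>R One)) ?w /\<^sub>R h ^ DIM(real) - ?w x) < e"
        using N(2)[OF x(2) \<open>e > 0\<close>] by blast
      show ?thesis using d(2)[of "d / 2"] d(1) integral_unique[OF w[of x "x + d / 2"]] by simp
    qed
    from this[of "\<bar>?w x\<bar>"] show "v x = 0" using x by (cases "v x = 0") auto
  qed
qed

text \<open>The primitive of \<open>v\<close> is orthogonal to all trigonometric polynomials of mean zero, hence
  constant.\<close>

lemma orthogonal_trig_polys_imp_zero_ae:
  fixes v :: "real \<Rightarrow> real"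
  assumes X: "X > 0" and v: "v absolutely_integrable_on {0..X}"
    and orth: "\<And>\<phi>. smooth \<phi> \<Longrightarrow> periodic X \<phi> \<Longrightarrow> integral {0..X} (\<lambda>x. v x * \<phi> x) = 0"
  obtains N where "negligible N" "\<And>x. x \<in> {0..X} \<Longrightarrow> x \<notin> N \<Longrightarrow> v x = 0"
proof -
  define U where "U x = integral {0..x} v" for x
  have vint: "v integrable_on {c..d}" if "0 \<le> c" "d \<le> X" for c d
    by (rule integrable_subinterval_real[of v 0 X]) (use that v in \<open>auto intro: set_lebesgue_integral_eq_integral(1)\<close>)
  have PU: "primitive_on 0 X U v"
    unfolding primitive_on_def
  proof (intro conjI v allI impI; elim conjE)
    fix c d :: real assume cd: "0 \<le> c" "c \<le> d" "d \<le> X"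
    have "U c + integral {c..d} v = U d"
      unfolding U_def by (rule Henstock_Kurzweil_Integration.integral_combine) (use cd vint in auto)
    moreover have "(v has_integral integral {c..d} v) {c..d}" using vint cd by auto
    ultimately show "(v has_integral U d - U c) {c..d}" by (metis add_diff_cancel_left')
  qed
  have "U X = 0" using smooth_const orth[of "\<lambda>_. 1"] by (simp add: U_def periodic_def)
  have "U 0 = 0" by (simp add: U_def)
  have cU: "continuous_on {0..X} U" using primitive_on_continuous[OF PU] .
  have cint: "f integrable_on {0..X}" if "continuous_on {0..X} f" for f :: "real \<Rightarrow> real"
    using that by (rule integrable_continuous_real)
  define m where "m = integral {0..X} U / X"
  have mint: "integral {0..X} (\<lambda>x. U x - m) = 0"
    using X integral_diff[OF cint[OF cU] integrable_const_ivl, of m] by (simp add: m_def)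
  \<comment> \<open>Integration by parts moves the orthogonality of \<open>v\<close> to its
    primitive \<open>U\<close>. The periodic primitive of \<psi> exists only after subtracting the
    mean \<open>a\<close>, and the subtraction of \<open>m\<close> from \<open>U\<close> absorbs
    this correction.\<close>
  have orthU: "integral {0..X} (\<lambda>x. (U x - m) * \<psi> x) = 0" if psi: "\<psi> \<in> trig_polys X" for \<psi>
  proof -
    have spsi: "smooth \<psi>" "periodic X \<psi>" using trig_polys_smooth trig_polys_periodic psi X by auto
    note cpsi = smooth_continuous[OF spsi(1)]
    define a where "a = integral {0..X} \<psi> / X"
    obtain \<Psi> where Psi: "smooth \<Psi>" "periodic X \<Psi>" "\<And>x. (\<Psi> has_real_derivative \<psi> x - a) (at x)"
      using smooth_periodic_primitive[OF X spsi] unfolding a_def by blast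
    have "integral {0..X} (\<lambda>x. v x * \<Psi> x) = 0" using orth Psi by blast
    have "primitive_on 0 X \<Psi> (\<lambda>x. \<psi> x - a)"
      by (intro primitive_on_derivative Psi(3) continuous_intros cpsi)
    from primitive_on_mult[OF PU this]
    have h: "((\<lambda>x. v x * \<Psi> x + U x * (\<psi> x - a)) has_integral 0) {0..X}"
      using X \<open>U X = 0\<close> \<open>U 0 = 0\<close> by (auto dest: primitive_on_integral[of 0 X _ _ 0 X])
    have i: "(\<lambda>x. U x * (\<psi> x - a)) integrable_on {0..X}" "(\<lambda>x. U x * \<psi> x) integrable_on {0..X}"
      "(\<lambda>x. m * \<psi> x) integrable_on {0..X}" "(\<lambda>x. a * U x) integrable_on {0..X}"
      by (intro cint continuous_intros cU cpsi)+
    have "(\<lambda>x. v x * \<Psi> x) integrable_on {0..X}"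
      using integrable_diff[OF _ i(1), of "\<lambda>x. v x * \<Psi> x + U x * (\<psi> x - a)"] h by auto
    then have "integral {0..X} (\<lambda>x. U x * (\<psi> x - a)) = 0"
      using integral_unique[OF h] integral_add[OF _ i(1), of "\<lambda>x. v x * \<Psi> x"]
        \<open>integral {0..X} (\<lambda>x. v x * \<Psi> x) = 0\<close> by simp
    moreover have "(\<lambda>x. U x * (\<psi> x - a)) = (\<lambda>x. U x * \<psi> x - a * U x)" by (auto simp: algebra_simps)
    ultimately have "integral {0..X} (\<lambda>x. U x * \<psi> x) = a * integral {0..X} U"
      using integral_diff[OF i(2) i(4)] by simp
    moreover have "integral {0..X} (\<lambda>x. m * \<psi> x) = a * integral {0..X} U"
      using X by (simp add: a_def m_def)
    ultimately show ?thesis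
      using integral_diff[OF i(2) i(3)] by (simp add: left_diff_distrib)
  qed
  let ?W = "\<lambda>x. U x - m"
  have cW: "continuous_on {0..X} ?W" by (intro continuous_intros cU)
  \<comment> \<open>Since \<open>?W\<close> is orthogonal to every trigonometric polynomial, the
    integral of its square equals that of \<open>?W * (?W - \<psi>)\<close>, which is small for a
    good uniform approximation \<psi>.\<close>
  have "integral {0..X} (\<lambda>x. ?W x * ?W x) \<le> 0 + e" if e: "e > 0" for e
  proof -
    define I where "I = integral {0..X} (\<lambda>x. \<bar>?W x\<bar>)"
    have "I \<ge> 0" unfolding I_def by (intro integral_nonneg cint continuous_intros cU) auto
    then have "e / (I + 1) > 0" using e by simp
    then obtain \<psi> where psi: "\<psi> \<in> trig_polys X" "\<And>x. x \<in> {0..X} \<Longrightarrow> \<bar>?W x - \<psi> x\<bar> < e / (I + 1)"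
      using trig_polys_dense[OF X cW, of "e / (I + 1)"] \<open>U X = 0\<close> \<open>U 0 = 0\<close> by auto
    note cpsi = smooth_continuous[OF trig_polys_smooth[OF psi(1)]]
    have "integral {0..X} (\<lambda>x. ?W x * ?W x) = integral {0..X} (\<lambda>x. ?W x * ?W x - ?W x * \<psi> x)"
      by (subst integral_diff) (use orthU[OF psi(1)] in \<open>auto intro!: cint continuous_intros cU cpsi\<close>)
    also have "\<dots> \<le> integral {0..X} (\<lambda>x. e / (I + 1) * \<bar>?W x\<bar>)"
    proof (rule integral_le)
      fix x assume "x \<in> {0..X}"
      have "?W x * ?W x - ?W x * \<psi> x \<le> \<bar>?W x * (?W x - \<psi> x)\<bar>"
        by (simp add: algebra_simps)
      also have "\<dots> = \<bar>?W x - \<psi> x\<bar> * \<bar>?W x\<bar>" by (simp add: abs_mult)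
      also have "\<dots> \<le> e / (I + 1) * \<bar>?W x\<bar>"
        using psi(2)[OF \<open>x \<in> {0..X}\<close>] by (intro mult_right_mono) auto
      finally show "?W x * ?W x - ?W x * \<psi> x \<le> e / (I + 1) * \<bar>?W x\<bar>" .
    qed (intro cint continuous_intros cU cpsi)+
    also have "\<dots> = e * (I / (I + 1))" by (simp add: I_def)
    also have "\<dots> \<le> e" using e \<open>I \<ge> 0\<close> by (simp add: field_simps)
    finally show ?thesis by simp
  qed
  then have "integral {0..X} (\<lambda>x. ?W x * ?W x) \<le> 0" by (rule field_le_epsilon)
  moreover have "integral {0..X} (\<lambda>x. ?W x * ?W x) \<ge> 0"
    by (intro integral_nonneg cint continuous_intros cU) auto
  ultimately have "((\<lambda>x. ?W x * ?W x) has_integral 0) {0..X}"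
    using cint[OF continuous_on_mult[OF cW cW]] unfolding has_integral_iff by auto
  then have W0: "?W x = 0" if "x \<in> {0..X}" for x
    using has_integral_0_cbox_imp_0[of 0 X "\<lambda>x. ?W x * ?W x" x] that X continuous_on_mult[OF cW cW]
    by simp
  then have U0: "U x = 0" if "x \<in> {0..X}" for x using W0[of 0] W0[OF that] \<open>U 0 = 0\<close> X by auto
  have "(v has_integral 0) {c..d}" if "0 \<le> c" "c \<le> d" "d \<le> X" for c d
    using primitive_on_integral[OF PU, of c d] U0[of c] U0[of d] that by simp
  then obtain N where "negligible N" "\<And>x. x \<in> {0..X} \<Longrightarrow> x \<notin> N \<Longrightarrow> v x = 0"
    using zero_primitive_imp_zero_ae[of 0 X v] by auto
  then show ?thesis by (rule that)
qed

section \<open>Weak derivatives on the circle\<close>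

lemma absolutely_integrable_imp_integrable_on:
  fixes f :: "real \<Rightarrow> real"
  shows "f absolutely_integrable_on S \<Longrightarrow> f integrable_on S"
  by (simp add: absolutely_integrable_on_def)

lemma L2_circle_measurable: "u \<in> L2_circle X \<Longrightarrow> u \<in> borel_measurable (lebesgue_on {0..X})"
  unfolding L2_circle_def by (auto intro: measurable_restrict_space1)

lemma L2_circle_absolutely_integrable:
  assumes "u \<in> L2_circle X"
  shows "u absolutely_integrable_on {0..X}"
proof (rule measurable_bounded_by_integrable_imp_absolutely_integrable)
  show "u \<in> borel_measurable (lebesgue_on {0..X})" by (rule L2_circle_measurable[OF assms])
  show "(\<lambda>x. 1 + (u x)\<^sup>2) integrable_on {0..X}"
    using assms unfolding L2_circle_def
    by (intro integrable_add) (auto intro: absolutely_integrable_imp_integrable_on)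
  fix x
  have "0 \<le> (\<bar>u x\<bar> - 1)\<^sup>2 + \<bar>u x\<bar>" by simp
  then have "\<bar>u x\<bar> \<le> 1 + \<bar>u x\<bar>\<^sup>2" by (simp add: power2_diff)
  then show "norm (u x) \<le> 1 + (u x)\<^sup>2" by simp
qed auto

lemma L2_circle_mult_continuous:
  assumes "u \<in> L2_circle X" "continuous_on {0..X} f"
  shows "(\<lambda>x. f x * u x) absolutely_integrable_on {0..X}"
  using absolutely_integrable_continuous_mult assms L2_circle_absolutely_integrable by blast

lemma L2_circle_continuous:
  assumes "continuous_on UNIV u" "periodic X u"
  shows "u \<in> L2_circle X"
proof -
  have "(\<lambda>x. (u x)\<^sup>2) absolutely_integrable_on {0..X}"
    by (intro absolutely_integrable_continuous_real continuous_intros continuous_on_subset[OF assms(1)]) auto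
  moreover have "u \<in> borel_measurable lebesgue"
    using borel_measurable_continuous_onI[OF assms(1)] by (intro measurable_completion) simp
  ultimately show ?thesis using assms unfolding L2_circle_def by auto
qed

lemma L2_circle_add_cmult:
  assumes "u \<in> L2_circle X" "v \<in> L2_circle X"
  shows "(\<lambda>x. u x + c * v x) \<in> L2_circle X"
proof -
  have m: "u \<in> borel_measurable lebesgue" "v \<in> borel_measurable lebesgue"
    using assms unfolding L2_circle_def by auto
  have "(\<lambda>x. (u x + c * v x)\<^sup>2) absolutely_integrable_on {0..X}"
  proof (rule measurable_bounded_by_integrable_imp_absolutely_integrable)
    show "(\<lambda>x. (u x + c * v x)\<^sup>2) \<in> borel_measurable (lebesgue_on {0..X})"
      using assms[THEN L2_circle_measurable] by measurable
    show "(\<lambda>x. 2 * (u x)\<^sup>2 + (2 * c\<^sup>2) * (v x)\<^sup>2) integrable_on {0..X}"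
      using assms unfolding L2_circle_def
      by (intro integrable_add integrable_on_mult_right) (auto intro: absolutely_integrable_imp_integrable_on)
    fix x
    have "0 \<le> (u x - c * v x)\<^sup>2" by simp
    then have "(u x + c * v x)\<^sup>2 \<le> 2 * (u x)\<^sup>2 + (2 * c\<^sup>2) * (v x)\<^sup>2"
      by (simp add: power2_eq_square algebra_simps)
    then show "norm ((u x + c * v x)\<^sup>2) \<le> 2 * (u x)\<^sup>2 + (2 * c\<^sup>2) * (v x)\<^sup>2" by simp
  qed auto
  moreover have "(\<lambda>x. u x + c * v x) \<in> borel_measurable lebesgue" using m by measurable
  ultimately show ?thesis using assms unfolding L2_circle_def periodic_def by auto
qed

text \<open>The difference of two candidates annihilates every periodic test function, hence
  vanishes almost everywhere.\<close>

lemma has_weak_deriv_unique: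
  assumes X: "X > 0" and v: "v1 \<in> L2_circle X" "v2 \<in> L2_circle X"
    and w: "has_weak_deriv X u v1" "has_weak_deriv X u v2"
  obtains N where "negligible N" "\<And>x. x \<in> {0..X} \<Longrightarrow> x \<notin> N \<Longrightarrow> v1 x = v2 x"
proof -
  have "(\<lambda>x. v1 x - v2 x) absolutely_integrable_on {0..X}"
    using v[THEN L2_circle_absolutely_integrable] by (rule set_integral_diff)
  moreover have "integral {0..X} (\<lambda>x. (v1 x - v2 x) * \<phi> x) = 0" if "smooth \<phi>" "periodic X \<phi>" for \<phi>
  proof -
    note c = smooth_continuous[OF that(1)]
    have "(\<lambda>x. v x * \<phi> x) integrable_on {0..X}" if "v \<in> L2_circle X" for v
      using absolutely_integrable_imp_integrable_on[OF L2_circle_mult_continuous[OF that c]]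
      by (simp add: mult.commute)
    then show ?thesis
      using w v that unfolding has_weak_deriv_def
      by (simp add: left_diff_distrib integral_diff)
  qed
  ultimately obtain N where "negligible N" "\<And>x. x \<in> {0..X} \<Longrightarrow> x \<notin> N \<Longrightarrow> v1 x - v2 x = 0"
    using orthogonal_trig_polys_imp_zero_ae[OF X, of "\<lambda>x. v1 x - v2 x"] by blast
  then show ?thesis using that by auto
qed

text \<open>Frees the energy from the choice made in \<open>weak_deriv\<close>. The function under
  \<open>H\<close> may also be changed on a null set, so that a continuous representative can be
  inserted.\<close>

lemma energy_eqI:
  assumes X: "X > 0" and v: "v \<in> L2_circle X" "has_weak_deriv X l v"
    and N: "negligible N" "\<And>x. x \<in> {0..X} \<Longrightarrow> x \<notin> N \<Longrightarrow> l x = L x"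
  shows "energy H X l = integral {0..X} (\<lambda>x. (v x)\<^sup>2 / 2 - H (L x))"
proof -
  have "weak_deriv X l \<in> L2_circle X \<and> has_weak_deriv X l (weak_deriv X l)"
    unfolding weak_deriv_def by (rule someI[of _ v]) (use v in simp)
  then obtain M where M: "negligible M" "\<And>x. x \<in> {0..X} \<Longrightarrow> x \<notin> M \<Longrightarrow> weak_deriv X l x = v x"
    using has_weak_deriv_unique[OF X _ v(1) _ v(2)] by blast
  have "negligible (M \<union> N)" using M N by auto
  then show ?thesis unfolding energy_def
    by (rule integral_spike) (use M(2) N(2) in auto)
qed

lemma primitive_on_has_weak_deriv:
  assumes "primitive_on 0 X U v" "U X = U 0" "X > 0"
  shows "has_weak_deriv X U v"
  unfolding has_weak_deriv_def
proof (intro allI impI; elim conjE)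
  fix \<phi> assume phi: "smooth \<phi>" "periodic X \<phi>"
  note c = smooth_continuous[OF phi(1)]
  have c': "continuous_on S (deriv \<phi>)" for S
    using smooth_continuous_deriv[OF phi(1)] continuous_on_subset by blast
  have "primitive_on 0 X \<phi> (deriv \<phi>)"
    by (rule primitive_on_derivative) (use smooth_has_derivative[OF phi(1)] c' in auto)
  from primitive_on_integral[OF primitive_on_mult[OF assms(1) this], of 0 X]
  have h: "((\<lambda>x. v x * \<phi> x + U x * deriv \<phi> x) has_integral 0) {0..X}"
    using assms(2,3) phi(2)[unfolded periodic_def, rule_format, of 0] by simp
  have "(\<lambda>x. \<phi> x * v x) integrable_on {0..X}"
    using assms(1) unfolding primitive_on_def
    by (intro absolutely_integrable_imp_integrable_on absolutely_integrable_continuous_mult c) auto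
  moreover have "(\<lambda>x. U x * deriv \<phi> x) integrable_on {0..X}"
    by (intro integrable_continuous_real continuous_intros c' primitive_on_continuous[OF assms(1)])
  ultimately show "integral {0..X} (\<lambda>x. U x * deriv \<phi> x) = - integral {0..X} (\<lambda>x. v x * \<phi> x)"
    using integral_unique[OF h] integral_add[of "\<lambda>x. v x * \<phi> x" "{0..X}" "\<lambda>x. U x * deriv \<phi> x"]
    by (simp add: mult.commute)
qed

lemma has_weak_deriv_add_cmult:
  assumes "u1 \<in> L2_circle X" "v1 \<in> L2_circle X" "u2 \<in> L2_circle X" "v2 \<in> L2_circle X"
    "has_weak_deriv X u1 v1" "has_weak_deriv X u2 v2"
  shows "has_weak_deriv X (\<lambda>x. u1 x + c * u2 x) (\<lambda>x. v1 x + c * v2 x)"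
  unfolding has_weak_deriv_def
proof (intro allI impI; elim conjE)
  fix \<phi> assume phi: "smooth \<phi>" "periodic X \<phi>"
  note cont = smooth_continuous[OF phi(1)]
  have cont': "continuous_on {0..X} (deriv \<phi>)"
    using smooth_continuous_deriv[OF phi(1)] continuous_on_subset by blast
  have i: "(\<lambda>x. u x * \<phi> x) integrable_on {0..X}" "(\<lambda>x. u x * deriv \<phi> x) integrable_on {0..X}"
    if "u \<in> L2_circle X" for u
    using L2_circle_mult_continuous[OF that cont] L2_circle_mult_continuous[OF that cont']
    by (auto simp: mult.commute intro: absolutely_integrable_imp_integrable_on)
  have lin: "integral {0..X} (\<lambda>x. (f x + c * g x) * \<psi> x) =
     integral {0..X} (\<lambda>x. f x * \<psi> x) + c * integral {0..X} (\<lambda>x. g x * \<psi> x)"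
    if "(\<lambda>x. f x * \<psi> x) integrable_on {0..X}" "(\<lambda>x. g x * \<psi> x) integrable_on {0..X}"
    for f g \<psi> :: "real \<Rightarrow> real"
    using integral_add[OF that(1) integrable_on_mult_right[OF that(2), of c]]
    by (simp add: distrib_right mult.assoc)
  have e: "integral {0..X} (\<lambda>x. u1 x * deriv \<phi> x) = - integral {0..X} (\<lambda>x. v1 x * \<phi> x)"
     "integral {0..X} (\<lambda>x. u2 x * deriv \<phi> x) = - integral {0..X} (\<lambda>x. v2 x * \<phi> x)"
    using assms(5,6) phi unfolding has_weak_deriv_def by blast+
  show "integral {0..X} (\<lambda>x. (u1 x + c * u2 x) * deriv \<phi> x) =
       - integral {0..X} (\<lambda>x. (v1 x + c * v2 x) * \<phi> x)"
    using assms(1-4) by (simp add: lin i e)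
qed

text \<open>The representative is a primitive of the weak derivative plus a constant. It is periodic
  because the weak derivative has mean zero, and its difference to \<open>u\<close> has weak
  derivative zero, hence is constant almost everywhere.\<close>

lemma H1_circle_representative:
  assumes X: "X > 0" and u: "u \<in> H1_circle X"
  obtains U v N where "periodic X U" "v \<in> L2_circle X" "\<And>a b. primitive_on a b U v"
    "has_weak_deriv X u v" "negligible N" "\<And>x. x \<in> {0..X} \<Longrightarrow> x \<notin> N \<Longrightarrow> u x = U x"
proof -
  obtain v where v: "v \<in> L2_circle X" "has_weak_deriv X u v" and uL: "u \<in> L2_circle X"
    using u unfolding H1_circle_def by blast
  have pv: "periodic X v" using v(1) unfolding L2_circle_def by auto
  have pu: "periodic X u" using uL unfolding L2_circle_def by auto
  have va: "v absolutely_integrable_on {0..X}" by (rule L2_circle_absolutely_integrable[OF v(1)])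
  note shift = periodic_absolutely_integrable_shift[OF X pv va]
  \<comment> \<open>The period will later be cut at an arbitrary point, so integrability is needed
    on all intervals.\<close>
  have long: "v absolutely_integrable_on {a..a + real n * X}" for a n
  proof (induction n)
    case 0
    then show ?case using absolutely_integrable_continuous_real[of a a v] by simp
  next
    case (Suc n)
    have "v absolutely_integrable_on ({a..a + real n * X} \<union> {a + real n * X..a + real n * X + X})"
      by (rule set_integrable_Un) (use Suc shift in auto)
    moreover have "{a..a + real n * X} \<union> {a + real n * X..a + real n * X + X} = {a..a + real (Suc n) * X}"
      using X mult_nonneg_nonneg[of "real n" X] by (auto simp: distrib_right simp del: mult_nonneg_nonneg)
    ultimately show ?case by simp
  qed
  have vab: "v absolutely_integrable_on {a..b}" for a b
  proof -
    obtain n where "b - a < real n * X" using ex_less_of_nat_mult[OF X] by blast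
    then show ?thesis by (intro set_integrable_subset[OF long[of a n]]) auto
  qed
  have vint: "v integrable_on {a..b}" for a b
    by (rule absolutely_integrable_imp_integrable_on[OF vab])
  \<comment> \<open>One of the two intervals is empty or a point and contributes 0; the other one
    carries the sign of the oriented integral.\<close>
  define V where "V x = integral {0..x} v - integral {x..0} v" for x
  have V: "integral {a..b} v = V b - V a" if "a \<le> b" for a b
  proof -
    note c = Henstock_Kurzweil_Integration.integral_combine[OF _ _ vint]
    consider "0 \<le> a" | "b \<le> 0" | "a < 0" "0 < b" by linarith
    then show ?thesis
    proof cases
      case 1 then show ?thesis using c[of 0 a b] that unfolding V_def
        by (cases "a = 0"; cases "b = 0") auto
    next
      case 2 then show ?thesis using c[of a b 0] that unfolding V_def
        by (cases "a = 0"; cases "b = 0") auto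
    next
      case 3 then show ?thesis using c[of a 0 b] that unfolding V_def by auto
    qed
  qed
  have PV: "primitive_on a b V v" for a b
    unfolding primitive_on_def using vab V vint by (auto simp: has_integral_iff)
  \<comment> \<open>Testing with the constant 1 shows that a weak derivative on the circle has mean
    zero.\<close>
  have "integral {0..X} (\<lambda>x. u x * deriv (\<lambda>_. 1) x) = - integral {0..X} (\<lambda>x. v x * 1)"
    using v(2) smooth_const[of 1] unfolding has_weak_deriv_def periodic_def by blast
  then have v0: "integral {0..X} v = 0" by simp
  have pV: "periodic X V" unfolding periodic_def
  proof
    fix x
    have "(v has_integral 0) {x..x + X}"
      using periodic_has_integral_shift[OF X pv, of 0] v0 vint by (metis has_integral_iff)
    then show "V (x + X) = V x" using V[of x "x + X"] X by (simp add: integral_unique)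
  qed
  have cV: "continuous_on UNIV V"
  proof (rule continuous_at_imp_continuous_on, safe)
    fix x
    have "continuous_on {x - 1..x + 1} V" by (rule primitive_on_continuous[OF PV])
    then show "isCont V x" by (rule continuous_on_interior) auto
  qed
  have VL: "V \<in> L2_circle X" by (rule L2_circle_continuous[OF cV pV])
  have wV: "has_weak_deriv X V v"
    by (rule primitive_on_has_weak_deriv[OF PV _ X]) (use pV[unfolded periodic_def, rule_format, of 0] in simp)
  have uV: "(\<lambda>x. u x + (-1) * V x) \<in> L2_circle X" by (rule L2_circle_add_cmult[OF uL VL])
  define m where "m = integral {0..X} (\<lambda>x. u x + (-1) * V x) / X"
  have zero: "has_weak_deriv X (\<lambda>x. u x + (-1) * V x) (\<lambda>x. v x + (-1) * v x)"
    by (rule has_weak_deriv_add_cmult[OF uL v(1) VL v(1) v(2) wV])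
  \<comment> \<open>A test function minus its mean is the derivative of a periodic test function, so
    the vanishing weak derivative of \<open>u - V\<close> makes \<open>u - V - m\<close> orthogonal
    to all test functions.\<close>
  have "integral {0..X} (\<lambda>x. (u x + (-1) * V x - m) * \<psi> x) = 0" if psi: "smooth \<psi>" "periodic X \<psi>" for \<psi>
  proof -
    note cpsi = smooth_continuous[OF that(1)]
    have cint: "f integrable_on {0..X}" if "continuous_on {0..X} f" for f :: "real \<Rightarrow> real"
      using that by (rule integrable_continuous_real)
    define a where "a = integral {0..X} \<psi> / X"
    obtain \<Psi> where Psi: "smooth \<Psi>" "periodic X \<Psi>" "\<And>x. (\<Psi> has_real_derivative \<psi> x - a) (at x)"
      using smooth_periodic_primitive[OF X psi] unfolding a_def by blast
    have "deriv \<Psi> = (\<lambda>x. \<psi> x - a)" using Psi(3) DERIV_imp_deriv by blast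
    then have o: "integral {0..X} (\<lambda>x. (u x + (-1) * V x) * (\<psi> x - a)) = 0"
      using zero Psi(1,2) unfolding has_weak_deriv_def by force
    let ?d = "\<lambda>x. u x + (-1) * V x"
    have i1: "(\<lambda>x. ?d x * \<psi> x) integrable_on {0..X}"
      using absolutely_integrable_imp_integrable_on[OF L2_circle_mult_continuous[OF uV cpsi]]
      by (simp add: mult.commute)
    have i2: "?d integrable_on {0..X}"
      using absolutely_integrable_imp_integrable_on[OF L2_circle_absolutely_integrable[OF uV]] .
    have "integral {0..X} (\<lambda>x. ?d x * \<psi> x - a * ?d x) = integral {0..X} (\<lambda>x. ?d x * \<psi> x) - a * integral {0..X} ?d"
      using integral_diff[OF i1 integrable_on_mult_right[OF i2, of a]] by simp
    moreover have "(\<lambda>x. ?d x * \<psi> x - a * ?d x) = (\<lambda>x. ?d x * (\<psi> x - a))" by (auto simp: algebra_simps)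
    ultimately have "integral {0..X} (\<lambda>x. ?d x * \<psi> x) = a * integral {0..X} ?d" using o by simp
    moreover have "integral {0..X} (\<lambda>x. ?d x * \<psi> x - m * \<psi> x) =
        integral {0..X} (\<lambda>x. ?d x * \<psi> x) - m * integral {0..X} \<psi>"
      using integral_diff[OF i1 integrable_on_mult_right[OF cint[OF cpsi], of m]] by simp
    moreover have "(\<lambda>x. ?d x * \<psi> x - m * \<psi> x) = (\<lambda>x. (?d x - m) * \<psi> x)" by (auto simp: algebra_simps)
    moreover have "a * integral {0..X} ?d = m * integral {0..X} \<psi>" by (simp add: a_def m_def)
    ultimately show ?thesis by simp
  qed
  moreover have "(\<lambda>x. u x + (-1) * V x - m) absolutely_integrable_on {0..X}"
    by (intro set_integral_diff L2_circle_absolutely_integrable[OF uV] absolutely_integrable_continuous_real) auto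
  ultimately obtain N where N: "negligible N" "\<And>x. x \<in> {0..X} \<Longrightarrow> x \<notin> N \<Longrightarrow> u x + (-1) * V x - m = 0"
    using orthogonal_trig_polys_imp_zero_ae[OF X, of "\<lambda>x. u x + (-1) * V x - m"] by blast
  show ?thesis
  proof (rule that[of "\<lambda>x. V x + m" v N])
    show "periodic X (\<lambda>x. V x + m)" using pV by (auto simp: periodic_def)
    show "primitive_on a b (\<lambda>x. V x + m) v" for a b using PV[of a b] by (simp add: primitive_on_def)
    show "u x = V x + m" if "x \<in> {0..X}" "x \<notin> N" for x using N(2)[OF that] by simp
  qed (use v N in auto)
qed

section \<open>The quadratic form of the second variation\<close>

text \<open>Picone's identity: \<open>v\<^sup>2 - c U\<^sup>2 = (v - (p'/p) U)\<^sup>2 + ((p'/p) U\<^sup>2)'\<close>.\<close>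

lemma picone_dirichlet:
  fixes U v p p' c :: "real \<Rightarrow> real"
  assumes ab: "a \<le> b" and U: "primitive_on a b U v" and v2: "(\<lambda>x. (v x)\<^sup>2) absolutely_integrable_on {a..b}"
    and bd: "U a = 0" "U b = 0" and c: "continuous_on {a..b} c"
    and p: "\<And>x. x \<in> {a..b} \<Longrightarrow> 0 < p x" "\<And>x. x \<in> {a..b} \<Longrightarrow> (p has_real_derivative p' x) (at x)"
      "\<And>x. x \<in> {a..b} \<Longrightarrow> (p' has_real_derivative - (c x * p x)) (at x)"
  obtains I where "((\<lambda>x. (v x)\<^sup>2 - c x * (U x)\<^sup>2) has_integral I) {a..b}" "0 \<le> I"
    "I = 0 \<Longrightarrow> \<forall>x\<in>{a..b}. U x = 0"
proof -
  define g where "g x = p' x / p x" for x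
  have cp: "continuous_on {a..b} p" "continuous_on {a..b} p'"
    using DERIV_isCont[OF p(2)] DERIV_isCont[OF p(3)] by (auto intro!: continuous_at_imp_continuous_on)
  have p0: "x \<in> {a..b} \<Longrightarrow> p x \<noteq> 0" for x using p(1)[of x] by auto
  have cg: "continuous_on {a..b} g" unfolding g_def
    by (intro continuous_intros cp) (use p0 in auto)
  have cU: "continuous_on {a..b} U" by (rule primitive_on_continuous[OF U])
  have va: "v absolutely_integrable_on {a..b}" using U unfolding primitive_on_def by auto
  have "primitive_on a b g (\<lambda>x. - c x - (g x)\<^sup>2)"
  proof (rule primitive_on_derivative)
    fix x assume "a \<le> x" "x \<le> b"
    then show "(g has_real_derivative - c x - (g x)\<^sup>2) (at x)"
      unfolding g_def using p0[of x]
      by (auto intro!: derivative_eq_intros p simp: field_simps power2_eq_square)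
  qed (intro continuous_intros c cg)
  from primitive_on_mult[OF primitive_on_mult[OF U U] this]
  have T: "((\<lambda>x. (v x * U x + U x * v x) * g x + U x * U x * (- c x - (g x)\<^sup>2)) has_integral 0) {a..b}"
    using ab bd by (auto dest: primitive_on_integral[of a b _ _ a b])
  let ?z = "\<lambda>x. v x - g x * U x"
  have "(\<lambda>x. (v x)\<^sup>2 - 2 * (g x * U x * v x) + (g x * U x)\<^sup>2) absolutely_integrable_on {a..b}"
    by (intro set_integral_add set_integral_diff v2 set_integrable_mult_right absolutely_integrable_continuous_mult va
        absolutely_integrable_continuous_real continuous_intros cg cU)
  moreover have "(\<lambda>x. (v x)\<^sup>2 - 2 * (g x * U x * v x) + (g x * U x)\<^sup>2) = (\<lambda>x. (?z x)\<^sup>2)"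
    by (auto simp: power2_eq_square algebra_simps)
  ultimately have z2: "(\<lambda>x. (?z x)\<^sup>2) absolutely_integrable_on {a..b}" by simp
  then have zi: "(\<lambda>x. (?z x)\<^sup>2) integrable_on {a..b}" by (rule absolutely_integrable_imp_integrable_on)
  define I where "I = integral {a..b} (\<lambda>x. (?z x)\<^sup>2)"
  have "((\<lambda>x. (?z x)\<^sup>2 + ((v x * U x + U x * v x) * g x + U x * U x * (- c x - (g x)\<^sup>2))) has_integral I + 0) {a..b}"
    unfolding I_def by (intro has_integral_add T integrable_integral zi)
  moreover have "(\<lambda>x. (?z x)\<^sup>2 + ((v x * U x + U x * v x) * g x + U x * U x * (- c x - (g x)\<^sup>2)))
      = (\<lambda>x. (v x)\<^sup>2 - c x * (U x)\<^sup>2)" by (auto simp: power2_eq_square algebra_simps)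
  ultimately have 1: "((\<lambda>x. (v x)\<^sup>2 - c x * (U x)\<^sup>2) has_integral I) {a..b}" by simp
  have 2: "0 \<le> I" unfolding I_def by (intro integral_nonneg zi) auto
  \<comment> \<open>If the square integrates to zero, \<open>v = g * U\<close> almost everywhere.
    This says that \<open>U / p\<close> has derivative zero, and \<open>U / p\<close> vanishes at
    \<open>a\<close>.\<close>
  have 3: "\<forall>x\<in>{a..b}. U x = 0" if I0: "I = 0"
  proof -
    have "((\<lambda>x. (?z x)\<^sup>2) has_integral 0) {s..t}" if st: "a \<le> s" "s \<le> t" "t \<le> b" for s t
    proof -
      have sub: "(\<lambda>x. (?z x)\<^sup>2) integrable_on {s..t}"
        by (rule integrable_subinterval_real[OF zi]) (use st in auto)
      have "integral {s..t} (\<lambda>x. (?z x)\<^sup>2) \<le> integral {a..b} (\<lambda>x. (?z x)\<^sup>2)"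
        by (rule integral_subset_le[OF _ sub zi]) (use st in auto)
      moreover have "0 \<le> integral {s..t} (\<lambda>x. (?z x)\<^sup>2)" by (intro integral_nonneg sub) auto
      ultimately show ?thesis using sub I0 unfolding I_def has_integral_iff by auto
    qed
    then obtain N where N: "negligible N" "\<And>x. x \<in> {a..b} \<Longrightarrow> x \<notin> N \<Longrightarrow> (?z x)\<^sup>2 = 0"
      using zero_primitive_imp_zero_ae[of a b "\<lambda>x. (?z x)\<^sup>2"] by blast
    have "primitive_on a b (\<lambda>x. 1 / p x) (\<lambda>x. - p' x / (p x)\<^sup>2)"
    proof (rule primitive_on_derivative)
      fix x assume "a \<le> x" "x \<le> b"
      then show "((\<lambda>x. 1 / p x) has_real_derivative - p' x / (p x)\<^sup>2) (at x)"
        using p0[of x] by (auto intro!: derivative_eq_intros p simp: field_simps power2_eq_square)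
    qed (intro continuous_intros cp, use p0 in auto)
    note P = primitive_on_mult[OF U this]
    show ?thesis
    proof
      fix x assume x: "x \<in> {a..b}"
      have "((\<lambda>x. v x * (1 / p x) + U x * (- p' x / (p x)\<^sup>2)) has_integral U x * (1 / p x) - U a * (1 / p a)) {a..x}"
        using primitive_on_integral[OF P, of a x] x by auto
      moreover have "((\<lambda>x. v x * (1 / p x) + U x * (- p' x / (p x)\<^sup>2)) has_integral 0) {a..x}"
      proof (rule has_integral_spike[OF N(1) _ has_integral_0])
        fix y assume "y \<in> {a..x} - N"
        then have "y \<in> {a..b}" "?z y = 0" using N(2)[of y] x by auto
        then show "v y * (1 / p y) + U y * (- p' y / (p y)\<^sup>2) = 0"
          using p0[of y] unfolding g_def by (simp add: field_simps power2_eq_square)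
      qed
      ultimately have "U x * (1 / p x) - U a * (1 / p a) = 0" by (rule has_integral_unique)
      then show "U x = 0" using bd p0[OF x] by simp
    qed
  qed
  show ?thesis using that 1 2 3 by blast
qed

text \<open>For a steady state no solution of the linearised equation is positive on a whole period,
  because the sign-changing derivative of the state is itself a solution. Hence the period is split
  at \<open>b\<close>, with one positive solution for each arc.\<close>

lemma circle_dirichlet:
  fixes U v p1 p1' p2 p2' c :: "real \<Rightarrow> real"
  assumes ab: "a \<le> b" "b \<le> d" and U: "primitive_on a d U v" and v2: "(\<lambda>x. (v x)\<^sup>2) absolutely_integrable_on {a..d}"
    and bd: "U a = 0" "U b = 0" "U d = 0" and c: "continuous_on UNIV c"
    and p1: "\<And>x. x \<in> {a..b} \<Longrightarrow> 0 < p1 x" "\<And>x. (p1 has_real_derivative p1' x) (at x)"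
      "\<And>x. (p1' has_real_derivative - (c x * p1 x)) (at x)"
    and p2: "\<And>x. x \<in> {b..d} \<Longrightarrow> 0 < p2 x" "\<And>x. (p2 has_real_derivative p2' x) (at x)"
      "\<And>x. (p2' has_real_derivative - (c x * p2 x)) (at x)"
  obtains I where "((\<lambda>x. (v x)\<^sup>2 - c x * (U x)\<^sup>2) has_integral I) {a..d}" "0 \<le> I"
    "I = 0 \<Longrightarrow> \<forall>x\<in>{a..d}. U x = 0"
proof -
  obtain I1 where I1: "((\<lambda>x. (v x)\<^sup>2 - c x * (U x)\<^sup>2) has_integral I1) {a..b}" "0 \<le> I1"
    "I1 = 0 \<Longrightarrow> \<forall>x\<in>{a..b}. U x = 0"
    by (rule picone_dirichlet[OF ab(1) primitive_on_subset[OF U, of a b] set_integrable_subset[OF v2, of "{a..b}"]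
          bd(1,2) continuous_on_subset[OF c] p1]) (use ab in auto)
  obtain I2 where I2: "((\<lambda>x. (v x)\<^sup>2 - c x * (U x)\<^sup>2) has_integral I2) {b..d}" "0 \<le> I2"
    "I2 = 0 \<Longrightarrow> \<forall>x\<in>{b..d}. U x = 0"
    by (rule picone_dirichlet[OF ab(2) primitive_on_subset[OF U, of b d] set_integrable_subset[OF v2, of "{b..d}"]
          bd(2,3) continuous_on_subset[OF c] p2]) (use ab in auto)
  show ?thesis
  proof (rule that[of "I1 + I2"])
    show "((\<lambda>x. (v x)\<^sup>2 - c x * (U x)\<^sup>2) has_integral I1 + I2) {a..d}"
      by (rule has_integral_combine[OF ab I1(1) I2(1)])
    show "\<forall>x\<in>{a..d}. U x = 0" if "I1 + I2 = 0"
    proof -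
      have "I1 = 0" "I2 = 0" using that I1(2) I2(2) by auto
      then show ?thesis using I1(3) I2(3) by force
    qed
  qed (use I1 I2 in auto)
qed

text \<open>Integration by parts reduces the cross term to a multiple of the integral of
  \<open>U\<close>, which is zero, and the form of \<open>g\<close> alone to
  \<open>- \<kappa> * G\<close>.\<close>

lemma quadratic_form_translate:
  fixes U v g g' c :: "real \<Rightarrow> real"
  assumes "X > 0" and U: "primitive_on a (a + X) U v" and per: "U (a + X) = U a" "g (a + X) = g a" "g' (a + X) = g' a"
    and c: "continuous_on UNIV c"
    and g: "\<And>x. (g has_real_derivative g' x) (at x)" "\<And>x. (g' has_real_derivative \<kappa> - c x * g x) (at x)"
    and U0: "(U has_integral 0) {a..a + X}" and G: "(g has_integral G) {a..a + X}"
    and Q: "((\<lambda>x. (v x)\<^sup>2 - c x * (U x)\<^sup>2) has_integral Q) {a..a + X}"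
  shows "((\<lambda>x. (v x + g' x)\<^sup>2 - c x * (U x + g x)\<^sup>2) has_integral Q - \<kappa> * G) {a..a + X}"
proof -
  have cg: "continuous_on S g" "continuous_on S g'" for S
    using g by (auto intro!: continuous_at_imp_continuous_on DERIV_isCont)
  have cc: "continuous_on S c" for S using c continuous_on_subset by blast
  have Pg: "primitive_on a (a + X) g g'" by (rule primitive_on_derivative) (use g cg in auto)
  have Pg': "primitive_on a (a + X) g' (\<lambda>x. \<kappa> - c x * g x)"
    by (rule primitive_on_derivative) (use g in \<open>auto intro!: continuous_intros cg cc\<close>)
  have "((\<lambda>x. v x * g' x + U x * (\<kappa> - c x * g x)) has_integral 0) {a..a + X}"
    using primitive_on_integral[OF primitive_on_mult[OF U Pg'], of a "a + X"] \<open>X > 0\<close> per by simp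
  moreover have "((\<lambda>x. g' x * g' x + g x * (\<kappa> - c x * g x)) has_integral 0) {a..a + X}"
    using primitive_on_integral[OF primitive_on_mult[OF Pg Pg'], of a "a + X"] \<open>X > 0\<close> per by simp
  ultimately have "((\<lambda>x. ((v x)\<^sup>2 - c x * (U x)\<^sup>2) + 2 * (v x * g' x + U x * (\<kappa> - c x * g x))
      + (g' x * g' x + g x * (\<kappa> - c x * g x)) - 2 * \<kappa> * U x - \<kappa> * g x) has_integral
      Q + 2 * 0 + 0 - 2 * \<kappa> * 0 - \<kappa> * G) {a..a + X}"
    using Q U0 G by (intro has_integral_add has_integral_diff has_integral_mult_right)
  then show ?thesis by (simp add: power2_eq_square algebra_simps)
qed

text \<open>With \<open>L = - d\<^sup>2/dx\<^sup>2 - c\<close>, the function \<open>w\<close> satisfies \<open>L w = - \<kappa>\<close> and \<open>k\<close> spans the kernel of \<open>L\<close>.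
  Adding a suitable combination \<open>s w + t k\<close> to \<open>U\<close> produces a function that vanishes at \<open>a\<close> and \<open>b\<close>, on which the
  quadratic form is nonnegative; as \<open>U\<close> has mean zero the form only drops by \<open>s\<^sup>2 \<kappa> W\<close>.\<close>

lemma constrained_quadratic_form_nonneg:
  fixes U v w w' k k' p1 p1' p2 p2' c :: "real \<Rightarrow> real"
  assumes ab: "a \<le> b" "b \<le> a + X" "X > 0"
    and U: "primitive_on a (a + X) U v" and v2: "(\<lambda>x. (v x)\<^sup>2) absolutely_integrable_on {a..a + X}"
    and per: "U (a + X) = U a" "w (a + X) = w a" "w' (a + X) = w' a" "k (a + X) = k a" "k' (a + X) = k' a"
    and c: "continuous_on UNIV c"
    and w: "\<And>x. (w has_real_derivative w' x) (at x)" "\<And>x. (w' has_real_derivative \<kappa> - c x * w x) (at x)"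
    and k: "\<And>x. (k has_real_derivative k' x) (at x)" "\<And>x. (k' has_real_derivative - (c x * k x)) (at x)"
    and U0: "(U has_integral 0) {a..a + X}" and W: "(w has_integral W) {a..a + X}" "0 < W"
    and k0: "(k has_integral 0) {a..a + X}" and "k a \<noteq> 0" and "\<kappa> > 0"
    and p1: "\<And>x. x \<in> {a..b} \<Longrightarrow> 0 < p1 x" "\<And>x. (p1 has_real_derivative p1' x) (at x)"
      "\<And>x. (p1' has_real_derivative - (c x * p1 x)) (at x)"
    and p2: "\<And>x. x \<in> {b..a + X} \<Longrightarrow> 0 < p2 x" "\<And>x. (p2 has_real_derivative p2' x) (at x)"
      "\<And>x. (p2' has_real_derivative - (c x * p2 x)) (at x)"
    and Q: "((\<lambda>x. (v x)\<^sup>2 - c x * (U x)\<^sup>2) has_integral Q) {a..a + X}"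
  shows "0 \<le> Q" and "Q = 0 \<Longrightarrow> \<exists>t. \<forall>x\<in>{a..a + X}. U x = t * k x"
proof -
  \<comment> \<open>The multiple \<open>t\<close> of \<open>k\<close> leaves no trace in the form:
    \<open>k\<close> solves the homogeneous equation and has mean zero.\<close>
  have shift: "((\<lambda>x. (f x + (s * w' x + t * k' x))\<^sup>2 - c x * (F x + (s * w x + t * k x))\<^sup>2) has_integral R - s\<^sup>2 * \<kappa> * W) {a..a + X}"
    if "primitive_on a (a + X) F f" "F (a + X) = F a" "(F has_integral 0) {a..a + X}"
      "((\<lambda>x. (f x)\<^sup>2 - c x * (F x)\<^sup>2) has_integral R) {a..a + X}" for F f s t R
  proof -
    have "((\<lambda>x. s * w x + t * k x) has_integral s * W + t * 0) {a..a + X}"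
      by (intro has_integral_add has_integral_mult_right W k0)
    moreover have "((\<lambda>x. s * w x + t * k x) has_real_derivative s * w' x + t * k' x) (at x)" for x
      by (auto intro!: derivative_eq_intros w k)
    moreover have "((\<lambda>x. s * w' x + t * k' x) has_real_derivative s * \<kappa> - c x * (s * w x + t * k x)) (at x)" for x
      by (auto intro!: derivative_eq_intros w k simp: algebra_simps)
    ultimately have "((\<lambda>x. (f x + (s * w' x + t * k' x))\<^sup>2 - c x * (F x + (s * w x + t * k x))\<^sup>2) has_integral
        R - s * \<kappa> * (s * W + t * 0)) {a..a + X}"
      using per ab by (intro quadratic_form_translate[OF ab(3) that(1,2) _ _ c _ _ that(3) _ that(4)]) auto
    then show ?thesis by (simp add: power2_eq_square mult_ac)
  qed
  have cw: "continuous_on S w" "continuous_on S w'" "continuous_on S k" "continuous_on S k'" for S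
    using w k by (auto intro!: continuous_at_imp_continuous_on DERIV_isCont)
  have prim: "primitive_on a (a + X) (\<lambda>x. s * w x + t * k x) (\<lambda>x. s * w' x + t * k' x)" for s t
    by (rule primitive_on_derivative) (auto intro!: derivative_eq_intros w k continuous_intros cw)
  have dir: "0 \<le> R \<and> (R = 0 \<longrightarrow> (\<forall>x\<in>{a..a + X}. F x = 0))"
    if F: "primitive_on a (a + X) F f" "(\<lambda>x. (f x)\<^sup>2) absolutely_integrable_on {a..a + X}" "F a = 0" "F b = 0" "F (a + X) = 0"
      "((\<lambda>x. (f x)\<^sup>2 - c x * (F x)\<^sup>2) has_integral R) {a..a + X}" for F f R
  proof -
    obtain I where I: "((\<lambda>x. (f x)\<^sup>2 - c x * (F x)\<^sup>2) has_integral I) {a..a + X}" "0 \<le> I"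
      "I = 0 \<Longrightarrow> \<forall>x\<in>{a..a + X}. F x = 0"
      using circle_dirichlet[OF ab(1,2) F(1-5) c p1 p2] by blast
    have "R = I" by (rule has_integral_unique[OF F(6) I(1)])
    then show ?thesis using I by simp
  qed
  \<comment> \<open>If the boundary values of \<open>w\<close> and \<open>k\<close> at
    \<open>a\<close> and \<open>b\<close> were dependent, \<open>k a * w - w a * k\<close> would
    vanish at both points. Its form would then be nonnegative, whereas it equals
    \<open>- ((k a)^2 * \<kappa> * W)\<close>.\<close>
  have det: "w a * k b - w b * k a \<noteq> 0"
  proof
    assume det0: "w a * k b - w b * k a = 0"
    let ?s = "k a" and ?t = "- w a"
    have "primitive_on a (a + X) (\<lambda>_. 0) (\<lambda>_. 0)" by (rule primitive_on_derivative) auto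
    from shift[OF this, of 0 ?s ?t]
    have "((\<lambda>x. (?s * w' x + ?t * k' x)\<^sup>2 - c x * (?s * w x + ?t * k x)\<^sup>2) has_integral - (?s\<^sup>2 * \<kappa> * W)) {a..a + X}"
      by simp
    then have "0 \<le> - (?s\<^sup>2 * \<kappa> * W)"
      by (intro conjunct1[OF dir[OF prim[of ?s ?t]]])
         (use det0 per in \<open>auto intro!: absolutely_integrable_continuous_real continuous_intros cw simp: algebra_simps\<close>)
    moreover have "?s\<^sup>2 * \<kappa> * W > 0" using \<open>k a \<noteq> 0\<close> \<open>\<kappa> > 0\<close> W by simp
    ultimately show False by simp
  qed
  \<comment> \<open>Cramer's rule for the two equations saying that \<open>?F\<close> vanishes at
    \<open>a\<close> and at \<open>b\<close>.\<close>
  define s where "s = (U b * k a - U a * k b) / (w a * k b - w b * k a)"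
  define t where "t = (U a * w b - U b * w a) / (w a * k b - w b * k a)"
  let ?F = "\<lambda>x. U x + (s * w x + t * k x)" and ?f = "\<lambda>x. v x + (s * w' x + t * k' x)"
  have st: "s * (w a * k b - w b * k a) = U b * k a - U a * k b" "t * (w a * k b - w b * k a) = U a * w b - U b * w a"
    using det unfolding s_def t_def by simp_all
  have "(w a * k b - w b * k a) * ?F a = 0" "(w a * k b - w b * k a) * ?F b = 0"
    using st by algebra+
  then have Fa: "?F a = 0" and Fb: "?F b = 0" using det by auto
  have va: "v absolutely_integrable_on {a..a + X}" using U unfolding primitive_on_def by auto
  have "(\<lambda>x. (v x)\<^sup>2 + 2 * ((s * w' x + t * k' x) * v x) + (s * w' x + t * k' x)\<^sup>2) absolutely_integrable_on {a..a + X}"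
    by (intro set_integral_add v2 set_integrable_mult_right absolutely_integrable_continuous_mult va
        absolutely_integrable_continuous_real continuous_intros cw)
  moreover have "(\<lambda>x. (v x)\<^sup>2 + 2 * ((s * w' x + t * k' x) * v x) + (s * w' x + t * k' x)\<^sup>2) = (\<lambda>x. (?f x)\<^sup>2)"
    by (auto simp: power2_eq_square algebra_simps)
  ultimately have f2: "(\<lambda>x. (?f x)\<^sup>2) absolutely_integrable_on {a..a + X}" by simp
  have R: "0 \<le> Q - s\<^sup>2 * \<kappa> * W \<and> (Q - s\<^sup>2 * \<kappa> * W = 0 \<longrightarrow> (\<forall>x\<in>{a..a + X}. ?F x = 0))"
    by (rule dir[OF primitive_on_add[OF U prim] f2 Fa Fb _ shift[OF U per(1) U0 Q]]) (use Fa per in simp)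
  have nn: "0 \<le> s\<^sup>2 * \<kappa> * W" using \<open>\<kappa> > 0\<close> W by simp
  then show "0 \<le> Q" using R by linarith
  show "\<exists>t. \<forall>x\<in>{a..a + X}. U x = t * k x" if "Q = 0"
  proof -
    have "s\<^sup>2 * \<kappa> * W = 0" using that R nn by linarith
    then have "s = 0" using \<open>\<kappa> > 0\<close> W by simp
    then have "\<forall>x\<in>{a..a + X}. U x = (- t) * k x" using R that by (simp add: add_eq_0_iff)
    then show ?thesis by blast
  qed
qed

text \<open>Two integrations leave an affine freedom. It adds the same amount to the energy of all
  competitors with the same mass, so the comparisons can be made with the pure power.\<close>

lemma energy_potential_explicit:
  assumes H: "energy_potential B q H" and q: "q > 1"
  obtains c0 c1 where "\<And>y. y > 0 \<Longrightarrow> H y = B * y powr (q + 1) / (q * (q + 1)) + c0 * y + c1"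
proof -
  have d1: "(H has_real_derivative deriv H y) (at y)" and d2: "(deriv H has_real_derivative B * y powr (q - 1)) (at y)"
    if "y > 0" for y
    using H that DERIV_deriv_iff_real_differentiable unfolding energy_potential_def by auto
  define c0 where "c0 = deriv H 1 - B / q"
  define c1 where "c1 = H 1 - B / (q * (q + 1)) - c0"
  have const: "f y = f 1" if "y > 0" "\<And>z. z > 0 \<Longrightarrow> (f has_real_derivative 0) (at z)" for f :: "real \<Rightarrow> real" and y
    by (rule has_field_derivative_zero_constant[of "{0<..}", THEN exE, of f])
       (use that in \<open>auto intro: has_field_derivative_at_within\<close>)
  have 1: "deriv H y = B * y powr q / q + c0" if "y > 0" for y
  proof -
    have "deriv H y - B * y powr q / q = deriv H 1 - B * 1 powr q / q"
      by (rule const[OF that]) (use q in \<open>auto intro!: derivative_eq_intros d2\<close>)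
    then show ?thesis by (simp add: c0_def)
  qed
  have "H y = B * y powr (q + 1) / (q * (q + 1)) + c0 * y + c1" if "y > 0" for y
  proof -
    have "H y - B * y powr (q + 1) / (q * (q + 1)) - c0 * y = H 1 - B * 1 powr (q + 1) / (q * (q + 1)) - c0 * 1"
    proof (rule const[OF that])
      fix z :: real assume z: "z > 0"
      show "((\<lambda>y. H y - B * y powr (q + 1) / (q * (q + 1)) - c0 * y) has_real_derivative 0) (at z)"
      proof -
        have "((\<lambda>y. H y - B / (q * (q + 1)) * y powr (q + 1) - c0 * y) has_real_derivative
            deriv H z - B / (q * (q + 1)) * ((q + 1) * z powr q) - c0) (at z)"
          using z q by (auto intro!: derivative_eq_intros d1)
        moreover have "B / (q * (q + 1)) * ((q + 1) * z powr q) = B * z powr q / q"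
          using q by (simp add: divide_simps)
        then have "deriv H z - B / (q * (q + 1)) * ((q + 1) * z powr q) - c0 = 0"
          using 1[OF z] by linarith
        moreover have "(\<lambda>y. H y - B / (q * (q + 1)) * y powr (q + 1) - c0 * y) =
            (\<lambda>y. H y - B * y powr (q + 1) / (q * (q + 1)) - c0 * y)" by auto
        ultimately show ?thesis by metis
      qed
    qed
    then show ?thesis by (simp add: c1_def)
  qed
  then show ?thesis using that by blast
qed

section \<open>Expansion of the energy at a steady state\<close>

definition power_potential :: "real \<Rightarrow> real \<Rightarrow> real \<Rightarrow> real" where
  "power_potential B q y = B * y powr (q + 1) / (q * (q + 1))"

definition taylor_remainder :: "real \<Rightarrow> real \<Rightarrow> real \<Rightarrow> real \<Rightarrow> real" where
  "taylor_remainder B q y \<eta> = power_potential B q (y + \<eta>) - power_potential B q y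
     - B * y powr q / q * \<eta> - B * y powr (q - 1) / 2 * \<eta>\<^sup>2"

lemma power_potential_derivs:
  assumes "y > 0" "q > 1"
  shows "(power_potential B q has_real_derivative B * y powr q / q) (at y)"
    "((\<lambda>y. B * y powr q / q) has_real_derivative B * y powr (q - 1)) (at y)"
    "((\<lambda>y. B * y powr (q - 1)) has_real_derivative B * (q - 1) * y powr (q - 2)) (at y)"
    "((\<lambda>y. B * (q - 1) * y powr (q - 2)) has_real_derivative B * (q - 1) * (q - 2) * y powr (q - 3)) (at y)"
proof -
  have "((\<lambda>y. B / (q * (q + 1)) * y powr (q + 1)) has_real_derivative B / (q * (q + 1)) * ((q + 1) * y powr q)) (at y)"
    using assms by (auto intro!: derivative_eq_intros)
  moreover have "B / (q * (q + 1)) * ((q + 1) * y powr q) = B * y powr q / q"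
    using assms by (simp add: divide_simps)
  moreover have "(\<lambda>y. B / (q * (q + 1)) * y powr (q + 1)) = power_potential B q"
    by (auto simp: power_potential_def)
  ultimately show "(power_potential B q has_real_derivative B * y powr q / q) (at y)" by metis
qed (use assms in \<open>auto intro!: derivative_eq_intros simp: algebra_simps\<close>)

lemma taylor_remainder_third:
  assumes "y > 0" "y + \<eta> > 0" "\<eta> \<noteq> 0" "q > 1"
  obtains \<xi> where "min y (y + \<eta>) < \<xi>" "taylor_remainder B q y \<eta> = B * (q - 1) * \<xi> powr (q - 2) / 6 * \<eta> ^ 3"
proof -
  define dd where "dd = (\<lambda>i::nat. [power_potential B q, \<lambda>y. B * y powr q / q, \<lambda>y. B * y powr (q - 1),
      \<lambda>y. B * (q - 1) * y powr (q - 2)] ! i)"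
  let ?a = "min y (y + \<eta>)" and ?b = "max y (y + \<eta>)"
  have "\<exists>t. (if y + \<eta> < y then y + \<eta> < t \<and> t < y else y < t \<and> t < y + \<eta>) \<and>
      power_potential B q (y + \<eta>) = (\<Sum>m<3. dd m y / fact m * (y + \<eta> - y) ^ m) + dd 3 t / fact 3 * (y + \<eta> - y) ^ 3"
  proof (rule Taylor[where a = ?a and b = ?b])
    show "\<forall>m t. m < 3 \<and> ?a \<le> t \<and> t \<le> ?b \<longrightarrow> (dd m has_real_derivative dd (Suc m) t) (at t)"
    proof (intro allI impI; elim conjE)
      fix m :: nat and t assume "m < 3" "?a \<le> t"
      then have "t > 0" and "m = 0 \<or> m = 1 \<or> m = 2" using assms by auto
      then show "(dd m has_real_derivative dd (Suc m) t) (at t)"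
        using power_potential_derivs[OF \<open>t > 0\<close> \<open>q > 1\<close>, of B] by (auto simp: dd_def numeral_eq_Suc)
    qed
  qed (use assms in \<open>auto simp: dd_def\<close>)
  then obtain t where t: "if y + \<eta> < y then y + \<eta> < t \<and> t < y else y < t \<and> t < y + \<eta>"
    "power_potential B q (y + \<eta>) = (\<Sum>m<3. dd m y / fact m * (y + \<eta> - y) ^ m) + dd 3 t / fact 3 * (y + \<eta> - y) ^ 3"
    by blast
  show ?thesis
  proof (rule that[of t])
    show "min y (y + \<eta>) < t" using t(1) by (auto split: if_splits)
    show "taylor_remainder B q y \<eta> = B * (q - 1) * t powr (q - 2) / 6 * \<eta> ^ 3"
      using t(2) by (simp add: taylor_remainder_def dd_def numeral_eq_Suc fact_numeral)
  qed
qed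

text \<open>For \<open>q < 2\<close> the third derivative decreases, so its value at
  \<open>m / 2\<close> bounds it on the whole segment.\<close>

lemma taylor_remainder_bound:
  assumes "m > 0" "m \<le> y" "\<bar>\<eta>\<bar> \<le> m / 2" "1 < q" "q < 2" "B > 0"
  shows "\<bar>taylor_remainder B q y \<eta>\<bar> \<le> B * (q - 1) * (m / 2) powr (q - 2) / 6 * \<bar>\<eta>\<bar> ^ 3"
proof (cases "\<eta> = 0")
  case True
  then show ?thesis by (simp add: taylor_remainder_def)
next
  case False
  have "y > 0" "y + \<eta> \<ge> m / 2" "y \<ge> m / 2" using assms by auto
  then obtain \<xi> where x: "min y (y + \<eta>) < \<xi>" "taylor_remainder B q y \<eta> = B * (q - 1) * \<xi> powr (q - 2) / 6 * \<eta> ^ 3"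
    using taylor_remainder_third[of y \<eta> q] False assms by (metis half_gt_zero less_le_trans)
  have "\<xi> > m / 2" using x(1) \<open>y + \<eta> \<ge> m / 2\<close> \<open>y \<ge> m / 2\<close> by auto
  then have "\<xi> powr (q - 2) \<le> (m / 2) powr (q - 2)" using assms by (intro powr_mono2') auto
  then show ?thesis unfolding x(2) abs_mult power_abs
    using assms by (auto intro!: mult_right_mono mult_left_mono divide_right_mono)
qed

text \<open>The fourth derivative \<open>B * (q - 1) * (q - 2) * y powr (q - 3)\<close> is negative
  for \<open>1 < q < 2\<close>, and the fourth power does not see the sign of the increment. The
  strictness decides stability in the direction of translations.\<close>

lemma taylor_remainder_fourth:
  assumes "y > 0" "y + \<eta> > 0" "\<eta> \<noteq> 0" "1 < q" "q < 2" "B > 0"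
  shows "taylor_remainder B q y \<eta> < B * (q - 1) * y powr (q - 2) / 6 * \<eta> ^ 3"
proof -
  obtain \<xi> where x: "min y (y + \<eta>) < \<xi>" "taylor_remainder B q y \<eta> = B * (q - 1) * \<xi> powr (q - 2) / 6 * \<eta> ^ 3"
    by (rule taylor_remainder_third[OF assms(1-4)])
  define dd where "dd = (\<lambda>i::nat. [power_potential B q, \<lambda>y. B * y powr q / q, \<lambda>y. B * y powr (q - 1),
      \<lambda>y. B * (q - 1) * y powr (q - 2), \<lambda>y. B * (q - 1) * (q - 2) * y powr (q - 3)] ! i)"
  let ?a = "min y (y + \<eta>)" and ?b = "max y (y + \<eta>)"
  have "\<exists>t. (if y + \<eta> < y then y + \<eta> < t \<and> t < y else y < t \<and> t < y + \<eta>) \<and>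
      power_potential B q (y + \<eta>) = (\<Sum>m<4. dd m y / fact m * (y + \<eta> - y) ^ m) + dd 4 t / fact 4 * (y + \<eta> - y) ^ 4"
  proof (rule Taylor[where a = ?a and b = ?b])
    show "\<forall>m t. m < 4 \<and> ?a \<le> t \<and> t \<le> ?b \<longrightarrow> (dd m has_real_derivative dd (Suc m) t) (at t)"
    proof (intro allI impI; elim conjE)
      fix m :: nat and t assume "m < 4" "?a \<le> t"
      then have "t > 0" and "m = 0 \<or> m = 1 \<or> m = 2 \<or> m = 3" using assms by auto
      then show "(dd m has_real_derivative dd (Suc m) t) (at t)"
        using power_potential_derivs[OF \<open>t > 0\<close> \<open>q > 1\<close>, of B] by (auto simp: dd_def numeral_eq_Suc)
    qed
  qed (use assms in \<open>auto simp: dd_def\<close>)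
  then obtain t where t: "if y + \<eta> < y then y + \<eta> < t \<and> t < y else y < t \<and> t < y + \<eta>"
    "power_potential B q (y + \<eta>) = (\<Sum>m<4. dd m y / fact m * (y + \<eta> - y) ^ m) + dd 4 t / fact 4 * (y + \<eta> - y) ^ 4"
    by blast
  have "t > 0" using t(1) assms by (auto split: if_splits)
  have "taylor_remainder B q y \<eta> = B * (q - 1) * y powr (q - 2) / 6 * \<eta> ^ 3
      + (B * (q - 1) * (q - 2) * t powr (q - 3)) / 24 * \<eta> ^ 4"
    using t(2) by (simp add: taylor_remainder_def dd_def numeral_eq_Suc fact_numeral)
  moreover have "(B * (q - 1) * (q - 2) * t powr (q - 3)) / 24 * \<eta> ^ 4 < 0"
  proof -
    have "B * (q - 1) > 0" "q - 2 < 0" "t powr (q - 3) > 0" "\<eta> ^ 4 > 0" using assms \<open>t > 0\<close> by auto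
    then show ?thesis by (simp add: mult_less_0_iff zero_less_mult_iff mult_pos_neg)
  qed
  ultimately show ?thesis by linarith
qed

lemma continuous_on_power_potential:
  "continuous_on S f \<Longrightarrow> \<forall>x\<in>S. f x > 0 \<Longrightarrow> continuous_on S (\<lambda>x. power_potential B q (f x))"
  unfolding power_potential_def divide_inverse by (intro continuous_intros) auto

lemma continuous_on_taylor_remainder:
  assumes "continuous_on S f" "continuous_on S g" "\<forall>x\<in>S. f x > 0" "\<forall>x\<in>S. f x + g x > 0"
  shows "continuous_on S (\<lambda>x. taylor_remainder B q (f x) (g x))"
  unfolding taylor_remainder_def divide_inverse
  by (intro continuous_intros continuous_on_power_potential assms) (use assms in auto)

text \<open>The steady state equation integrated twice. Up to sign and the linear coefficient of
  \<open>H\<close>, \<open>D\<close> is the Lagrange multiplier of the mass constraint.\<close>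

locale circle_steady_state =
  fixes B q D X :: real and H h h' :: "real \<Rightarrow> real"
  assumes X: "X > 0" and B: "B > 0" and q: "1 < q" "q < 2"
    and pot: "energy_potential B q H"
    and per: "periodic X h" and pos: "\<And>x. h x > 0"
    and h: "\<And>x. (h has_real_derivative h' x) (at x)"
    and h': "\<And>x. (h' has_real_derivative D - B / q * h x powr q) (at x)"
begin

lemma per': "periodic X h'"
  by (rule periodic_derivative[OF per h])

lemma cont_h: "continuous_on S h" and cont_h': "continuous_on S h'"
  using h h' by (auto intro!: continuous_at_imp_continuous_on DERIV_isCont)

lemma cont_powr: "continuous_on S (\<lambda>x. h x powr s)"
  by (intro continuous_intros cont_h) (use pos less_imp_neq in fastforce)

lemma min_h: obtains m where "m > 0" "\<And>x. x \<in> {0..X} \<Longrightarrow> m \<le> h x"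
proof -
  obtain x where "x \<in> {0..X}" "\<forall>y\<in>{0..X}. h x \<le> h y"
    using continuous_attains_inf[of "{0..X}" h] cont_h[of "{0..X}"] X by auto
  then show ?thesis using that[of "h x"] pos by blast
qed

lemma h_L2: "h \<in> L2_circle X" and h'_L2: "h' \<in> L2_circle X" and h_weak: "has_weak_deriv X h h'"
proof -
  show "h \<in> L2_circle X" "h' \<in> L2_circle X"
    using L2_circle_continuous cont_h cont_h' per per' by auto
  show "has_weak_deriv X h h'"
    by (rule primitive_on_has_weak_deriv[OF primitive_on_derivative])
       (use h cont_h' X per[unfolded periodic_def, rule_format, of 0] in auto)
qed

lemma energy_h: "energy H X h = integral {0..X} (\<lambda>x. (h' x)\<^sup>2 / 2 - H (h x))"
  by (rule energy_eqI[OF X h'_L2 h_weak negligible_empty]) auto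

text \<open>The first-order term disappears: by the equation for \<open>h'\<close> and integration
  by parts it is a constant multiple of the integral of \<open>U\<close>. What remains is the second
  variation and the Taylor remainder of the potential.\<close>

lemma energy_increment:
  assumes u: "u \<in> L2_circle X" "has_weak_deriv X u v" "v \<in> L2_circle X"
    and N: "negligible N" "\<And>x. x \<in> {0..X} \<Longrightarrow> x \<notin> N \<Longrightarrow> u x = U x"
    and U: "primitive_on 0 X U v" "U X = U 0" "integral {0..X} u = 0"
    and eps: "\<And>x. x \<in> {0..X} \<Longrightarrow> h x + \<epsilon> * U x > 0"
  shows "energy H X (\<lambda>x. h x + \<epsilon> * u x) = energy H X h
     + \<epsilon>\<^sup>2 / 2 * integral {0..X} (\<lambda>x. (v x)\<^sup>2 - B * h x powr (q - 1) * (U x)\<^sup>2)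
     - integral {0..X} (\<lambda>x. taylor_remainder B q (h x) (\<epsilon> * U x))"
proof -
  obtain c0 c1 where H: "\<And>y. y > 0 \<Longrightarrow> H y = power_potential B q y + c0 * y + c1"
    using energy_potential_explicit[OF pot q(1)] unfolding power_potential_def by blast
  have cU: "continuous_on {0..X} U" by (rule primitive_on_continuous[OF U(1)])
  have U0: "(U has_integral 0) {0..X}"
  proof -
    have "integral {0..X} U = integral {0..X} u" by (rule integral_spike[OF N(1)]) (use N(2) in auto)
    then show ?thesis using U(3) integrable_continuous_real[OF cU] by (simp add: has_integral_iff)
  qed
  have "energy H X (\<lambda>x. h x + \<epsilon> * u x) = integral {0..X} (\<lambda>x. (h' x + \<epsilon> * v x)\<^sup>2 / 2 - H (h x + \<epsilon> * U x))"
    by (rule energy_eqI[OF X L2_circle_add_cmult[OF h'_L2 u(3)]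
          has_weak_deriv_add_cmult[OF h_L2 h'_L2 u(1,3) h_weak u(2)] N(1)]) (use N(2) in auto)
  moreover have sum: "((\<lambda>x. ((h' x)\<^sup>2 / 2 - H (h x)) + \<epsilon> * (v x * h' x + U x * (D - B / q * h x powr q))
      - \<epsilon> * (D + c0) * U x + \<epsilon>\<^sup>2 / 2 * ((v x)\<^sup>2 - B * h x powr (q - 1) * (U x)\<^sup>2)
      - taylor_remainder B q (h x) (\<epsilon> * U x)) has_integral
      (energy H X h + \<epsilon> * 0 - \<epsilon> * (D + c0) * 0 + \<epsilon>\<^sup>2 / 2 * integral {0..X} (\<lambda>x. (v x)\<^sup>2 - B * h x powr (q - 1) * (U x)\<^sup>2)
       - integral {0..X} (\<lambda>x. taylor_remainder B q (h x) (\<epsilon> * U x)))) {0..X}"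
  proof (intro has_integral_add has_integral_diff has_integral_mult_right)
    have "continuous_on {0..X} (\<lambda>x. (h' x)\<^sup>2 / 2 - (power_potential B q (h x) + c0 * h x + c1))"
      by (intro continuous_intros cont_h cont_h' continuous_on_power_potential) (use pos in auto)
    then have "continuous_on {0..X} (\<lambda>x. (h' x)\<^sup>2 / 2 - H (h x))" using H pos by simp
    then show "((\<lambda>x. (h' x)\<^sup>2 / 2 - H (h x)) has_integral energy H X h) {0..X}"
      unfolding energy_h by (intro integrable_integral integrable_continuous_real)
    have "primitive_on 0 X h' (\<lambda>x. D - B / q * h x powr q)"
      by (rule primitive_on_derivative[OF h']) (intro continuous_intros cont_powr)
    from primitive_on_integral[OF primitive_on_mult[OF U(1) this], of 0 X]
    show "((\<lambda>x. v x * h' x + U x * (D - B / q * h x powr q)) has_integral 0) {0..X}"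
      using X U(2) per'[unfolded periodic_def, rule_format, of 0] by simp
    show "(U has_integral 0) {0..X}" by (rule U0)
    have "(\<lambda>x. (v x)\<^sup>2) integrable_on {0..X}"
      using u(3) unfolding L2_circle_def by (auto intro: absolutely_integrable_imp_integrable_on)
    then show "((\<lambda>x. (v x)\<^sup>2 - B * h x powr (q - 1) * (U x)\<^sup>2) has_integral
        integral {0..X} (\<lambda>x. (v x)\<^sup>2 - B * h x powr (q - 1) * (U x)\<^sup>2)) {0..X}"
      by (intro integrable_integral integrable_diff[OF _ integrable_continuous_real] continuous_intros cont_powr cU)
    show "((\<lambda>x. taylor_remainder B q (h x) (\<epsilon> * U x)) has_integral
       integral {0..X} (\<lambda>x. taylor_remainder B q (h x) (\<epsilon> * U x))) {0..X}"
      by (intro integrable_integral integrable_continuous_real continuous_on_taylor_remainder cont_h continuous_intros cU)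
         (use pos eps in auto)
  qed
  moreover have eq: "((h' x)\<^sup>2 / 2 - H (h x)) + \<epsilon> * (v x * h' x + U x * (D - B / q * h x powr q))
      - \<epsilon> * (D + c0) * U x + \<epsilon>\<^sup>2 / 2 * ((v x)\<^sup>2 - B * h x powr (q - 1) * (U x)\<^sup>2)
      - taylor_remainder B q (h x) (\<epsilon> * U x) = (h' x + \<epsilon> * v x)\<^sup>2 / 2 - H (h x + \<epsilon> * U x)" if "x \<in> {0..X}" for x
    using H[OF pos[of x]] H[OF eps[OF that]] q
    by (simp add: taylor_remainder_def power2_eq_square field_simps)
  ultimately have "((\<lambda>x. (h' x + \<epsilon> * v x)\<^sup>2 / 2 - H (h x + \<epsilon> * U x)) has_integral
      (energy H X h + \<epsilon> * 0 - \<epsilon> * (D + c0) * 0 + \<epsilon>\<^sup>2 / 2 * integral {0..X} (\<lambda>x. (v x)\<^sup>2 - B * h x powr (q - 1) * (U x)\<^sup>2)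
       - integral {0..X} (\<lambda>x. taylor_remainder B q (h x) (\<epsilon> * U x)))) {0..X}"
    by (intro has_integral_eq[OF eq sum])
  then show ?thesis
    using \<open>energy H X (\<lambda>x. h x + \<epsilon> * u x) = _\<close> by (simp add: integral_unique)
qed

lemma eventually_positive:
  assumes "continuous_on {0..X} U"
  shows "\<forall>\<^sub>F \<epsilon> in at_right 0. \<forall>x\<in>{0..X}. h x + \<epsilon> * U x > 0"
    and "\<exists>K. \<forall>\<^sub>F \<epsilon> in at_right 0. \<bar>integral {0..X} (\<lambda>x. taylor_remainder B q (h x) (\<epsilon> * U x))\<bar> \<le> K * \<epsilon> ^ 3"
proof -
  obtain m where m: "m > 0" "\<And>x. x \<in> {0..X} \<Longrightarrow> m \<le> h x" using min_h by blast
  have "bounded (U ` {0..X})" by (intro compact_imp_bounded compact_continuous_image assms) auto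
  then obtain M where M: "M > 0" "\<And>x. x \<in> {0..X} \<Longrightarrow> \<bar>U x\<bar> \<le> M" unfolding bounded_pos by auto
  have small: "\<forall>\<^sub>F \<epsilon> in at_right 0. 0 < \<epsilon> \<and> (\<forall>x\<in>{0..X}. \<bar>\<epsilon> * U x\<bar> \<le> m / 2)"
    unfolding eventually_at_right_field
  proof (intro exI[of _ "m / (2 * M)"] conjI allI impI ballI)
    fix \<epsilon> x assume e: "0 < \<epsilon>" "\<epsilon> < m / (2 * M)" and x: "x \<in> {0..X}"
    have "\<bar>\<epsilon> * U x\<bar> \<le> \<epsilon> * M" using e M(2)[OF x] by (simp add: abs_mult)
    also have "\<dots> \<le> m / 2" using e M(1) by (simp add: field_simps)
    finally show "\<bar>\<epsilon> * U x\<bar> \<le> m / 2" .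
  qed (use m M in auto)
  have posi: "h x + \<epsilon> * U x > 0" if "\<forall>x\<in>{0..X}. \<bar>\<epsilon> * U x\<bar> \<le> m / 2" "x \<in> {0..X}" for x \<epsilon>
    using m(1) m(2)[OF that(2)] bspec[OF that] by linarith
  show "\<forall>\<^sub>F \<epsilon> in at_right 0. \<forall>x\<in>{0..X}. h x + \<epsilon> * U x > 0"
    by (rule eventually_mono[OF small]) (use posi in blast)
  define C where "C = B * (q - 1) * (m / 2) powr (q - 2) / 6"
  show "\<exists>K. \<forall>\<^sub>F \<epsilon> in at_right 0. \<bar>integral {0..X} (\<lambda>x. taylor_remainder B q (h x) (\<epsilon> * U x))\<bar> \<le> K * \<epsilon> ^ 3"
  proof (intro exI, rule eventually_mono[OF small])
    fix \<epsilon> assume e: "0 < \<epsilon> \<and> (\<forall>x\<in>{0..X}. \<bar>\<epsilon> * U x\<bar> \<le> m / 2)"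
    have "norm (integral {0..X} (\<lambda>x. taylor_remainder B q (h x) (\<epsilon> * U x))) \<le> integral {0..X} (\<lambda>x. C * \<bar>\<epsilon> * U x\<bar> ^ 3)"
    proof (rule integral_norm_bound_integral)
      show "(\<lambda>x. taylor_remainder B q (h x) (\<epsilon> * U x)) integrable_on {0..X}"
        by (intro integrable_continuous_real continuous_on_taylor_remainder cont_h continuous_intros assms)
           (use pos posi e in auto)
      show "(\<lambda>x. C * \<bar>\<epsilon> * U x\<bar> ^ 3) integrable_on {0..X}"
        by (intro integrable_continuous_real continuous_intros assms)
      fix x assume x: "x \<in> {0..X}"
      show "norm (taylor_remainder B q (h x) (\<epsilon> * U x)) \<le> C * \<bar>\<epsilon> * U x\<bar> ^ 3"
        unfolding real_norm_def C_def
        by (rule taylor_remainder_bound) (use m(1) m(2)[OF x] e x q B in auto)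
    qed
    also have "(\<lambda>x. C * \<bar>\<epsilon> * U x\<bar> ^ 3) = (\<lambda>x. (C * \<bar>U x\<bar> ^ 3) * \<epsilon> ^ 3)"
      using e by (auto simp: abs_mult power_mult_distrib)
    finally show "\<bar>integral {0..X} (\<lambda>x. taylor_remainder B q (h x) (\<epsilon> * U x))\<bar> \<le> integral {0..X} (\<lambda>x. C * \<bar>U x\<bar> ^ 3) * \<epsilon> ^ 3"
      by simp
  qed
qed

lemma eventually_cubic_small:
  assumes "(a::real) > 0"
  shows "\<forall>\<^sub>F \<epsilon> in at_right 0. K * \<epsilon> ^ 3 < \<epsilon>\<^sup>2 / 2 * a"
  unfolding eventually_at_right_field
proof (intro exI[of _ "a / (2 * (\<bar>K\<bar> + 1))"] conjI allI impI)
  fix \<epsilon> :: real assume e: "0 < \<epsilon>" "\<epsilon> < a / (2 * (\<bar>K\<bar> + 1))"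
  have "K * \<epsilon> \<le> \<bar>K\<bar> * \<epsilon>" by (rule mult_right_mono) (use e in auto)
  moreover have "(\<bar>K\<bar> + 1) * \<epsilon> < a / 2" using e by (simp add: field_simps)
  ultimately have "K * \<epsilon> < a / 2" using e(1) unfolding distrib_right by linarith
  then have "\<epsilon>\<^sup>2 * (K * \<epsilon>) < \<epsilon>\<^sup>2 * (a / 2)" using e by (intro mult_strict_left_mono) auto
  then show "K * \<epsilon> ^ 3 < \<epsilon>\<^sup>2 / 2 * a" by (simp add: power2_eq_square power3_eq_cube algebra_simps)
qed (use assms in \<open>auto intro!: divide_pos_pos add_nonneg_pos\<close>)

text \<open>The quadratic term is negative of second order in the step size and the Taylor remainder
  only of third order.\<close>

lemma energy_unstableI:
  assumes u: "smooth u" "periodic X u" "integral {0..X} u = 0"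
    and Q: "integral {0..X} (\<lambda>x. (deriv u x)\<^sup>2 - B * h x powr (q - 1) * (u x)\<^sup>2) < 0"
  shows "energy_unstable H X h"
  unfolding energy_unstable_def
proof (intro exI[of _ u] conjI u)
  have uL: "u \<in> L2_circle X" by (rule L2_circle_continuous[OF smooth_continuous[OF u(1)] u(2)])
  have vL: "deriv u \<in> L2_circle X"
    by (rule L2_circle_continuous[OF smooth_continuous_deriv[OF u(1)] periodic_derivative[OF u(2) smooth_has_derivative[OF u(1)]]])
  have prim: "primitive_on 0 X u (deriv u)"
    by (rule primitive_on_derivative[OF smooth_has_derivative[OF u(1)] continuous_on_subset[OF smooth_continuous_deriv[OF u(1)]]]) auto
  have uX: "u X = u 0" using u(2)[unfolded periodic_def, rule_format, of 0] by simp
  have w: "has_weak_deriv X u (deriv u)" by (rule primitive_on_has_weak_deriv[OF prim uX X])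
  obtain K where "\<forall>\<^sub>F \<epsilon> in at_right 0. \<bar>integral {0..X} (\<lambda>x. taylor_remainder B q (h x) (\<epsilon> * u x))\<bar> \<le> K * \<epsilon> ^ 3"
    using eventually_positive(2)[OF smooth_continuous[OF u(1)]] by blast
  moreover have "\<forall>\<^sub>F \<epsilon> in at_right 0. K * \<epsilon> ^ 3 < \<epsilon>\<^sup>2 / 2 * - integral {0..X} (\<lambda>x. (deriv u x)\<^sup>2 - B * h x powr (q - 1) * (u x)\<^sup>2)"
    by (rule eventually_cubic_small) (use Q in simp)
  ultimately show "\<forall>\<^sub>F \<epsilon> in at_right 0. energy H X (\<lambda>x. h x + \<epsilon> * u x) < energy H X h"
    using eventually_positive(1)[OF smooth_continuous[OF u(1)]]
  proof eventually_elim
    case (elim \<epsilon>)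
    then show ?case
      using energy_increment[OF uL w vL negligible_empty _ prim uX u(3), of \<epsilon>] by simp
  qed
qed

text \<open>Conservation of mechanical energy for the second-order equation; its use is that the
  square of \<open>h'\<close> becomes a function of \<open>h\<close> alone.\<close>

lemma first_integral: "\<exists>e. \<forall>x. (h' x)\<^sup>2 = 2 * (e + D * h x - power_potential B q (h x))"
proof -
  have "((\<lambda>x. (h' x)\<^sup>2 / 2 - D * h x + power_potential B q (h x)) has_real_derivative 0) (at x)" for x
  proof -
    have "((\<lambda>x. power_potential B q (h x)) has_real_derivative B * h x powr q / q * h' x) (at x)"
      by (rule DERIV_chain2[OF power_potential_derivs(1)[OF pos q(1)] h])
    moreover have "((\<lambda>x. (h' x)\<^sup>2 / 2 - D * h x) has_real_derivative h' x * (D - B / q * h x powr q) - D * h' x) (at x)"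
      by (auto intro!: derivative_eq_intros h h')
    ultimately have "((\<lambda>x. (h' x)\<^sup>2 / 2 - D * h x + power_potential B q (h x)) has_real_derivative
        h' x * (D - B / q * h x powr q) - D * h' x + B * h x powr q / q * h' x) (at x)"
      by (rule DERIV_add[rotated])
    then show ?thesis by (simp add: algebra_simps)
  qed
  then have "(h' x)\<^sup>2 / 2 - D * h x + power_potential B q (h x) = (h' 0)\<^sup>2 / 2 - D * h 0 + power_potential B q (h 0)" for x
    by (intro DERIV_isconst_all) simp
  then show ?thesis
    by (intro exI[of _ "(h' 0)\<^sup>2 / 2 - D * h 0 + power_potential B q (h 0)"]) (simp add: field_simps)
qed

text \<open>By the first integral the integrand is a function of \<open>h\<close> times
  \<open>h'\<close>, the exact derivative of a periodic function.\<close>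

lemma cubic_integral_zero: "((\<lambda>x. h x powr (q - 2) * (h' x) ^ 3) has_integral 0) {0..X}"
proof -
  obtain e where e: "\<And>x. (h' x)\<^sup>2 = 2 * (e + D * h x - power_potential B q (h x))" using first_integral by blast
  \<comment> \<open>Coefficients of the term-by-term primitive of \<open>h powr (q - 2)\<close>
    times the expression for the square of \<open>h'\<close>.\<close>
  define a1 a2 a3 where "a1 = 2 * e / (q - 1)" and "a2 = 2 * D / q" and "a3 = 2 * B / (q * (q + 1) * (2 * q))"
  let ?A = "\<lambda>x. a1 * h x powr (q - 1) + a2 * h x powr q - a3 * h x powr (2 * q)"
  have "(?A has_real_derivative h x powr (q - 2) * (h' x) ^ 3) (at x)" for x
  proof -
    have "(?A has_real_derivative a1 * ((q - 1) * h x powr (q - 1 - 1) * h' x) + a2 * (q * h x powr (q - 1) * h' x)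
        - a3 * (2 * q * h x powr (2 * q - 1) * h' x)) (at x)"
      using DERIV_fun_powr[OF h pos, of "q - 1" x] DERIV_fun_powr[OF h pos, of q x] DERIV_fun_powr[OF h pos, of "2 * q" x]
      by (intro DERIV_add DERIV_diff DERIV_cmult) simp_all
    moreover have "h x powr (q - 1) = h x powr (q - 2) * h x" "h x powr (2 * q - 1) = h x powr (q - 2) * h x powr (q + 1)"
      "h x powr (q - 1 - 1) = h x powr (q - 2)"
      using pos[of x] powr_add[of "h x" "q - 2" 1] powr_add[of "h x" "q - 2" "q + 1"] by (simp_all add: algebra_simps)
    moreover have "a1 * (q - 1) = 2 * e" "a2 * q = 2 * D" "a3 * (2 * q) = 2 * (B / (q * (q + 1)))"
      using q by (simp_all add: a1_def a2_def a3_def mult.commute)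
    moreover have "(h' x) ^ 3 = 2 * (e + D * h x - B / (q * (q + 1)) * h x powr (q + 1)) * h' x"
      using e[of x] by (simp add: power2_eq_square power3_eq_cube power_potential_def)
    moreover have "a1 * ((q - 1) * s) = (a1 * (q - 1)) * s" "a2 * (q * s) = (a2 * q) * s" "a3 * (2 * q * s) = (a3 * (2 * q)) * s" for s
      by simp_all
    ultimately show ?thesis by (simp add: mult.assoc) (simp add: algebra_simps)
  qed
  from has_integral_of_derivative[OF _ this, of 0 X] X per[unfolded periodic_def, rule_format, of 0]
  show ?thesis by simp
qed

text \<open>The data \<open>w\<close>, \<open>p1\<close>, \<open>p2\<close> give a nonnegative
  second variation \<open>Q\<close>. For \<open>Q > 0\<close> it outweighs the remainder. For
  \<open>Q = 0\<close> the perturbation is a multiple of \<open>h'\<close> and only the remainder is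
  left: its cubic part integrates to zero and the rest has a strict sign.\<close>

lemma energy_stableI:
  fixes w w' p1 p1' p2 p2' :: "real \<Rightarrow> real"
  defines "c \<equiv> \<lambda>x. B * h x powr (q - 1)"
  assumes ab: "a \<le> b" "b \<le> a + X" and h'a: "h' a \<noteq> 0"
    and pw: "periodic X w" and w: "\<And>x. (w has_real_derivative w' x) (at x)" "\<And>x. (w' has_real_derivative \<kappa> - c x * w x) (at x)"
    and W: "(w has_integral W) {0..X}" "0 < W" and kappa: "\<kappa> > 0"
    and p1: "\<And>x. x \<in> {a..b} \<Longrightarrow> 0 < p1 x" "\<And>x. (p1 has_real_derivative p1' x) (at x)"
      "\<And>x. (p1' has_real_derivative - (c x * p1 x)) (at x)"
    and p2: "\<And>x. x \<in> {b..a + X} \<Longrightarrow> 0 < p2 x" "\<And>x. (p2 has_real_derivative p2' x) (at x)"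
      "\<And>x. (p2' has_real_derivative - (c x * p2 x)) (at x)"
  shows "energy_stable H X h"
  unfolding energy_stable_def
proof (intro ballI impI; elim conjE)
  fix u assume u: "u \<in> H1_circle X" "\<not> (AE x in lebesgue. u x = 0)" "integral {0..X} u = 0"
  have uL: "u \<in> L2_circle X" and pu: "periodic X u" using u(1) unfolding H1_circle_def L2_circle_def by auto
  obtain U v N where U: "periodic X U" "v \<in> L2_circle X" "\<And>a b. primitive_on a b U v"
    "has_weak_deriv X u v" "negligible N" "\<And>x. x \<in> {0..X} \<Longrightarrow> x \<notin> N \<Longrightarrow> u x = U x"
    by (rule H1_circle_representative[OF X u(1)]) (rule that)
  have pv: "periodic X v" using U(2) unfolding L2_circle_def by auto
  have UX: "U X = U 0" using U(1)[unfolded periodic_def, rule_format, of 0] by simp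
  have cU: "continuous_on {0..X} U" by (rule primitive_on_continuous[OF U(3)])
  have cc: "continuous_on S c" for S unfolding c_def by (intro continuous_intros cont_powr)
  define Q where "Q = integral {0..X} (\<lambda>x. (v x)\<^sup>2 - B * h x powr (q - 1) * (U x)\<^sup>2)"
  note inc = energy_increment[OF uL U(4) U(2) U(5) U(6) U(3) UX u(3)]
  have U0: "(U has_integral 0) {0..X}"
  proof -
    have "integral {0..X} U = integral {0..X} u" by (rule integral_spike[OF U(5)]) (use U(6) in auto)
    then show ?thesis using u(3) integrable_continuous_real[OF cU] by (simp add: has_integral_iff)
  qed
  have v2: "(\<lambda>x. (v x)\<^sup>2) absolutely_integrable_on {0..X}" using U(2) unfolding L2_circle_def by auto
  have "((\<lambda>x. (v x)\<^sup>2 - c x * (U x)\<^sup>2) has_integral Q) {0..X}"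
    unfolding Q_def c_def
    by (intro integrable_integral integrable_diff[OF _ integrable_continuous_real]
        absolutely_integrable_imp_integrable_on v2 continuous_intros cont_powr cU)
  then have Q: "((\<lambda>x. (v x)\<^sup>2 - c x * (U x)\<^sup>2) has_integral Q) {a..a + X}"
    by (rule periodic_has_integral_shift[OF X, rotated]) (use pv U(1) per in \<open>auto simp: periodic_def c_def\<close>)
  have k': "((\<lambda>x. D - B / q * h x powr q) has_real_derivative - (c x * h' x)) (at x)" for x
    unfolding c_def using DERIV_diff[OF DERIV_const[of D] DERIV_cmult[OF DERIV_fun_powr[OF h pos, of q x], of "B / q"]] q by (simp add: mult.assoc)
  have h'0: "(h' has_integral 0) {a..a + X}"
    using has_integral_of_derivative[OF _ h, of a "a + X"] X per[unfolded periodic_def, rule_format, of a] by simp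
  have pw': "periodic X w'" by (rule periodic_derivative[OF pw w(1)])
  note form = constrained_quadratic_form_nonneg[OF ab X U(3) periodic_absolutely_integrable_shift[OF X _ v2]
      _ _ _ _ _ cc w h' k' periodic_has_integral_shift[OF X U(1) U0] periodic_has_integral_shift[OF X pw W(1)] W(2) h'0 h'a kappa p1 p2 Q]
  have pers: "periodic X (\<lambda>x. (v x)\<^sup>2)" "U (a + X) = U a" "w (a + X) = w a" "w' (a + X) = w' a" "h' (a + X) = h' a"
    "D - B / q * h (a + X) powr q = D - B / q * h a powr q"
    using pv U(1) pw pw' per per' by (auto simp: periodic_def)
  have "0 \<le> Q" by (rule form(1)) (use pers in auto)
  show "\<forall>\<^sub>F \<epsilon> in at_right 0. energy H X h < energy H X (\<lambda>x. h x + \<epsilon> * u x)"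
  proof (cases "Q = 0")
    case False
    obtain K where "\<forall>\<^sub>F \<epsilon> in at_right 0. \<bar>integral {0..X} (\<lambda>x. taylor_remainder B q (h x) (\<epsilon> * U x))\<bar> \<le> K * \<epsilon> ^ 3"
      using eventually_positive(2)[OF cU] by blast
    moreover have "\<forall>\<^sub>F \<epsilon> in at_right 0. K * \<epsilon> ^ 3 < \<epsilon>\<^sup>2 / 2 * Q"
      by (rule eventually_cubic_small) (use False \<open>0 \<le> Q\<close> in simp)
    ultimately show ?thesis using eventually_positive(1)[OF cU]
    proof eventually_elim
      case (elim \<epsilon>)
      then show ?case using inc[of \<epsilon>] unfolding Q_def[symmetric] by simp
    qed
  next
    case True
    have "\<exists>t. \<forall>x\<in>{a..a + X}. U x = t * h' x" by (rule form(2)) (use pers True in auto)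
    then obtain t where t: "\<And>x. x \<in> {a..a + X} \<Longrightarrow> U x = t * h' x" by blast
    have Ut: "U x = t * h' x" for x
    proof -
      obtain k :: int where "a \<le> x + of_int k * X" "x + of_int k * X < a + X" by (rule periodic_representative[OF X])
      then show ?thesis using t[of "x + of_int k * X"] periodic_int[OF U(1)] periodic_int[OF per'] by simp
    qed
    have "t \<noteq> 0"
    proof
      assume "t = 0"
      then have u0: "x \<in> {0..X} \<Longrightarrow> x \<notin> N \<Longrightarrow> u x = 0" for x using U(6) Ut by auto
      \<comment> \<open>\<open>u\<close> is known to vanish almost everywhere on one period only;
        the exceptional set is spread over the line by its countably many translates.\<close>
      have "negligible (\<Union>k::int. (+) (- (of_int k * X)) ` N)"
        proof (rule negligible_countable_Union)
        fix S assume "S \<in> range (\<lambda>k::int. (+) (- (of_int k * X)) ` N)"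
        then show "negligible S" using negligible_translation[OF U(5)] by blast
      qed simp
      moreover have "{x. u x \<noteq> 0} \<subseteq> (\<Union>k::int. (+) (- (of_int k * X)) ` N)"
      proof
        fix x assume x: "x \<in> {x. u x \<noteq> 0}"
        obtain k :: int where k: "0 \<le> x + of_int k * X" "x + of_int k * X < 0 + X" by (rule periodic_representative[OF X])
        then have "x + of_int k * X \<in> N" using u0[of "x + of_int k * X"] x periodic_int[OF pu] by auto
        then show "x \<in> (\<Union>k::int. (+) (- (of_int k * X)) ` N)" by (auto intro!: exI[of _ k] image_eqI[of _ _ "x + of_int k * X"])
      qed
      ultimately have "negligible {x. u x \<noteq> 0}" by (rule negligible_subset)
      then have "AE x in lebesgue. u x = 0"
        unfolding eventually_ae_filter_negligible by (intro exI[of _ "{x. u x \<noteq> 0}"]) auto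
      then show False using u(2) by simp
    qed
    show ?thesis using eventually_positive(1)[OF cU] eventually_at_right_less[of 0]
    proof eventually_elim
      case (elim \<epsilon>)
      define s where "s = \<epsilon> * t"
      have "s \<noteq> 0" using \<open>t \<noteq> 0\<close> elim by (simp add: s_def)
      \<comment> \<open>Cubic Taylor term minus remainder: nonnegative, positive where
        \<open>h'\<close> does not vanish, and with integral \<open>- r\<close>, because the cubic
        term integrates to zero.\<close>
      let ?g = "\<lambda>x. B * (q - 1) / 6 * s ^ 3 * (h x powr (q - 2) * (h' x) ^ 3) - taylor_remainder B q (h x) (s * h' x)"
      have eps: "h x + s * h' x > 0" if "x \<in> {0..X}" for x
        using bspec[OF elim(1) that] by (simp add: Ut s_def mult_ac)
      have cr: "continuous_on {0..X} (\<lambda>x. taylor_remainder B q (h x) (s * h' x))"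
        by (intro continuous_on_taylor_remainder cont_h cont_h' continuous_intros) (use pos eps in auto)
      have cg: "continuous_on {0..X} ?g"
        by (intro continuous_intros cr cont_powr cont_h')
      have g0: "0 < ?g x" if "x \<in> {0..X}" "h' x \<noteq> 0" for x
        using taylor_remainder_fourth[OF pos eps[OF that(1)] _ q B] that(2) \<open>s \<noteq> 0\<close>
        by (simp add: power_mult_distrib mult_ac)
      have gn: "0 \<le> ?g x" if "x \<in> {0..X}" for x
        using g0[OF that] by (cases "h' x = 0") (auto simp: taylor_remainder_def)
      define r where "r = integral {0..X} (\<lambda>x. taylor_remainder B q (h x) (s * h' x))"
      have gi: "(?g has_integral B * (q - 1) / 6 * s ^ 3 * 0 - r) {0..X}"
        unfolding r_def
        by (intro has_integral_diff has_integral_mult_right cubic_integral_zero integrable_integral integrable_continuous_real cr)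
      then have "0 \<le> - r" using has_integral_nonneg[OF gi] gn by simp
      moreover have "r \<noteq> 0"
      proof
        assume "r = 0"
        \<comment> \<open>A translate of \<open>a\<close> inside the basic period is a point where
          the integrand is strictly positive.\<close>
        obtain k :: int where k: "0 \<le> a + of_int k * X" "a + of_int k * X < 0 + X" by (rule periodic_representative[OF X])
        have "?g (a + of_int k * X) = 0"
          by (rule has_integral_0_cbox_imp_0[of 0 X ?g]) (use cg gn gi \<open>r = 0\<close> X k in auto)
        moreover have "h' (a + of_int k * X) \<noteq> 0" using h'a periodic_int[OF per'] by simp
        ultimately show False using g0[of "a + of_int k * X"] k by simp
      qed
      ultimately have "r < 0" by simp
      moreover have "(\<lambda>x. taylor_remainder B q (h x) (\<epsilon> * U x)) = (\<lambda>x. taylor_remainder B q (h x) (s * h' x))"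
        by (simp add: Ut s_def mult_ac)
      ultimately show ?case
        using inc[of \<epsilon>] elim(1) True unfolding Q_def[symmetric] r_def by simp
    qed
  qed
qed

end

section \<open>Linearising the potential well\<close>

text \<open>L'Hopital's rule for the difference quotient. It supplies the derivative of
  \<open>G1\<close> at 0, where the explicit formula degenerates to 0/0.\<close>

lemma has_derivative_of_limit:
  fixes f f' :: "real \<Rightarrow> real"
  assumes "isCont f a" "\<forall>\<^sub>F x in at a. (f has_real_derivative f' x) (at x)" "(f' \<longlongrightarrow> L) (at a)"
  shows "(f has_real_derivative L) (at a)"
proof -
  have "((\<lambda>x. (f x - f a) / (x - a)) \<longlongrightarrow> L) (at a)"
  proof (rule lhopital[where f' = f' and g' = "\<lambda>_. 1"])
    show "((\<lambda>x. f x - f a) \<longlongrightarrow> 0) (at a)" using assms(1) by (simp add: isCont_def LIM_zero)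
    show "((\<lambda>x. x - a) \<longlongrightarrow> 0) (at a)" by (simp add: LIM_zero)
    show "\<forall>\<^sub>F x in at a. x - a \<noteq> 0" by (auto simp: eventually_at intro: exI[of _ 1])
    show "\<forall>\<^sub>F x in at a. ((\<lambda>x. f x - f a) has_real_derivative f' x) (at x)"
      using assms(2) by eventually_elim (auto intro!: derivative_eq_intros)
    show "\<forall>\<^sub>F x in at a. ((\<lambda>x. x - a) has_real_derivative 1) (at x)"
      by (intro always_eventually allI) (auto intro!: derivative_eq_intros)
  qed (use assms(3) in auto)
  then show ?thesis by (simp add: has_field_derivative_iff)
qed

lemma has_real_derivative_local_inverse:
  fixes f g :: "real \<Rightarrow> real"
  assumes "open S" "x \<in> S" "continuous_on S f" "\<And>x. x \<in> S \<Longrightarrow> g (f x) = x"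
    and "(f has_real_derivative D) (at x)" "D \<noteq> 0"
  shows "(g has_real_derivative inverse D) (at (f x))"
  unfolding has_field_derivative_def
  by (rule has_derivative_inverse_strong[OF assms(1-4) assms(5)[unfolded has_field_derivative_def]])
     (use assms(6) in \<open>auto simp: fun_eq_iff\<close>)

text \<open>The signs of \<open>V\<close>, \<open>N\<close> and \<open>R\<close> and the tangent
  bounds are all obtained by starting at the equilibrium 1 and reading off the sign of a derivative,
  to the right here and to the left in the companion lemma.\<close>

lemma pos_right_of_zero:
  fixes \<phi> \<phi>' :: "real \<Rightarrow> real"
  assumes "\<phi> 1 = 0" "\<And>k. k > 0 \<Longrightarrow> (\<phi> has_real_derivative \<phi>' k) (at k)" "\<And>k. k > 1 \<Longrightarrow> \<phi>' k > 0" "k > 1"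
  shows "\<phi> k > 0"
proof -
  have "\<phi> 1 < \<phi> k"
  proof (rule DERIV_pos_imp_increasing_open[OF \<open>k > 1\<close>])
    show "continuous_on {1..k} \<phi>" using DERIV_isCont[OF assms(2)] by (intro continuous_at_imp_continuous_on) auto
    show "\<exists>y. (\<phi> has_real_derivative y) (at x) \<and> 0 < y" if "1 < x" "x < k" for x
      using assms(2)[of x] assms(3)[of x] that by auto
  qed
  then show ?thesis using assms(1) by simp
qed

lemma pos_left_of_zero:
  fixes \<phi> \<phi>' :: "real \<Rightarrow> real"
  assumes "\<phi> 1 = 0" "\<And>k. k > 0 \<Longrightarrow> (\<phi> has_real_derivative \<phi>' k) (at k)"
    "\<And>k. 0 < k \<Longrightarrow> k < 1 \<Longrightarrow> \<phi>' k < 0" "0 < k" "k < 1"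
  shows "\<phi> k > 0"
proof -
  have "\<phi> 1 < \<phi> k"
  proof (rule DERIV_neg_imp_decreasing_open[OF \<open>k < 1\<close>])
    show "continuous_on {k..1} \<phi>" using DERIV_isCont[OF assms(2)] assms(4) by (intro continuous_at_imp_continuous_on) auto
    show "\<exists>y. (\<phi> has_real_derivative y) (at x) \<and> y < 0" if "k < x" "x < 1" for x
      using assms(2)[of x] assms(3)[of x] assms(4) that by auto
  qed
  then show ?thesis using assms(1) by simp
qed

locale exponent =
  fixes q :: real
  assumes q: "1 < q" "q < 2"
begin

definition "f k = (k powr q - 1) / q"
definition "V k = (k powr (q + 1) / (q + 1) - k + q / (q + 1)) / q"
text \<open>Equal to \<open>f^2 - 2 V f'\<close>, the numerator of the second derivative of
  \<gamma>, which is \<open>N / f^3\<close> at the point \<gamma>.\<close>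

definition "N k = (f k)\<^sup>2 - 2 * V k * k powr (q - 1)"
text \<open>Equal to \<open>N' f - 3 f' N\<close>, the numerator in the derivative
  \<open>R / f^4\<close> of \<open>N / f^3\<close>.\<close>

definition "R k = - 2 * V k * ((q - 1) * k powr (q - 2)) * f k - 3 * k powr (q - 1) * N k"

section \<open>Signs of the force, the potential and the two numerators\<close>

lemma f_deriv: "k > 0 \<Longrightarrow> (f has_real_derivative k powr (q - 1)) (at k)"
  unfolding f_def using q by (auto intro!: derivative_eq_intros)

lemma V_deriv: "k > 0 \<Longrightarrow> (V has_real_derivative f k) (at k)"
proof -
  assume k: "k > 0"
  have "((\<lambda>k. 1 / (q * (q + 1)) * k powr (q + 1) - 1 / q * k + 1 / (q + 1)) has_real_derivative
      1 / (q * (q + 1)) * ((q + 1) * k powr q) - 1 / q) (at k)"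
    using k q by (auto intro!: derivative_eq_intros)
  moreover have "1 / (q * (q + 1)) * ((q + 1) * k powr q) - 1 / q = f k"
    using q by (simp add: f_def divide_simps)
  moreover have "(\<lambda>k. 1 / (q * (q + 1)) * k powr (q + 1) - 1 / q * k + 1 / (q + 1)) = V"
    using q by (auto simp: V_def divide_simps)
  ultimately show ?thesis by simp
qed

lemma powr_deriv: "k > 0 \<Longrightarrow> ((\<lambda>k. k powr (q - 1)) has_real_derivative (q - 1) * k powr (q - 2)) (at k)"
  by (auto intro!: derivative_eq_intros)

lemma powr_deriv2: "k > 0 \<Longrightarrow> ((\<lambda>k. (q - 1) * k powr (q - 2)) has_real_derivative (q - 1) * (q - 2) * k powr (q - 3)) (at k)"
  by (auto intro!: derivative_eq_intros)

lemma f_1: "f 1 = 0" and V_1: "V 1 = 0" and N_1: "N 1 = 0" and R_1: "R 1 = 0"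
  using q by (simp_all add: f_def V_def N_def R_def divide_simps)

lemma f_pos: "k > 1 \<Longrightarrow> f k > 0"
  using q by (simp add: f_def)

lemma f_neg: "0 < k \<Longrightarrow> k < 1 \<Longrightarrow> f k < 0"
  using q powr_less_mono2[of q k 1] by (simp add: f_def divide_less_0_iff)

lemma f_eq_0_iff: "k > 0 \<Longrightarrow> f k = 0 \<longleftrightarrow> k = 1"
  using f_pos[of k] f_neg[of k] f_1 by (cases k "1::real" rule: linorder_cases) auto

lemma V_pos: "k > 0 \<Longrightarrow> k \<noteq> 1 \<Longrightarrow> V k > 0"
  using pos_right_of_zero[OF V_1 V_deriv f_pos, of k] pos_left_of_zero[OF V_1 V_deriv f_neg, of k] by linarith

lemma V_nonneg: "k > 0 \<Longrightarrow> V k \<ge> 0"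
  using V_pos[of k] V_1 by (cases "k = 1") auto

text \<open>For \<open>q > 1\<close> the force is strictly convex, so it lies above its tangent
  \<open>k - 1\<close> at the equilibrium.\<close>

lemma f_gt: "k > 0 \<Longrightarrow> k \<noteq> 1 \<Longrightarrow> f k > k - 1"
proof -
  assume k: "k > 0" "k \<noteq> 1"
  have d: "((\<lambda>k. f k - (k - 1)) has_real_derivative k powr (q - 1) - 1) (at k)" if "k > 0" for k
    using f_deriv[OF that] by (auto intro!: derivative_eq_intros)
  have "k < 1 \<Longrightarrow> k powr (q - 1) - 1 < 0" if "0 < k" for k using that q powr_less_mono2[of "q - 1" k 1] by auto
  then show ?thesis
    using pos_right_of_zero[OF _ d, of k] pos_left_of_zero[OF _ d, of k] f_1 q k by fastforce
qed

text \<open>The tangent bound for \<open>f\<close>, integrated. It guarantees that the potential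
  reaches every level to the right of 1.\<close>

lemma V_ge: "k > 1 \<Longrightarrow> V k > (k - 1)\<^sup>2 / 2"
proof -
  assume k: "k > 1"
  have d: "((\<lambda>k. V k - (k - 1)\<^sup>2 / 2) has_real_derivative f k - (k - 1)) (at k)" if "k > 0" for k
  proof (rule DERIV_diff[OF V_deriv[OF that]])
    show "((\<lambda>k. (k - 1)\<^sup>2 / 2) has_real_derivative k - 1) (at k)"
      by (auto intro!: derivative_eq_intros simp: field_simps)
  qed
  show ?thesis using pos_right_of_zero[OF _ d _ k] V_1 f_gt by force
qed

text \<open>The two terms \<open>2 f f'\<close> cancel and only \<open>- 2 V f''\<close> survives,
  so that \<open>N\<close> has the sign opposite to \<open>k - 1\<close>.\<close>

lemma N_deriv: "k > 0 \<Longrightarrow> (N has_real_derivative - 2 * V k * ((q - 1) * k powr (q - 2))) (at k)"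
proof -
  assume k: "k > 0"
  have "((\<lambda>k. (f k)\<^sup>2 - 2 * V k * k powr (q - 1)) has_real_derivative
     2 * f k * k powr (q - 1) - (2 * V k * ((q - 1) * k powr (q - 2)) + 2 * f k * k powr (q - 1))) (at k)"
    by (rule derivative_eq_intros f_deriv[OF k] V_deriv[OF k] powr_deriv[OF k] refl)+ (simp add: algebra_simps)
  moreover have "N = (\<lambda>k. (f k)\<^sup>2 - 2 * V k * k powr (q - 1))" by (auto simp: N_def)
  ultimately show ?thesis by simp
qed

lemma N_pos: "0 < k \<Longrightarrow> k < 1 \<Longrightarrow> N k > 0"
  by (rule pos_left_of_zero[OF N_1 N_deriv]) (use V_pos q in auto)

lemma N_neg: "k > 1 \<Longrightarrow> N k < 0"
proof -
  assume k: "k > 1"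
  have d: "((\<lambda>k. - N k) has_real_derivative 2 * V k * ((q - 1) * k powr (q - 2))) (at k)" if "k > 0" for k
    using DERIV_minus[OF N_deriv[OF that]] by simp
  have "- N k > 0" by (rule pos_right_of_zero[OF _ d _ k]) (use V_pos q N_1 in auto)
  then show ?thesis by simp
qed

text \<open>In short \<open>R' = - 5 f'' N - 2 V f f'''\<close>. Both summands have the sign of
  \<open>k - 1\<close>, the second because \<open>f'''\<close> is negative.\<close>

lemma R_deriv: "k > 0 \<Longrightarrow> (R has_real_derivative
    - 5 * ((q - 1) * k powr (q - 2)) * N k - 2 * V k * f k * ((q - 1) * (q - 2) * k powr (q - 3))) (at k)"
proof -
  assume k: "k > 0"
  let ?f1 = "k powr (q - 1)" and ?f2 = "(q - 1) * k powr (q - 2)" and ?f3 = "(q - 1) * (q - 2) * k powr (q - 3)"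
  have "((\<lambda>k. ((-2) * V k) * ((q - 1) * k powr (q - 2)) * f k - (3 * k powr (q - 1)) * N k) has_real_derivative
     ((((-2) * V k) * ?f3 + ((-2) * f k) * ?f2) * f k + ?f1 * (((-2) * V k) * ?f2)
      - ((3 * ?f1) * (- 2 * V k * ?f2) + (3 * ?f2) * N k))) (at k)"
    by (intro DERIV_diff DERIV_mult' DERIV_cmult f_deriv V_deriv N_deriv powr_deriv powr_deriv2 k
        DERIV_cong[OF DERIV_mult'[OF DERIV_mult'[OF DERIV_cmult[OF V_deriv[OF k]] powr_deriv2[OF k]] f_deriv[OF k]]])
       simp_all
  moreover have "R = (\<lambda>k. ((-2) * V k) * ((q - 1) * k powr (q - 2)) * f k - (3 * k powr (q - 1)) * N k)"
    by (auto simp: R_def)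
  moreover have "((((-2) * V k) * ?f3 + ((-2) * f k) * ?f2) * f k + ?f1 * (((-2) * V k) * ?f2)
      - ((3 * ?f1) * (- 2 * V k * ?f2) + (3 * ?f2) * N k)) = - 5 * ?f2 * N k - 2 * V k * f k * ?f3"
    unfolding N_def by (simp add: power2_eq_square algebra_simps)
  ultimately show ?thesis by metis
qed

text \<open>This is where \<open>q < 2\<close> enters the monotonicity of the period.\<close>

lemma R_pos: "k > 0 \<Longrightarrow> k \<noteq> 1 \<Longrightarrow> R k > 0"
proof -
  assume k: "k > 0" "k \<noteq> 1"
  have s: "(q - 1) * k powr (q - 2) > 0" "(q - 1) * (q - 2) * k powr (q - 3) < 0" if "k > 0" for k
    using that q by (auto simp: mult_pos_neg mult_neg_pos)
  show ?thesis
  proof (cases "k < 1")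
    case True
    show ?thesis
    proof (rule pos_left_of_zero[OF R_1 R_deriv])
      fix k :: real assume k: "0 < k" "k < 1"
      have "((q - 1) * k powr (q - 2)) * N k > 0" using s(1)[OF k(1)] N_pos[OF k] by simp
      moreover have "V k * f k < 0" using V_pos[of k] f_neg[OF k] k by (simp add: mult_pos_neg)
      then have "(V k * f k) * ((q - 1) * (q - 2) * k powr (q - 3)) > 0"
        using s(2)[OF k(1)] mult_neg_neg by blast
      ultimately show "- 5 * ((q - 1) * k powr (q - 2)) * N k - 2 * V k * f k * ((q - 1) * (q - 2) * k powr (q - 3)) < 0"
        by (simp only: mult.assoc mult_minus_left)
    qed (use k True in auto)
  next
    case False
    show ?thesis
    proof (rule pos_right_of_zero[OF R_1 R_deriv])
      fix k :: real assume k: "1 < k"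
      then have k0: "0 < k" by simp
      have "((q - 1) * k powr (q - 2)) * N k < 0" using s(1)[OF k0] N_neg[OF k] mult_pos_neg by blast
      moreover have "V k * f k > 0" using V_pos[of k] f_pos[OF k] k by simp
      then have "(V k * f k) * ((q - 1) * (q - 2) * k powr (q - 3)) < 0"
        using s(2)[OF k0] mult_pos_neg by blast
      ultimately show "- 5 * ((q - 1) * k powr (q - 2)) * N k - 2 * V k * f k * ((q - 1) * (q - 2) * k powr (q - 3)) > 0"
        by (simp only: mult.assoc mult_minus_left)
    qed (use k False in auto)
  qed
qed

section \<open>The coordinate in which the potential well is harmonic\<close>

definition "g k = (if k < 1 then - sqrt (2 * V k) else sqrt (2 * V k))"

lemma g_sq: "k > 0 \<Longrightarrow> (g k)\<^sup>2 = 2 * V k"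
  using V_nonneg by (simp add: g_def)

lemma g_1: "g 1 = 0"
  by (simp add: g_def V_1)

lemma g_pos: "k > 1 \<Longrightarrow> g k > 0" and g_neg: "0 < k \<Longrightarrow> k < 1 \<Longrightarrow> g k < 0"
  using V_pos by (simp_all add: g_def)

lemma at_1_pos: "\<forall>\<^sub>F k in at (1::real). k > 0 \<and> k \<noteq> 1"
  unfolding eventually_at by (intro exI[of _ 1]) (auto simp: dist_real_def)

lemma tendsto_at_1:
  "(f \<longlongrightarrow> 0) (at 1)" "(V \<longlongrightarrow> 0) (at 1)" "(N \<longlongrightarrow> 0) (at 1)"
  using DERIV_isCont[OF f_deriv, of 1] DERIV_isCont[OF V_deriv, of 1] DERIV_isCont[OF N_deriv, of 1] f_1 V_1 N_1
  by (simp_all add: isCont_def)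

lemma f_div_tendsto: "((\<lambda>k. f k / (k - 1)) \<longlongrightarrow> 1) (at 1)"
  using f_deriv[of 1] f_1 by (simp add: has_field_derivative_iff)

lemma V_div_tendsto: "((\<lambda>k. 2 * V k / (k - 1)\<^sup>2) \<longlongrightarrow> 1) (at 1)"
proof (rule lhopital[where f' = "\<lambda>k. 2 * f k" and g' = "\<lambda>k. 2 * (k - 1)"])
  show "((\<lambda>k. 2 * V k) \<longlongrightarrow> 0) (at 1)" using tendsto_mult_right_zero[OF tendsto_at_1(2)] .
  show "((\<lambda>k. (k - 1)\<^sup>2) \<longlongrightarrow> 0) (at (1::real))" by (auto intro!: tendsto_eq_intros)
  show "\<forall>\<^sub>F k in at 1. (k - 1)\<^sup>2 \<noteq> (0::real)" "\<forall>\<^sub>F k in at 1. 2 * (k - 1) \<noteq> (0::real)"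
    using at_1_pos by (auto elim: eventually_mono)
  show "\<forall>\<^sub>F k in at 1. ((\<lambda>k. 2 * V k) has_real_derivative 2 * f k) (at k)"
    using at_1_pos by eventually_elim (auto intro!: DERIV_cmult V_deriv)
  show "\<forall>\<^sub>F k in at 1. ((\<lambda>k. (k - 1)\<^sup>2) has_real_derivative 2 * (k - 1)) (at (k::real))"
    by (intro always_eventually allI) (auto intro!: derivative_eq_intros)
  show "((\<lambda>k. 2 * f k / (2 * (k - 1))) \<longlongrightarrow> 1) (at 1)" using f_div_tendsto by (simp only: mult_divide_mult_cancel_left_if) simp
qed

lemma V_div_f_tendsto: "((\<lambda>k. 2 * V k / (f k)\<^sup>2) \<longlongrightarrow> 1) (at 1)"
proof -
  have "((\<lambda>k. (2 * V k / (k - 1)\<^sup>2) / (f k / (k - 1))\<^sup>2) \<longlongrightarrow> 1 / 1\<^sup>2) (at 1)"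
    by (intro tendsto_intros V_div_tendsto f_div_tendsto) simp
  moreover have "\<forall>\<^sub>F k in at 1. (2 * V k / (k - 1)\<^sup>2) / (f k / (k - 1))\<^sup>2 = 2 * V k / (f k)\<^sup>2"
    using at_1_pos by eventually_elim (auto simp: power_divide)
  ultimately show ?thesis using Lim_transform_eventually by fastforce
qed

text \<open>Near 1 the potential is \<open>(k - 1)^2 / 2\<close> to leading order, so the signed
  root is differentiable at the point where the square root itself is not.\<close>

lemma g_deriv_1: "(g has_real_derivative 1) (at 1)"
proof -
  have "((\<lambda>k. sqrt (2 * V k / (k - 1)\<^sup>2)) \<longlongrightarrow> sqrt 1) (at 1)"
    by (rule tendsto_real_sqrt[OF V_div_tendsto])
  moreover have "\<forall>\<^sub>F k in at 1. sqrt (2 * V k / (k - 1)\<^sup>2) = (g k - g 1) / (k - 1)"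
    using at_1_pos by eventually_elim (auto simp: g_def V_1 real_sqrt_divide divide_simps algebra_simps)
  ultimately show ?thesis unfolding has_field_derivative_iff using Lim_transform_eventually by fastforce
qed

lemma g_deriv: "k > 0 \<Longrightarrow> (g has_real_derivative (if k = 1 then 1 else f k / g k)) (at k)"
proof -
  assume k: "k > 0"
  consider "k = 1" | "k < 1" | "k > 1" by linarith
  then show ?thesis
  proof cases
    case 1
    then show ?thesis using g_deriv_1 by simp
  next
    case 2
    have "((\<lambda>k. - sqrt (2 * V k)) has_real_derivative f k / g k) (at k)"
      using V_deriv[OF k] V_pos[OF k] 2 unfolding g_def
      by (auto intro!: derivative_eq_intros simp: divide_simps)
    moreover have "\<forall>\<^sub>F x in nhds k. g x = - sqrt (2 * V x)"
      using eventually_nhds_in_open[of "{..<1}" k] 2 by (auto simp: g_def elim: eventually_mono)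
    ultimately show ?thesis using 2 by (simp add: DERIV_cong_ev)
  next
    case 3
    have "((\<lambda>k. sqrt (2 * V k)) has_real_derivative f k / g k) (at k)"
      using V_deriv[OF k] V_pos[OF k] 3 unfolding g_def
      by (auto intro!: derivative_eq_intros simp: divide_simps)
    moreover have "\<forall>\<^sub>F x in nhds k. g x = sqrt (2 * V x)"
      using eventually_nhds_in_open[of "{1<..}" k] 3 by (auto simp: g_def elim: eventually_mono)
    ultimately show ?thesis using 3 by (simp add: DERIV_cong_ev)
  qed
qed

lemma g_deriv_pos: "k > 0 \<Longrightarrow> (if k = 1 then 1 else f k / g k) > 0"
  using f_pos[of k] f_neg[of k] g_pos[of k] g_neg[of k] by (cases k "1::real" rule: linorder_cases) (auto intro: divide_neg_neg)

lemma g_continuous: "continuous_on {0<..} g"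
  using g_deriv by (intro continuous_at_imp_continuous_on ballI DERIV_isCont) auto

lemma g_strict_mono: "0 < j \<Longrightarrow> j < k \<Longrightarrow> g j < g k"
proof (rule DERIV_pos_imp_increasing[of j k g])
  fix x assume "0 < j" "j \<le> x"
  then have "x > 0" by simp
  then show "\<exists>y. (g has_real_derivative y) (at x) \<and> 0 < y" using g_deriv[of x] g_deriv_pos[of x] by blast
qed

lemma g_inj: "inj_on g {0<..}"
  using g_strict_mono by (intro linorder_inj_onI') force

text \<open>The amplitude at which an orbit would touch \<open>k = 0\<close>: half its square is
  \<open>V 0 = 1 / (q + 1)\<close>.\<close>

definition "rmax = sqrt (2 / (q + 1))"

lemma rmax_pos: "rmax > 0" using q by (simp add: rmax_def)

lemma g_gt: "k > 0 \<Longrightarrow> g k > - rmax"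
proof (cases "k < 1")
  case True
  assume k: "k > 0"
  have "k powr (q + 1) / (q + 1) < k"
  proof -
    have "k powr (q + 1) = k powr q * k" using k by (simp add: powr_add)
    also have "\<dots> < 1 * k" using k True q powr_less_mono2[of q k 1] by (intro mult_strict_right_mono) auto
    also have "\<dots> \<le> k * (q + 1)" using k q by simp
    finally show ?thesis using q by (simp add: field_simps)
  qed
  then have "V k < (q / (q + 1)) / q" unfolding V_def using q by (intro divide_strict_right_mono) auto
  then have "2 * V k < 2 / (q + 1)" using q by simp
  then show ?thesis using True by (simp add: g_def rmax_def)
next
  case False
  assume k: "k > 0"
  then have "g k \<ge> 0" using False g_pos[of k] g_1 by (cases "k = 1") auto
  then show ?thesis using rmax_pos by linarith
qed

lemma V_continuous: "continuous_on {0..} V"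
  unfolding V_def divide_inverse using q
  by (intro continuous_intros continuous_on_powr') auto

text \<open>Intermediate values of \<open>V\<close>: on the right it outgrows \<open>s^2 / 2\<close>
  by \<open>V_ge\<close>, on the left the level lies below \<open>V 0\<close> because
  \<open>- s < rmax\<close>.\<close>

lemma g_surj: "s > - rmax \<Longrightarrow> \<exists>k>0. g k = s"
proof -
  assume s: "s > - rmax"
  consider "s = 0" | "s > 0" | "s < 0" by linarith
  then show ?thesis
  proof cases
    case 1 then show ?thesis using g_1 by (intro exI[of _ 1]) auto
  next
    case 2
    have "V (1 + s) > s\<^sup>2 / 2" using V_ge[of "1 + s"] 2 by simp
    then have "\<exists>k. 1 \<le> k \<and> k \<le> 1 + s \<and> V k = s\<^sup>2 / 2"
      using V_1 2 by (intro IVT') (auto intro: continuous_on_subset[OF V_continuous])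
    then obtain k where k: "1 \<le> k" "V k = s\<^sup>2 / 2" by blast
    then have "2 * V k = s\<^sup>2" by simp
    then show ?thesis using 2 k(1) by (intro exI[of _ k]) (auto simp: g_def)
  next
    case 3
    have "rmax\<^sup>2 = 2 / (q + 1)" using q by (simp add: rmax_def)
    moreover have "s\<^sup>2 < rmax\<^sup>2" using power_strict_mono[of "- s" rmax 2] s 3 by simp
    moreover have V0: "V 0 = 1 / (q + 1)" using q by (simp add: V_def)
    ultimately have "s\<^sup>2 / 2 < V 0" by simp
    then have "\<exists>k. 0 \<le> k \<and> k \<le> 1 \<and> V k = s\<^sup>2 / 2"
      using V_1 by (intro IVT2') (auto intro: continuous_on_subset[OF V_continuous])
    then obtain k where k: "0 \<le> k" "k \<le> 1" "V k = s\<^sup>2 / 2" by blast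
    moreover have "k \<noteq> 0" using \<open>s\<^sup>2 / 2 < V 0\<close> k by auto
    moreover have "k \<noteq> 1" using V_1 k 3 by auto
    ultimately have "k > 0" "k < 1" "2 * V k = s\<^sup>2" by auto
    moreover from this have "g k = - sqrt (s\<^sup>2)" unfolding g_def by presburger
    ultimately show ?thesis using 3 by (intro exI[of _ k]) auto
  qed
qed

section \<open>The inverse coordinate and its derivatives\<close>

definition "\<gamma> = inv_into {0<..} g"

lemma \<gamma>_g: "k > 0 \<Longrightarrow> \<gamma> (g k) = k"
  unfolding \<gamma>_def by (rule inv_into_f_f[OF g_inj]) simp

lemma \<gamma>_pos: "s > - rmax \<Longrightarrow> \<gamma> s > 0" and g_\<gamma>: "s > - rmax \<Longrightarrow> g (\<gamma> s) = s"
  using g_surj[of s] \<gamma>_g by force+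

lemma \<gamma>_0: "\<gamma> 0 = 1" using \<gamma>_g[of 1] g_1 by simp

lemma \<gamma>_eq_1_iff: "s > - rmax \<Longrightarrow> \<gamma> s = 1 \<longleftrightarrow> s = 0"
  using g_\<gamma>[of s] g_1 \<gamma>_0 by auto

lemma \<gamma>_V: "s > - rmax \<Longrightarrow> V (\<gamma> s) = s\<^sup>2 / 2"
  using g_sq[of "\<gamma> s"] \<gamma>_pos[of s] g_\<gamma>[of s] by simp

lemma f_\<gamma>_sgn: "s > - rmax \<Longrightarrow> s > 0 \<Longrightarrow> f (\<gamma> s) > 0" "s > - rmax \<Longrightarrow> s < 0 \<Longrightarrow> f (\<gamma> s) < 0"
  using \<gamma>_pos[of s] g_\<gamma>[of s] g_pos[of "\<gamma> s"] g_neg[of "\<gamma> s"] g_1 f_pos[of "\<gamma> s"] f_neg[of "\<gamma> s"]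
  by (cases "\<gamma> s" "1::real" rule: linorder_cases; force)+

text \<open>\<open>G1\<close> and \<open>G2\<close> are the first and second derivative of \<gamma>;
  the values at 0 are the limits of the quotients, which read 0/0 there.\<close>

definition "G1 s = (if s = 0 then 1 else s / f (\<gamma> s))"
definition "G2 s = (if s = 0 then - (q - 1) / 3 else N (\<gamma> s) / f (\<gamma> s) ^ 3)"

lemma G1_pos: "s > - rmax \<Longrightarrow> G1 s > 0"
  using f_\<gamma>_sgn[of s] by (auto simp: G1_def intro: divide_neg_neg) (metis divide_neg_neg divide_pos_pos linorder_neqE_linordered_idom)

lemma G1_f: "s > - rmax \<Longrightarrow> G1 s * f (\<gamma> s) = s"
  using f_\<gamma>_sgn[of s] \<gamma>_0 f_1 by (cases s "0::real" rule: linorder_cases) (auto simp: G1_def)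

lemma \<gamma>_deriv: "s > - rmax \<Longrightarrow> (\<gamma> has_real_derivative G1 s) (at s)"
proof -
  assume s: "s > - rmax"
  let ?k = "\<gamma> s"
  have k: "?k > 0" by (rule \<gamma>_pos[OF s])
  have "(\<gamma> has_real_derivative inverse (if ?k = 1 then 1 else f ?k / g ?k)) (at (g ?k))"
    by (rule has_real_derivative_local_inverse[where S = "{0<..}" and f = g, OF _ _ g_continuous _ g_deriv[OF k]])
       (use g_deriv_pos[OF k] k \<gamma>_g in auto)
  moreover have "inverse (if ?k = 1 then 1 else f ?k / g ?k) = G1 s"
    using \<gamma>_eq_1_iff[OF s] g_\<gamma>[OF s] by (auto simp: G1_def)
  ultimately show ?thesis using g_\<gamma>[OF s] by simp
qed

lemma near_0: "\<forall>\<^sub>F s in at 0. s > - rmax \<and> s \<noteq> 0"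
  unfolding eventually_at using rmax_pos by (intro exI[of _ rmax]) (auto simp: dist_real_def)

lemma filterlim_\<gamma>: "filterlim \<gamma> (at 1) (at 0)"
  unfolding filterlim_at
proof
  show "(\<gamma> \<longlongrightarrow> 1) (at 0)" using DERIV_isCont[OF \<gamma>_deriv, of 0] rmax_pos \<gamma>_0 by (simp add: isCont_def)
  show "\<forall>\<^sub>F x in at 0. \<gamma> x \<in> UNIV \<and> \<gamma> x \<noteq> 1"
    using near_0 by eventually_elim (use \<gamma>_eq_1_iff in auto)
qed

lemma G1_cont_0: "(G1 \<longlongrightarrow> 1) (at 0)"
proof -
  have "((\<lambda>s. sqrt (2 * V (\<gamma> s) / (f (\<gamma> s))\<^sup>2)) \<longlongrightarrow> sqrt 1) (at 0)"
    by (rule tendsto_real_sqrt[OF filterlim_compose[OF V_div_f_tendsto filterlim_\<gamma>]])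
  moreover have "\<forall>\<^sub>F s in at 0. sqrt (2 * V (\<gamma> s) / (f (\<gamma> s))\<^sup>2) = G1 s"
    using near_0
  proof eventually_elim
    case (elim s)
    have "2 * V (\<gamma> s) / (f (\<gamma> s))\<^sup>2 = (G1 s)\<^sup>2" using elim \<gamma>_V[of s] by (simp add: G1_def power_divide)
    then show ?case using G1_pos[of s] elim by simp
  qed
  ultimately show ?thesis using Lim_transform_eventually by fastforce
qed

text \<open>After one application of L'Hopital's rule the quotient is
  \<open>- (2 V / f^2) f'' / (3 f')\<close>, where \<open>2 V / f^2\<close> tends to 1 and
  \<open>f''\<close> to \<open>q - 1\<close>; hence the constant
  \<open>- (q - 1) / 3\<close>.\<close>

lemma G2_cont_0: "(G2 \<longlongrightarrow> - (q - 1) / 3) (at 0)"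
proof -
  have "((\<lambda>k. N k / f k ^ 3) \<longlongrightarrow> - (q - 1) / 3) (at 1)"
  proof (rule lhopital[where f' = "\<lambda>k. - 2 * V k * ((q - 1) * k powr (q - 2))" and g' = "\<lambda>k. 3 * (f k)\<^sup>2 * k powr (q - 1)"])
    show "(N \<longlongrightarrow> 0) (at 1)" by (rule tendsto_at_1)
    show "((\<lambda>k. f k ^ 3) \<longlongrightarrow> 0) (at 1)" using tendsto_power[OF tendsto_at_1(1), of 3] by simp
    show "\<forall>\<^sub>F k in at 1. f k ^ 3 \<noteq> 0" "\<forall>\<^sub>F k in at 1. 3 * (f k)\<^sup>2 * k powr (q - 1) \<noteq> 0"
      using at_1_pos by (auto elim!: eventually_mono simp: f_eq_0_iff)
    show "\<forall>\<^sub>F k in at 1. (N has_real_derivative - 2 * V k * ((q - 1) * k powr (q - 2))) (at k)"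
      using at_1_pos by eventually_elim (rule N_deriv, simp)
    show "\<forall>\<^sub>F k in at 1. ((\<lambda>k. f k ^ 3) has_real_derivative 3 * (f k)\<^sup>2 * k powr (q - 1)) (at k)"
      using at_1_pos by eventually_elim (auto intro!: derivative_eq_intros f_deriv simp: numeral_eq_Suc)
    have "((\<lambda>k. - (2 * V k / (f k)\<^sup>2) * ((q - 1) * k powr (q - 2)) / (3 * k powr (q - 1))) \<longlongrightarrow>
        - 1 * ((q - 1) * 1 powr (q - 2)) / (3 * 1 powr (q - 1))) (at 1)"
      by (intro tendsto_intros V_div_f_tendsto) auto
    moreover have "\<forall>\<^sub>F k in at 1. - (2 * V k / (f k)\<^sup>2) * ((q - 1) * k powr (q - 2)) / (3 * k powr (q - 1)) =
       - 2 * V k * ((q - 1) * k powr (q - 2)) / (3 * (f k)\<^sup>2 * k powr (q - 1))"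
      using at_1_pos by eventually_elim (auto simp: divide_simps)
    ultimately show "((\<lambda>k. - 2 * V k * ((q - 1) * k powr (q - 2)) / (3 * (f k)\<^sup>2 * k powr (q - 1))) \<longlongrightarrow> - (q - 1) / 3) (at 1)"
      using Lim_transform_eventually by fastforce
  qed
  from filterlim_compose[OF this filterlim_\<gamma>]
  have "((\<lambda>s. N (\<gamma> s) / f (\<gamma> s) ^ 3) \<longlongrightarrow> - (q - 1) / 3) (at 0)" .
  moreover have "\<forall>\<^sub>F s in at 0. N (\<gamma> s) / f (\<gamma> s) ^ 3 = G2 s"
    using near_0 by eventually_elim (auto simp: G2_def)
  ultimately show ?thesis using Lim_transform_eventually by fastforce
qed

lemma G1_deriv_off_0:
  assumes s: "s > - rmax" "s \<noteq> 0"
  shows "(G1 has_real_derivative G2 s) (at s)"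
proof -
  have k: "\<gamma> s > 0" "f (\<gamma> s) \<noteq> 0" using \<gamma>_pos[OF s(1)] f_\<gamma>_sgn[OF s(1)] s(2) by (auto, linarith)
  have fd: "((\<lambda>s. f (\<gamma> s)) has_real_derivative \<gamma> s powr (q - 1) * G1 s) (at s)"
    by (rule DERIV_chain2[OF f_deriv[OF k(1)] \<gamma>_deriv[OF s(1)]])
  have "((\<lambda>s. s / f (\<gamma> s)) has_real_derivative (1 * f (\<gamma> s) - s * (\<gamma> s powr (q - 1) * G1 s)) / (f (\<gamma> s) * f (\<gamma> s))) (at s)"
    by (rule DERIV_divide[OF DERIV_ident fd k(2)])
  moreover have "(1 * f (\<gamma> s) - s * (\<gamma> s powr (q - 1) * G1 s)) / (f (\<gamma> s) * f (\<gamma> s)) = G2 s"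
    using k s(2) \<gamma>_V[OF s(1)] by (simp add: G1_def G2_def N_def power2_eq_square power3_eq_cube field_simps)
  moreover have "\<forall>\<^sub>F x in nhds s. G1 x = x / f (\<gamma> x)"
    by (rule eventually_mono[OF eventually_nhds_in_open[of "- {0}" s]]) (use s(2) in \<open>auto simp: G1_def open_Compl\<close>)
  ultimately show ?thesis by (simp add: DERIV_cong_ev)
qed

lemma G1_deriv: "s > - rmax \<Longrightarrow> (G1 has_real_derivative G2 s) (at s)"
proof (cases "s = 0")
  case True
  have "(G1 has_real_derivative - (q - 1) / 3) (at 0)"
  proof (rule has_derivative_of_limit[OF _ _ G2_cont_0])
    show "isCont G1 0" using G1_cont_0 by (simp add: isCont_def G1_def)
    show "\<forall>\<^sub>F x in at 0. (G1 has_real_derivative G2 x) (at x)"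
      using near_0 by eventually_elim (auto intro: G1_deriv_off_0)
  qed
  then show ?thesis using True by (simp add: G2_def)
qed (use G1_deriv_off_0 in auto)

text \<open>The third derivative of \<gamma> is \<open>R / f^4\<close> times \<open>G1\<close>, both
  factors being positive.\<close>

lemma G2_deriv_off_0:
  assumes s: "s > - rmax" "s \<noteq> 0"
  shows "\<exists>y>0. (G2 has_real_derivative y) (at s)"
proof -
  have k: "\<gamma> s > 0" "f (\<gamma> s) \<noteq> 0" using \<gamma>_pos[OF s(1)] f_\<gamma>_sgn[OF s(1)] s(2) by (auto, linarith)
  have k1: "\<gamma> s \<noteq> 1" using k f_1 by auto
  let ?k = "\<gamma> s"
  have "((\<lambda>k. N k / f k ^ 3) has_real_derivative R ?k / f ?k ^ 4) (at ?k)"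
  proof -
    have "((\<lambda>k. f k ^ 3) has_real_derivative 3 * (f ?k)\<^sup>2 * ?k powr (q - 1)) (at ?k)"
      by (auto intro!: derivative_eq_intros f_deriv k simp: numeral_eq_Suc)
    from DERIV_divide[OF N_deriv[OF k(1)] this]
    show ?thesis using k(2) by (rule_tac DERIV_cong) (auto simp: R_def divide_simps power2_eq_square power3_eq_cube power4_eq_xxxx algebra_simps)
  qed
  from DERIV_chain2[OF this \<gamma>_deriv[OF s(1)]]
  have "((\<lambda>s. N (\<gamma> s) / f (\<gamma> s) ^ 3) has_real_derivative R ?k / f ?k ^ 4 * G1 s) (at s)" .
  moreover have "\<forall>\<^sub>F x in nhds s. G2 x = N (\<gamma> x) / f (\<gamma> x) ^ 3"
    by (rule eventually_mono[OF eventually_nhds_in_open[of "- {0}" s]]) (use s(2) in \<open>auto simp: G2_def open_Compl\<close>)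
  ultimately have "(G2 has_real_derivative R ?k / f ?k ^ 4 * G1 s) (at s)" by (simp add: DERIV_cong_ev)
  moreover have "R ?k / f ?k ^ 4 * G1 s > 0"
    using R_pos[OF k(1) k1] k(2) G1_pos[OF s(1)] by simp
  ultimately show ?thesis by blast
qed

lemma G2_cont: "s > - rmax \<Longrightarrow> isCont G2 s"
  using G2_deriv_off_0[of s] G2_cont_0 by (cases "s = 0") (auto simp: isCont_def G2_def[of 0] dest: DERIV_isCont)

text \<open>A derivative is available only away from 0; monotonicity on the two sides is glued at 0
  by continuity.\<close>

lemma G2_less: "- rmax < s \<Longrightarrow> s < t \<Longrightarrow> G2 s < G2 t"
proof -
  assume st: "- rmax < s" "s < t"
  have step: "G2 a < G2 b" if "- rmax < a" "a < b" "0 \<notin> {a<..<b}" for a b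
  proof (rule DERIV_pos_imp_increasing_open[OF \<open>a < b\<close>])
    show "continuous_on {a..b} G2"
      by (intro continuous_at_imp_continuous_on ballI G2_cont) (use that in auto)
    show "\<exists>y. (G2 has_real_derivative y) (at x) \<and> 0 < y" if "a < x" "x < b" for x
      using G2_deriv_off_0[of x] that \<open>- rmax < a\<close> \<open>0 \<notin> {a<..<b}\<close> by auto
  qed
  show ?thesis
  proof (cases "s < 0 \<and> 0 < t")
    case True
    then show ?thesis using step[of s 0] step[of 0 t] st rmax_pos by force
  next
    case False
    then show ?thesis using step[of s t] st by auto
  qed
qed

end

section \<open>Period, area and action\<close>

context exponent
begin

lemma amplitude_gt: "\<bar>r\<bar> < rmax \<Longrightarrow> - r * cos \<phi> > - rmax"
proof -
  assume r: "\<bar>r\<bar> < rmax"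
  have "\<bar>r * cos \<phi>\<bar> \<le> \<bar>r\<bar> * 1" unfolding abs_mult by (intro mult_left_mono) auto
  then show ?thesis using r by simp
qed

lemma continuous_on_comp_amplitude:
  assumes "\<And>s. s > - rmax \<Longrightarrow> isCont \<Psi> s" "\<bar>r\<bar> < rmax"
  shows "continuous_on S (\<lambda>\<phi>. \<Psi> (- r * cos \<phi>))"
proof (rule continuous_on_compose2[of "{- rmax<..}" \<Psi>])
  show "continuous_on {- rmax<..} \<Psi>" using assms(1) by (intro continuous_at_imp_continuous_on) simp
  show "(\<lambda>\<phi>. - r * cos \<phi>) ` S \<subseteq> {- rmax<..}" using amplitude_gt[OF assms(2)] by auto
qed (intro continuous_intros)

lemma \<gamma>_cont: "s > - rmax \<Longrightarrow> isCont \<gamma> s"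
  by (rule DERIV_isCont[OF \<gamma>_deriv])

lemma G1_cont: "s > - rmax \<Longrightarrow> isCont G1 s"
  by (rule DERIV_isCont[OF G1_deriv])

lemma cont_\<gamma>: "\<bar>r\<bar> < rmax \<Longrightarrow> continuous_on S (\<lambda>\<phi>. \<gamma> (- r * cos \<phi>))"
  and cont_G1: "\<bar>r\<bar> < rmax \<Longrightarrow> continuous_on S (\<lambda>\<phi>. G1 (- r * cos \<phi>))"
  and cont_G2: "\<bar>r\<bar> < rmax \<Longrightarrow> continuous_on S (\<lambda>\<phi>. G2 (- r * cos \<phi>))"
  by (rule continuous_on_comp_amplitude[OF \<gamma>_cont] continuous_on_comp_amplitude[OF G1_cont]
      continuous_on_comp_amplitude[OF G2_cont]; assumption)+

text \<open>The interval of integration does not depend on \<open>r\<close> and the integrand is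
  regular, so differentiation under the integral is legitimate. The weight \<open>m\<close> carries
  the sine factor of the action.\<close>

lemma angular_integral_deriv:
  assumes \<Psi>: "\<And>s. s > - rmax \<Longrightarrow> (\<Psi> has_real_derivative \<Psi>' s) (at s)" "\<And>s. s > - rmax \<Longrightarrow> isCont \<Psi>' s"
    and m: "continuous_on UNIV m" and r: "\<bar>r\<bar> < rmax"
  shows "((\<lambda>r. integral {0..2 * pi} (\<lambda>\<phi>. m \<phi> * \<Psi> (- r * cos \<phi>))) has_real_derivative
    integral {0..2 * pi} (\<lambda>\<phi>. m \<phi> * (\<Psi>' (- r * cos \<phi>) * - cos \<phi>))) (at r)"
proof -
  let ?U = "{- rmax<..<rmax}"
  have cm: "continuous_on S m" for S using m continuous_on_subset by blast
  have "((\<lambda>r. integral (cbox 0 (2 * pi)) (\<lambda>\<phi>. m \<phi> * \<Psi> (- r * cos \<phi>))) has_real_derivative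
    integral (cbox 0 (2 * pi)) (\<lambda>\<phi>. m \<phi> * (\<Psi>' (- r * cos \<phi>) * - cos \<phi>))) (at r within ?U)"
  proof (rule leibniz_rule_field_derivative)
    fix x t assume x: "x \<in> ?U"
    have "((\<lambda>r. \<Psi> (- r * cos t)) has_real_derivative \<Psi>' (- x * cos t) * - cos t) (at x)"
      by (rule DERIV_chain2[OF \<Psi>(1)]) (use x amplitude_gt[of x t] in \<open>auto intro!: derivative_eq_intros\<close>)
    then show "((\<lambda>r. m t * \<Psi> (- r * cos t)) has_real_derivative m t * (\<Psi>' (- x * cos t) * - cos t)) (at x within ?U)"
      by (intro has_field_derivative_at_within[OF DERIV_cmult])
  next
    fix x assume x: "x \<in> ?U"
    have "continuous_on (cbox 0 (2 * pi)) (\<lambda>\<phi>. \<Psi> (- x * cos \<phi>))"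
      by (rule continuous_on_comp_amplitude[OF DERIV_isCont[OF \<Psi>(1)]]) (use x in auto)
    then show "(\<lambda>\<phi>. m \<phi> * \<Psi> (- x * cos \<phi>)) integrable_on cbox 0 (2 * pi)"
      by (intro integrable_continuous continuous_on_mult cm)
  next
    have 1: "continuous_on (?U \<times> cbox 0 (2 * pi)) (\<lambda>p. \<Psi>' (- fst p * cos (snd p)))"
    proof (rule continuous_on_compose2[of "{- rmax<..}" \<Psi>'])
      show "continuous_on {- rmax<..} \<Psi>'" using \<Psi>(2) by (intro continuous_at_imp_continuous_on) simp
      show "(\<lambda>p. - fst p * cos (snd p)) ` (?U \<times> cbox 0 (2 * pi)) \<subseteq> {- rmax<..}"
      proof (rule image_subsetI)
        fix p assume "p \<in> ?U \<times> cbox 0 (2 * pi)"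
        then have "\<bar>fst p\<bar> < rmax" by auto
        then show "- fst p * cos (snd p) \<in> {- rmax<..}" using amplitude_gt by simp
      qed
    qed (intro continuous_intros)
    have 2: "continuous_on (?U \<times> cbox 0 (2 * pi)) (\<lambda>p. m (snd p))"
      by (rule continuous_on_compose2[OF m continuous_on_snd[OF continuous_on_id]]) simp
    have "continuous_on (?U \<times> cbox 0 (2 * pi)) (\<lambda>p. m (snd p) * (\<Psi>' (- fst p * cos (snd p)) * - cos (snd p)))"
      by (intro continuous_on_mult 1 2 continuous_intros)
    then show "continuous_on (?U \<times> cbox 0 (2 * pi)) (\<lambda>(x, t). m t * (\<Psi>' (- x * cos t) * - cos t))"
      by (simp add: case_prod_unfold)
  qed (use r in auto)
  moreover have "at r within ?U = at r" by (rule at_within_open) (use r in auto)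
  ultimately show ?thesis by simp
qed

definition "per r = integral {0..2 * pi} (\<lambda>\<phi>. G1 (- r * cos \<phi>))"
definition "per' r = integral {0..2 * pi} (\<lambda>\<phi>. G2 (- r * cos \<phi>) * - cos \<phi>)"
definition "area r = integral {0..2 * pi} (\<lambda>\<phi>. \<gamma> (- r * cos \<phi>) * G1 (- r * cos \<phi>))"
definition "area' r = integral {0..2 * pi} (\<lambda>\<phi>. ((G1 (- r * cos \<phi>))\<^sup>2 + \<gamma> (- r * cos \<phi>) * G2 (- r * cos \<phi>)) * - cos \<phi>)"
text \<open>The classical action: the integral over one period of the square of the derivative of
  the orbit, which is \<open>r * sin \<phi>\<close> at angle \<phi>.\<close>

definition "action r = integral {0..2 * pi} (\<lambda>\<phi>. (r * sin \<phi>)\<^sup>2 * G1 (- r * cos \<phi>))"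

lemma per_deriv: "\<bar>r\<bar> < rmax \<Longrightarrow> (per has_real_derivative per' r) (at r)"
  using angular_integral_deriv[OF G1_deriv G2_cont, of "\<lambda>_. 1" r] unfolding per_def[abs_def] per'_def by simp

lemma area_deriv: "\<bar>r\<bar> < rmax \<Longrightarrow> (area has_real_derivative area' r) (at r)"
proof -
  assume r: "\<bar>r\<bar> < rmax"
  have "((\<lambda>s. \<gamma> s * G1 s) has_real_derivative (G1 s)\<^sup>2 + \<gamma> s * G2 s) (at s)" if "s > - rmax" for s
    using DERIV_mult[OF \<gamma>_deriv[OF that] G1_deriv[OF that]] by (simp add: power2_eq_square mult_ac add_ac)
  moreover have "isCont (\<lambda>s. (G1 s)\<^sup>2 + \<gamma> s * G2 s) s" if "s > - rmax" for s
    by (intro isCont_add isCont_mult isCont_power G1_cont G2_cont \<gamma>_cont that)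
  ultimately show ?thesis
    using angular_integral_deriv[of "\<lambda>s. \<gamma> s * G1 s" "\<lambda>s. (G1 s)\<^sup>2 + \<gamma> s * G2 s" "\<lambda>_. 1" r] r
    unfolding area_def[abs_def] area'_def by simp
qed

lemma period_integral_derivative:
  fixes F F' :: "real \<Rightarrow> real"
  assumes "\<And>x. (F has_real_derivative F' x) (at x)" "F (2 * pi) = F 0"
  shows "(F' has_integral 0) {0..2 * pi}"
  using has_integral_of_derivative[of 0 "2 * pi" F F'] assms by simp

lemma deriv_amplitude:
  assumes "(\<Psi> has_real_derivative D) (at (- r * cos \<phi>))"
  shows "((\<lambda>\<phi>. \<Psi> (- r * cos \<phi>)) has_real_derivative D * (r * sin \<phi>)) (at \<phi>)"
  by (rule DERIV_chain2[where g = "\<lambda>\<phi>. - r * cos \<phi>", OF assms]) (auto intro!: derivative_eq_intros)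

text \<open>The classical relation that the derivative of the action with respect to the energy is
  the period, with energy \<open>r^2 / 2\<close>.\<close>

lemma action_deriv: "\<bar>r\<bar> < rmax \<Longrightarrow> (action has_real_derivative r * per r) (at r)"
proof -
  assume r: "\<bar>r\<bar> < rmax"
  let ?S = "\<lambda>r. integral {0..2 * pi} (\<lambda>\<phi>. (sin \<phi>)\<^sup>2 * G1 (- r * cos \<phi>))"
  let ?S' = "integral {0..2 * pi} (\<lambda>\<phi>. (sin \<phi>)\<^sup>2 * (G2 (- r * cos \<phi>) * - cos \<phi>))"
  have act: "action = (\<lambda>r. r\<^sup>2 * ?S r)"
    unfolding action_def by (simp add: power_mult_distrib mult.assoc fun_eq_iff)
  have "(?S has_real_derivative ?S') (at r)"
    by (rule angular_integral_deriv[OF G1_deriv G2_cont _ r]) (auto intro!: continuous_intros)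
  then have d: "(action has_real_derivative 2 * r * ?S r + ?S' * r\<^sup>2) (at r)"
    unfolding act by (auto intro!: derivative_eq_intros)
  \<comment> \<open>This exact derivative is the integrand of the differentiated action minus
    \<open>r * G1\<close>; its vanishing mean eliminates \<open>G2\<close>.\<close>
  have "((\<lambda>\<phi>. - r * sin \<phi> * cos \<phi> * G1 (- r * cos \<phi>)) has_real_derivative
     2 * r * ((sin \<phi>)\<^sup>2 * G1 (- r * cos \<phi>)) + r\<^sup>2 * ((sin \<phi>)\<^sup>2 * (G2 (- r * cos \<phi>) * - cos \<phi>)) - r * G1 (- r * cos \<phi>)) (at \<phi>)" for \<phi>
  proof -
    have "((\<lambda>\<phi>. - r * sin \<phi> * cos \<phi>) has_real_derivative - r * ((cos \<phi>)\<^sup>2 - (sin \<phi>)\<^sup>2)) (at \<phi>)"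
      by (auto intro!: derivative_eq_intros simp: power2_eq_square algebra_simps)
    from DERIV_mult[OF this deriv_amplitude[OF G1_deriv[OF amplitude_gt[OF r]]]]
    have "((\<lambda>\<phi>. - r * sin \<phi> * cos \<phi> * G1 (- r * cos \<phi>)) has_real_derivative
      - r * ((cos \<phi>)\<^sup>2 - (sin \<phi>)\<^sup>2) * G1 (- r * cos \<phi>) + G2 (- r * cos \<phi>) * (r * sin \<phi>) * (- r * sin \<phi> * cos \<phi>)) (at \<phi>)" .
    moreover have "- r * ((cos \<phi>)\<^sup>2 - (sin \<phi>)\<^sup>2) * G1 (- r * cos \<phi>) + G2 (- r * cos \<phi>) * (r * sin \<phi>) * (- r * sin \<phi> * cos \<phi>) =
        2 * r * ((sin \<phi>)\<^sup>2 * G1 (- r * cos \<phi>)) + r\<^sup>2 * ((sin \<phi>)\<^sup>2 * (G2 (- r * cos \<phi>) * - cos \<phi>)) - r * G1 (- r * cos \<phi>)"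
      unfolding cos_squared_eq by (simp add: power2_eq_square algebra_simps)
    ultimately show ?thesis by simp
  qed
  from period_integral_derivative[OF this]
  have 0: "((\<lambda>\<phi>. 2 * r * ((sin \<phi>)\<^sup>2 * G1 (- r * cos \<phi>)) + r\<^sup>2 * ((sin \<phi>)\<^sup>2 * (G2 (- r * cos \<phi>) * - cos \<phi>)) - r * G1 (- r * cos \<phi>)) has_integral 0) {0..2 * pi}"
    by simp
  have "((\<lambda>\<phi>. 2 * r * ((sin \<phi>)\<^sup>2 * G1 (- r * cos \<phi>)) + r\<^sup>2 * ((sin \<phi>)\<^sup>2 * (G2 (- r * cos \<phi>) * - cos \<phi>)) - r * G1 (- r * cos \<phi>)) has_integral
     2 * r * ?S r + r\<^sup>2 * ?S' - r * per r) {0..2 * pi}"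
    unfolding per_def
    by (intro has_integral_add has_integral_diff has_integral_mult_right integrable_integral integrable_continuous_real
        continuous_intros cont_G1 cont_G2 r)
  from has_integral_unique[OF this 0] d show ?thesis by (simp add: mult.commute)
qed

lemma has_integral_per: "\<bar>r\<bar> < rmax \<Longrightarrow> ((\<lambda>\<phi>. G1 (- r * cos \<phi>)) has_integral per r) {0..2 * pi}"
  unfolding per_def by (intro integrable_integral integrable_continuous_real cont_G1)

lemma has_integral_area: "\<bar>r\<bar> < rmax \<Longrightarrow> ((\<lambda>\<phi>. \<gamma> (- r * cos \<phi>) * G1 (- r * cos \<phi>)) has_integral area r) {0..2 * pi}"
  unfolding area_def by (intro integrable_integral integrable_continuous_real continuous_intros cont_\<gamma> cont_G1)

lemma has_integral_action: "\<bar>r\<bar> < rmax \<Longrightarrow> ((\<lambda>\<phi>. (r * sin \<phi>)\<^sup>2 * G1 (- r * cos \<phi>)) has_integral action r) {0..2 * pi}"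
  unfolding action_def by (intro integrable_integral integrable_continuous_real continuous_intros cont_G1)

lemma strict_integral_pos:
  fixes F :: "real \<Rightarrow> real"
  assumes "(F has_integral I) {0..2 * pi}" "continuous_on {0..2 * pi} F"
    "\<And>\<phi>. \<phi> \<in> {0..2 * pi} \<Longrightarrow> 0 \<le> F \<phi>" "F 0 > 0"
  shows "I > 0"
proof -
  have "I \<ge> 0" using has_integral_nonneg[OF assms(1,3)] by auto
  moreover have "I \<noteq> 0"
  proof
    assume "I = 0"
    then have "F 0 = 0" by (intro has_integral_0_cbox_imp_0[of 0 "2 * pi" F]) (use assms pi_gt_zero in \<open>auto simp del: pi_gt_zero\<close>)
    then show False using assms(4) by simp
  qed
  ultimately show ?thesis by simp
qed

lemma per_pos: "\<bar>r\<bar> < rmax \<Longrightarrow> per r > 0"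
  by (rule strict_integral_pos[OF has_integral_per cont_G1]) (auto intro!: less_imp_le G1_pos dest: amplitude_gt)

lemma area_pos: "\<bar>r\<bar> < rmax \<Longrightarrow> area r > 0"
  by (rule strict_integral_pos[OF has_integral_area continuous_on_mult[OF cont_\<gamma> cont_G1]])
     (auto intro!: less_imp_le mult_pos_pos G1_pos \<gamma>_pos dest: amplitude_gt)

text \<open>As the cosine has mean zero, \<open>G2\<close> may be replaced by its difference to
  \<open>G2 0\<close>. Since \<open>G2\<close> increases, this difference has the sign of
  \<open>- cos \<phi>\<close>.\<close>

lemma per'_pos:
  assumes r: "0 < r" "r < rmax"
  shows "per' r > 0"
proof -
  have r': "\<bar>r\<bar> < rmax" using r by simp
  have "((\<lambda>\<phi>. - cos \<phi>) has_integral 0) {0..2 * pi}"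
    by (rule period_integral_derivative[of "\<lambda>\<phi>. - sin \<phi>"]) (auto intro!: derivative_eq_intros)
  then have hi: "((\<lambda>\<phi>. G2 (- r * cos \<phi>) * - cos \<phi> - G2 0 * - cos \<phi>) has_integral per' r - G2 0 * 0) {0..2 * pi}"
    unfolding per'_def
    by (intro has_integral_diff has_integral_mult_right integrable_integral integrable_continuous_real continuous_intros cont_G2 r')
  have sgn: "G2 (- r * cos \<phi>) * - cos \<phi> - G2 0 * - cos \<phi> > 0" if "cos \<phi> \<noteq> 0" for \<phi>
  proof (cases "cos \<phi> > 0")
    case True
    then have "G2 (- r * cos \<phi>) < G2 0" using r amplitude_gt[OF r', of \<phi>] by (intro G2_less) auto
    then show ?thesis using True by simp
  next
    case False
    then have "cos \<phi> < 0" using that by simp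
    then have "G2 0 < G2 (- r * cos \<phi>)" using r rmax_pos by (intro G2_less) (auto simp: mult_pos_neg)
    then show ?thesis using \<open>cos \<phi> < 0\<close> by simp
  qed
  have "per' r - G2 0 * 0 > 0"
  proof (rule strict_integral_pos[OF hi])
    show "0 \<le> G2 (- r * cos \<phi>) * - cos \<phi> - G2 0 * - cos \<phi>" for \<phi>
      using sgn[of \<phi>] by (cases "cos \<phi> = 0") auto
    show "0 < G2 (- r * cos 0) * - cos 0 - G2 0 * - cos 0" by (rule sgn) simp
  qed (intro continuous_intros cont_G2 r')
  then show ?thesis by simp
qed

text \<open>The force has mean zero along an orbit and exceeds \<open>k - 1\<close> off the
  equilibrium, so \<open>k - 1\<close> has negative mean. This places the mean of a steady state
  below its height factor.\<close>

lemma area_less_per: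
  assumes r: "0 < r" "r < rmax"
  shows "area r < per r"
proof -
  have r': "\<bar>r\<bar> < rmax" using r by simp
  have 0: "((\<lambda>\<phi>. - r * cos \<phi>) has_integral 0) {0..2 * pi}"
    by (rule period_integral_derivative[of "\<lambda>\<phi>. - r * sin \<phi>"]) (auto intro!: derivative_eq_intros)
  then have hi: "((\<lambda>\<phi>. - r * cos \<phi> - (\<gamma> (- r * cos \<phi>) * G1 (- r * cos \<phi>) - G1 (- r * cos \<phi>))) has_integral 0 - (area r - per r)) {0..2 * pi}"
    by (intro has_integral_diff has_integral_area has_integral_per r')
  have eq: "- r * cos \<phi> - (\<gamma> (- r * cos \<phi>) * G1 (- r * cos \<phi>) - G1 (- r * cos \<phi>)) =
     G1 (- r * cos \<phi>) * (f (\<gamma> (- r * cos \<phi>)) - (\<gamma> (- r * cos \<phi>) - 1))" for \<phi>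
    using G1_f[OF amplitude_gt[OF r', of \<phi>]] by (simp add: algebra_simps)
  have pos: "G1 (- r * cos \<phi>) * (f (\<gamma> (- r * cos \<phi>)) - (\<gamma> (- r * cos \<phi>) - 1)) > 0" if "cos \<phi> \<noteq> 0" for \<phi>
  proof -
    have "\<gamma> (- r * cos \<phi>) \<noteq> 1" using \<gamma>_eq_1_iff[OF amplitude_gt[OF r', of \<phi>]] that r by simp
    then show ?thesis
      using f_gt[OF \<gamma>_pos[OF amplitude_gt[OF r', of \<phi>]]] G1_pos[OF amplitude_gt[OF r', of \<phi>]] by simp
  qed
  have "0 - (area r - per r) > 0"
  proof (rule strict_integral_pos[OF hi])
    show "0 \<le> - r * cos \<phi> - (\<gamma> (- r * cos \<phi>) * G1 (- r * cos \<phi>) - G1 (- r * cos \<phi>))" for \<phi>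
    proof (cases "cos \<phi> = 0")
      case True
      then show ?thesis using \<gamma>_0 by simp
    next
      case False
      then show ?thesis unfolding eq using pos by (simp add: less_imp_le)
    qed
    show "0 < - r * cos 0 - (\<gamma> (- r * cos 0) * G1 (- r * cos 0) - G1 (- r * cos 0))"
      unfolding eq by (rule pos) simp
  qed (intro continuous_intros cont_\<gamma> cont_G1 r')
  then show ?thesis by simp
qed

text \<open>Integrates the derivative of \<open>k k'\<close>, which is the square of
  \<open>k'\<close> minus \<open>k f(k)\<close>, over one period in the angular variable.\<close>

lemma has_integral_power:
  assumes r: "\<bar>r\<bar> < rmax"
  shows "((\<lambda>\<phi>. \<gamma> (- r * cos \<phi>) powr (q + 1) * G1 (- r * cos \<phi>)) has_integral q * action r + area r) {0..2 * pi}"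
proof -
  have "((\<lambda>\<phi>. \<gamma> (- r * cos \<phi>) * (r * sin \<phi>)) has_real_derivative
     (r * sin \<phi>)\<^sup>2 * G1 (- r * cos \<phi>) - (\<gamma> (- r * cos \<phi>) powr (q + 1) * G1 (- r * cos \<phi>) - \<gamma> (- r * cos \<phi>) * G1 (- r * cos \<phi>)) / q) (at \<phi>)" for \<phi>
  proof -
    let ?s = "- r * cos \<phi>"
    have s: "?s > - rmax" by (rule amplitude_gt[OF r])
    have "((\<lambda>\<phi>. r * sin \<phi>) has_real_derivative - ?s) (at \<phi>)"
      by (auto intro!: derivative_eq_intros)
    from DERIV_mult[OF deriv_amplitude[OF \<gamma>_deriv[OF s]] this]
    have "((\<lambda>\<phi>. \<gamma> (- r * cos \<phi>) * (r * sin \<phi>)) has_real_derivative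
        G1 ?s * (r * sin \<phi>) * (r * sin \<phi>) + - ?s * \<gamma> ?s) (at \<phi>)" .
    moreover have "?s * \<gamma> ?s = (\<gamma> ?s powr (q + 1) * G1 ?s - \<gamma> ?s * G1 ?s) / q"
    proof -
      have "?s * \<gamma> ?s = G1 ?s * f (\<gamma> ?s) * \<gamma> ?s" using G1_f[OF s] by simp
      also have "\<dots> = (\<gamma> ?s powr q * \<gamma> ?s * G1 ?s - \<gamma> ?s * G1 ?s) / q" using q by (simp add: f_def field_simps)
      also have "\<gamma> ?s powr q * \<gamma> ?s = \<gamma> ?s powr (q + 1)" using \<gamma>_pos[OF s] by (simp add: powr_add)
      finally show ?thesis .
    qed
    moreover have "(r * sin \<phi>)\<^sup>2 * G1 ?s = G1 ?s * (r * sin \<phi>) * (r * sin \<phi>)" by (simp add: power2_eq_square)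
    moreover have "- ?s * \<gamma> ?s = - (?s * \<gamma> ?s)" by simp
    ultimately show ?thesis by (simp only: diff_conv_add_uminus)
  qed
  from period_integral_derivative[OF this]
  have "((\<lambda>\<phi>. (r * sin \<phi>)\<^sup>2 * G1 (- r * cos \<phi>) - (\<gamma> (- r * cos \<phi>) powr (q + 1) * G1 (- r * cos \<phi>) - \<gamma> (- r * cos \<phi>) * G1 (- r * cos \<phi>)) / q) has_integral 0) {0..2 * pi}"
    by simp
  from has_integral_add[OF has_integral_mult_right[OF has_integral_diff[OF has_integral_action[OF r] this], of q] has_integral_area[OF r]]
  show ?thesis using q by simp
qed

text \<open>Conservation of energy integrated over a period, with the integral of
  \<open>k powr (q + 1)\<close> eliminated by the previous identity.\<close>

lemma virial_identity:
  assumes r: "\<bar>r\<bar> < rmax"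
  shows "area r = (q + 3) / 2 * action r - (q + 1) * ((r\<^sup>2 / 2 - 1 / (q + 1)) * per r)"
proof -
  have hi: "((\<lambda>\<phi>. (1 / 2) * ((r * sin \<phi>)\<^sup>2 * G1 (- r * cos \<phi>)) + 1 / (q * (q + 1)) * (\<gamma> (- r * cos \<phi>) powr (q + 1) * G1 (- r * cos \<phi>))
     - 1 / q * (\<gamma> (- r * cos \<phi>) * G1 (- r * cos \<phi>)) + 1 / (q + 1) * G1 (- r * cos \<phi>)) has_integral
     (1 / 2) * action r + 1 / (q * (q + 1)) * (q * action r + area r) - 1 / q * area r + 1 / (q + 1) * per r) {0..2 * pi}"
    by (intro has_integral_add has_integral_diff has_integral_mult_right has_integral_action has_integral_power has_integral_area has_integral_per r)
  have eq: "(1 / 2) * ((r * sin \<phi>)\<^sup>2 * G1 (- r * cos \<phi>)) + 1 / (q * (q + 1)) * (\<gamma> (- r * cos \<phi>) powr (q + 1) * G1 (- r * cos \<phi>))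
     - 1 / q * (\<gamma> (- r * cos \<phi>) * G1 (- r * cos \<phi>)) + 1 / (q + 1) * G1 (- r * cos \<phi>) = r\<^sup>2 / 2 * G1 (- r * cos \<phi>)" for \<phi>
  proof -
    have "V (\<gamma> (- r * cos \<phi>)) = 1 / (q * (q + 1)) * \<gamma> (- r * cos \<phi>) powr (q + 1) - 1 / q * \<gamma> (- r * cos \<phi>) + 1 / (q + 1)"
      using q by (simp add: V_def divide_simps)
    moreover have "V (\<gamma> (- r * cos \<phi>)) = r\<^sup>2 / 2 * (1 - (sin \<phi>)\<^sup>2)"
      using \<gamma>_V[OF amplitude_gt[OF r, of \<phi>]] by (simp add: power_mult_distrib cos_squared_eq)
    ultimately have "(1 / 2) * (r * sin \<phi>)\<^sup>2 + (1 / (q * (q + 1)) * \<gamma> (- r * cos \<phi>) powr (q + 1) - 1 / q * \<gamma> (- r * cos \<phi>) + 1 / (q + 1)) = r\<^sup>2 / 2"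
      by (simp add: power_mult_distrib algebra_simps)
    then have "((1 / 2) * (r * sin \<phi>)\<^sup>2 + (1 / (q * (q + 1)) * \<gamma> (- r * cos \<phi>) powr (q + 1) - 1 / q * \<gamma> (- r * cos \<phi>) + 1 / (q + 1))) * G1 (- r * cos \<phi>) = r\<^sup>2 / 2 * G1 (- r * cos \<phi>)"
      by simp
    then show ?thesis by (simp only: distrib_right left_diff_distrib mult.assoc)
  qed
  have "(1 / 2) * action r + 1 / (q * (q + 1)) * (q * action r + area r) - 1 / q * area r + 1 / (q + 1) * per r = r\<^sup>2 / 2 * per r"
    by (rule has_integral_unique[OF hi[unfolded eq] has_integral_mult_right[OF has_integral_per[OF r]]])
  moreover have "1 / (q * (q + 1)) * (q * J + A) - 1 / q * A = (J - A) / (q + 1)" for J A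
    using q by (simp add: divide_simps) (simp add: algebra_simps)
  note this[of "action r" "area r"]
  ultimately have "(1 / 2) * action r + (action r - area r) / (q + 1) + 1 / (q + 1) * per r = r\<^sup>2 / 2 * per r" by linarith
  then have e1: "(q + 1) * ((1 / 2) * action r + (action r - area r) / (q + 1) + 1 / (q + 1) * per r) = (q + 1) * (r\<^sup>2 / 2 * per r)" by simp
  have e2: "(q + 1) * ((1 / 2) * action r + (action r - area r) / (q + 1) + 1 / (q + 1) * per r) = (q + 3) / 2 * action r - area r + per r"
    using q by (simp add: distrib_left) (simp add: field_simps)
  have e3: "(q + 1) * ((r\<^sup>2 / 2 - 1 / (q + 1)) * per r) = (q + 1) * (r\<^sup>2 / 2 * per r) - per r"
    using q by (simp add: field_simps)
  show ?thesis unfolding e3 e1[unfolded e2, symmetric] by simp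
qed

text \<open>The virial identity differentiated in \<open>r\<close>; the derivative of the action is
  again a multiple of the period, so no new integrals appear.\<close>

lemma area'_eq:
  assumes r: "\<bar>r\<bar> < rmax"
  shows "area' r = - (q - 1) / 2 * r * per r - (q + 1) * ((r\<^sup>2 / 2 - 1 / (q + 1)) * per' r)"
proof -
  have d: "((\<lambda>r. (q + 3) / 2 * action r - (q + 1) * ((r\<^sup>2 / 2 - 1 / (q + 1)) * per r)) has_real_derivative
     (q + 3) / 2 * (r * per r) - (q + 1) * (r * per r + (r\<^sup>2 / 2 - 1 / (q + 1)) * per' r)) (at r)"
  proof (intro DERIV_diff DERIV_cmult action_deriv[OF r])
    have "((\<lambda>r. r\<^sup>2 / 2 - 1 / (q + 1)) has_real_derivative r) (at r)"
      by (auto intro!: derivative_eq_intros)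
    from DERIV_mult[OF this per_deriv[OF r]]
    show "((\<lambda>r. (r\<^sup>2 / 2 - 1 / (q + 1)) * per r) has_real_derivative r * per r + (r\<^sup>2 / 2 - 1 / (q + 1)) * per' r) (at r)"
      by (simp add: mult.commute)
  qed
  have "\<forall>\<^sub>F x in nhds r. x \<in> {- rmax<..<rmax}" by (rule eventually_nhds_in_open) (use r in auto)
  then have "\<forall>\<^sub>F x in nhds r. (q + 3) / 2 * action x - (q + 1) * ((x\<^sup>2 / 2 - 1 / (q + 1)) * per x) = area x"
    by eventually_elim (use virial_identity in auto)
  then have "(area has_real_derivative
     (q + 3) / 2 * (r * per r) - (q + 1) * (r * per r + (r\<^sup>2 / 2 - 1 / (q + 1)) * per' r)) (at r)"
    using d DERIV_cong_ev[OF refl] by fast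
  from DERIV_unique[OF area_deriv[OF r] this] show ?thesis by (simp add: field_simps)
qed

end

section \<open>Orbits and their linearisation\<close>

lemma periodic_shift_of_derivative:
  fixes F F' :: "real \<Rightarrow> real"
  assumes "\<And>x. (F has_real_derivative F' x) (at x)" "\<And>x. F' (x + p) = F' x" "F 0 = 0"
  shows "F (x + p) = F x + F p"
proof -
  have "((\<lambda>x. F (x + p) - F x) has_real_derivative 0) (at x)" for x
  proof -
    have "((\<lambda>x. F (x + p)) has_real_derivative F' (x + p)) (at x)" using DERIV_shift[of F "F' (x + p)" x p] assms(1) by simp
    from DERIV_diff[OF this assms(1)[of x]] show ?thesis using assms(2) by simp
  qed
  then have "F (x + p) - F x = F (0 + p) - F 0" by (intro DERIV_isconst_all) simp
  then show ?thesis using assms(3) by simp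
qed

lemma odd_of_even_derivative:
  fixes F F' :: "real \<Rightarrow> real"
  assumes "\<And>x. (F has_real_derivative F' x) (at x)" "\<And>x. F' (- x) = F' x" "F 0 = 0"
  shows "F (- x) = - F x"
proof -
  have "((\<lambda>x. F (- x) + F x) has_real_derivative 0) (at x)" for x
  proof -
    have "((\<lambda>x. F (- x)) has_real_derivative F' (- x) * - 1) (at x)"
      by (rule DERIV_chain2[OF assms(1)]) (auto intro!: derivative_eq_intros)
    from DERIV_add[OF this assms(1)[of x]] show ?thesis using assms(2) by simp
  qed
  then have "F (- x) + F x = F (- 0) + F 0" by (intro DERIV_isconst_all) simp
  then show ?thesis using assms(3) by simp
qed

locale orbit = exponent +
  fixes r :: real
  assumes r: "0 < r" "r < rmax"
begin

lemma r_abs: "\<bar>r\<bar> < rmax" using r by simp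

abbreviation "amp \<phi> \<equiv> - r * cos \<phi>"

lemma amp_gt: "amp \<phi> > - rmax" by (rule amplitude_gt[OF r_abs])

text \<open>\<open>time\<close> is the position on the line reached at angle \<phi>, and
  \<open>T\<close> is its derivative in the amplitude at fixed angle; both are normalised to vanish
  at 0.\<close>

definition "time = (SOME F. F 0 = 0 \<and> (\<forall>\<phi>. (F has_real_derivative G1 (amp \<phi>)) (at \<phi>)))"
definition "T = (SOME F. F 0 = 0 \<and> (\<forall>\<phi>. (F has_real_derivative G2 (amp \<phi>) * - cos \<phi>) (at \<phi>)))"

lemma \<gamma>_amp_deriv: "((\<lambda>\<phi>. \<gamma> (amp \<phi>)) has_real_derivative G1 (amp \<phi>) * (r * sin \<phi>)) (at \<phi>)"
  and G1_amp_deriv: "((\<lambda>\<phi>. G1 (amp \<phi>)) has_real_derivative G2 (amp \<phi>) * (r * sin \<phi>)) (at \<phi>)"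
  by (rule deriv_amplitude[OF \<gamma>_deriv[OF amp_gt]], rule deriv_amplitude[OF G1_deriv[OF amp_gt]])

lemma r_sin_deriv: "((\<lambda>\<phi>. r * sin \<phi>) has_real_derivative r * cos \<phi>) (at \<phi>)"
  by (rule DERIV_cmult[OF DERIV_sin])

lemma time_0: "time 0 = 0" and time_deriv: "(time has_real_derivative G1 (amp \<phi>)) (at \<phi>)"
proof -
  obtain F where "F 0 = 0" "\<And>\<phi>. (F has_real_derivative G1 (amp \<phi>)) (at \<phi>)"
    by (rule antiderivative_exists[OF cont_G1[OF r_abs]]) (rule that)
  then have "time 0 = 0 \<and> (\<forall>\<phi>. (time has_real_derivative G1 (amp \<phi>)) (at \<phi>))"
    unfolding time_def by (intro someI[of "\<lambda>F. F 0 = 0 \<and> (\<forall>\<phi>. (F has_real_derivative G1 (amp \<phi>)) (at \<phi>))"]) auto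
  then show "time 0 = 0" "(time has_real_derivative G1 (amp \<phi>)) (at \<phi>)" by auto
qed

lemma T_0: "T 0 = 0" and T_deriv: "(T has_real_derivative G2 (amp \<phi>) * - cos \<phi>) (at \<phi>)"
proof -
  have c: "continuous_on UNIV (\<lambda>\<phi>. G2 (amp \<phi>) * - cos \<phi>)" by (intro continuous_intros cont_G2[OF r_abs])
  obtain F where "F 0 = 0" "\<And>\<phi>. (F has_real_derivative G2 (amp \<phi>) * - cos \<phi>) (at \<phi>)"
    by (rule antiderivative_exists[OF c]) (rule that)
  then have "T 0 = 0 \<and> (\<forall>\<phi>. (T has_real_derivative G2 (amp \<phi>) * - cos \<phi>) (at \<phi>))"
    unfolding T_def by (intro someI[of "\<lambda>F. F 0 = 0 \<and> (\<forall>\<phi>. (F has_real_derivative G2 (amp \<phi>) * - cos \<phi>) (at \<phi>))"]) auto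
  then show "T 0 = 0" "(T has_real_derivative G2 (amp \<phi>) * - cos \<phi>) (at \<phi>)" by auto
qed

lemma time_odd: "time (- \<phi>) = - time \<phi>"
  by (rule odd_of_even_derivative[OF time_deriv _ time_0]) simp

lemma T_odd: "T (- \<phi>) = - T \<phi>"
  by (rule odd_of_even_derivative[OF T_deriv _ T_0]) simp

lemma time_2pi: "time (2 * pi) = per r"
  using has_integral_unique[OF has_integral_of_derivative[OF _ time_deriv, of 0 "2 * pi"] has_integral_per[OF r_abs]] time_0 by simp

lemma T_2pi: "T (2 * pi) = per' r"
proof -
  have "((\<lambda>\<phi>. G2 (amp \<phi>) * - cos \<phi>) has_integral per' r) {0..2 * pi}"
    unfolding per'_def by (intro integrable_integral integrable_continuous_real continuous_intros cont_G2 r_abs)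
  from has_integral_unique[OF has_integral_of_derivative[OF _ T_deriv, of 0 "2 * pi"] this] show ?thesis using T_0 by simp
qed

lemma time_shift: "time (\<phi> + 2 * pi) = time \<phi> + per r"
  using periodic_shift_of_derivative[OF time_deriv _ time_0, of "2 * pi" \<phi>] time_2pi by simp

lemma T_shift: "T (\<phi> + 2 * pi) = T \<phi> + per' r"
  using periodic_shift_of_derivative[OF T_deriv _ T_0, of "2 * pi" \<phi>] T_2pi by simp

text \<open>Oddness together with the shift rule for a full turn.\<close>

lemma T_pi: "T pi = per' r / 2"
  using T_shift[of "- pi"] T_odd[of pi] by simp

lemma time_strict: "\<phi> < \<psi> \<Longrightarrow> time \<phi> < time \<psi>"
proof (rule DERIV_pos_imp_increasing[of \<phi> \<psi> time])
  show "\<exists>y. (time has_real_derivative y) (at x) \<and> 0 < y" for x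
    using time_deriv[of x] G1_pos[OF amp_gt, of x] by blast
qed

lemma time_shift_nat: "time (2 * pi * real n) = real n * per r"
proof (induction n)
  case (Suc n)
  then show ?case using time_shift[of "2 * pi * real n"] by (simp add: algebra_simps)
qed (simp add: time_0)

lemma time_surj: "\<exists>\<phi>. time \<phi> = x"
proof -
  obtain n where n: "\<bar>x\<bar> < real n * per r" using ex_less_of_nat_mult[OF per_pos[OF r_abs]] by blast
  have "time (- (2 * pi * real n)) \<le> x" "x \<le> time (2 * pi * real n)"
    unfolding time_odd time_shift_nat using n by auto
  moreover have "continuous_on {- (2 * pi * real n)..2 * pi * real n} time"
    using DERIV_isCont[OF time_deriv] by (intro continuous_at_imp_continuous_on) simp
  ultimately show ?thesis using IVT'[of time "- (2 * pi * real n)" x "2 * pi * real n"] by auto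
qed

definition "\<theta> = inv time"

lemma time_inj: "inj time"
  by (intro linorder_injI) (metis time_strict less_irrefl)

lemma \<theta>_time: "\<theta> (time \<phi>) = \<phi>" unfolding \<theta>_def by (rule inv_f_f[OF time_inj])

lemma time_\<theta>: "time (\<theta> x) = x"
  unfolding \<theta>_def by (rule surj_f_inv_f) (use time_surj in \<open>metis surjI surj_def\<close>)

lemma \<theta>_0: "\<theta> 0 = 0" using \<theta>_time[of 0] time_0 by simp

lemma \<theta>_shift: "\<theta> (x + per r) = \<theta> x + 2 * pi"
  using \<theta>_time[of "\<theta> x + 2 * pi"] time_shift[of "\<theta> x"] time_\<theta>[of x] by simp

lemma \<theta>_per: "\<theta> (per r) = 2 * pi" using \<theta>_shift[of 0] \<theta>_0 by simp

lemma \<theta>_deriv: "(\<theta> has_real_derivative 1 / G1 (amp (\<theta> x))) (at x)"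
proof -
  have "(\<theta> has_real_derivative inverse (G1 (amp (\<theta> x)))) (at (time (\<theta> x)))"
    by (rule has_real_derivative_local_inverse[of UNIV])
       (use \<theta>_time time_deriv DERIV_isCont[OF time_deriv] G1_pos[OF amp_gt, of "\<theta> x"] in
         \<open>auto intro: continuous_at_imp_continuous_on\<close>)
  then show ?thesis by (simp add: time_\<theta> inverse_eq_divide)
qed

lemma \<theta>_mono: "x \<le> y \<Longrightarrow> \<theta> x \<le> \<theta> y"
  using time_strict[of "\<theta> y" "\<theta> x"] time_\<theta> by (metis linorder_not_le)

text \<open>Along the orbit d/dx is d/d\<phi> divided by \<open>G1\<close>, so a derivative in the
  position is found by splitting off a factor \<open>G1\<close> in the angle.\<close>

lemma orbit_derivative:
  assumes "(F has_real_derivative D * G1 (amp (\<theta> x))) (at (\<theta> x))"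
  shows "((\<lambda>x. F (\<theta> x)) has_real_derivative D) (at x)"
  using DERIV_chain2[OF assms \<theta>_deriv] G1_pos[OF amp_gt, of "\<theta> x"] by simp

lemma orbit_integral:
  assumes "continuous_on UNIV m" "((\<lambda>\<phi>. m \<phi> * G1 (amp \<phi>)) has_integral I) {0..2 * pi}"
  shows "((\<lambda>x. m (\<theta> x)) has_integral I) {0..per r}"
proof -
  obtain F where F: "F 0 = 0" "\<And>\<phi>. (F has_real_derivative m \<phi> * G1 (amp \<phi>)) (at \<phi>)"
    by (rule antiderivative_exists[OF continuous_on_mult[OF assms(1) cont_G1[OF r_abs]]]) (rule that)
  have "((\<lambda>x. m (\<theta> x)) has_integral F (\<theta> (per r)) - F (\<theta> 0)) {0..per r}"
    by (rule has_integral_of_derivative[OF less_imp_le[OF per_pos[OF r_abs]] orbit_derivative[OF F(2)]])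
  moreover have "F (2 * pi) - F 0 = I"
    by (rule has_integral_unique[OF has_integral_of_derivative[OF _ F(2)] assms(2)]) simp
  ultimately show ?thesis by (simp add: \<theta>_per \<theta>_0)
qed

definition "k x = \<gamma> (amp (\<theta> x))"
definition "kd x = r * sin (\<theta> x)"

lemma k_pos: "k x > 0" unfolding k_def by (rule \<gamma>_pos[OF amp_gt])

lemma k_0: "k 0 = \<gamma> (- r)" and kd_0: "kd 0 = 0" by (simp_all add: k_def kd_def \<theta>_0)

lemma k_periodic: "periodic (per r) k" and kd_periodic: "periodic (per r) kd"
  by (simp_all add: periodic_def k_def kd_def \<theta>_shift)

lemma k_deriv: "(k has_real_derivative kd x) (at x)"
  unfolding k_def[abs_def]
  by (rule orbit_derivative) (use \<gamma>_amp_deriv in \<open>simp add: kd_def mult.commute\<close>)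

lemma kd_deriv: "(kd has_real_derivative - f (k x)) (at x)"
  unfolding kd_def[abs_def]
proof (rule orbit_derivative[where F = "\<lambda>\<phi>. r * sin \<phi>"])
  have "r * cos (\<theta> x) = - f (k x) * G1 (amp (\<theta> x))" using G1_f[OF amp_gt, of "\<theta> x"] by (simp add: k_def mult.commute)
  then show "((\<lambda>\<phi>. r * sin \<phi>) has_real_derivative - f (k x) * G1 (amp (\<theta> x))) (at (\<theta> x))"
    by (auto intro!: derivative_eq_intros)
qed

text \<open>A period returns the orbit to its initial value, where the cosine of the angle is 1 as
  \<open>g\<close> undoes \<gamma>; so the angle has made at least one full turn.\<close>

lemma least_period:
  assumes "S > 0" "periodic S k"
  shows "per r \<le> S"
proof -
  have "k S = k 0" using assms(2) unfolding periodic_def by (metis add_0)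
  then have "g (\<gamma> (amp (\<theta> S))) = g (\<gamma> (amp (\<theta> 0)))" by (simp add: k_def)
  then have "cos (\<theta> S) = 1" unfolding g_\<gamma>[OF amp_gt] using r by (simp add: \<theta>_0)
  moreover have "\<theta> S > 0" using \<theta>_mono[of 0 S] assms(1) time_\<theta>[of S] time_0 \<theta>_0 by (cases "\<theta> S = 0") auto
  ultimately obtain n :: int where n: "\<theta> S = of_int n * 2 * pi" using cos_one_2pi_int by auto
  then have "n \<ge> 1" using \<open>\<theta> S > 0\<close> by (simp add: zero_less_mult_iff)
  then have "2 * pi \<le> \<theta> S" using n mult_right_mono[of 1 "of_int n" "2 * pi"] by simp
  then have "time (2 * pi) \<le> time (\<theta> S)" using time_strict[of "2 * pi" "\<theta> S"] by (cases "2 * pi = \<theta> S") auto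
  then show ?thesis by (simp add: time_2pi time_\<theta>)
qed

lemma is_least_period_k: "is_least_period k (per r)"
  unfolding is_least_period_def using per_pos[OF r_abs] k_periodic least_period by auto

lemma integral_k: "(k has_integral area r) {0..per r}"
  using orbit_integral[OF cont_\<gamma>[OF r_abs] has_integral_area[OF r_abs]] by (simp add: k_def[abs_def])

lemma integral_kd_sq: "((\<lambda>x. (kd x)\<^sup>2) has_integral action r) {0..per r}"
  unfolding kd_def
  by (rule orbit_integral[OF _ has_integral_action[OF r_abs]]) (intro continuous_intros)

lemma integral_k_power: "((\<lambda>x. k x powr (q + 1)) has_integral q * action r + area r) {0..per r}"
  unfolding k_def
proof (rule orbit_integral[OF _ has_integral_power[OF r_abs]])
  show "continuous_on UNIV (\<lambda>\<phi>. \<gamma> (amp \<phi>) powr (q + 1))"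
    by (intro continuous_intros cont_\<gamma>[OF r_abs]) (intro ballI, rule less_imp_neq[OF \<gamma>_pos[OF amp_gt], symmetric])
qed

text \<open>Minus the derivative of \<open>k x\<close> in the amplitude at fixed \<open>x\<close>:
  the angle changes at the rate \<open>- T / G1\<close>. As a derivative within a family of
  solutions it solves the linearised equation.\<close>

definition "V1 x = G1 (amp (\<theta> x)) * cos (\<theta> x) + r * sin (\<theta> x) * T (\<theta> x)"
definition "V1d x = - sin (\<theta> x) - f (k x) * T (\<theta> x)"

lemma V1_deriv: "(V1 has_real_derivative V1d x) (at x)"
  unfolding V1_def[abs_def]
proof (rule orbit_derivative[where F = "\<lambda>\<phi>. G1 (amp \<phi>) * cos \<phi> + r * sin \<phi> * T \<phi>"])
  let ?p = "\<theta> x"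
  have "((\<lambda>\<phi>. G1 (amp \<phi>) * cos \<phi> + r * sin \<phi> * T \<phi>) has_real_derivative
     (G2 (amp ?p) * (r * sin ?p) * cos ?p + - sin ?p * G1 (amp ?p)) + (r * cos ?p * T ?p + G2 (amp ?p) * - cos ?p * (r * sin ?p))) (at ?p)"
    by (rule DERIV_add[OF DERIV_mult[OF G1_amp_deriv DERIV_cos] DERIV_mult[OF r_sin_deriv T_deriv]])
  moreover have rc: "r * cos ?p = - (G1 (amp ?p) * f (k x))" using G1_f[OF amp_gt, of ?p] by (simp add: k_def)
  have "(g2 * (r * s) * c + - s * g1) + (r * cos ?p * t + g2 * - c * (r * s)) = (- s - f (k x) * t) * G1 (amp ?p)"
    if "g1 = G1 (amp ?p)" for g1 g2 s c t
    unfolding rc that by (simp add: algebra_simps)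
  ultimately show "((\<lambda>\<phi>. G1 (amp \<phi>) * cos \<phi> + r * sin \<phi> * T \<phi>) has_real_derivative V1d x * G1 (amp ?p)) (at ?p)"
    unfolding V1d_def by metis
qed

text \<open>Both sides of \<open>G1 s * f (\<gamma> s) = s\<close> differentiated.\<close>

lemma G_relation: "G2 s * f (\<gamma> s) + \<gamma> s powr (q - 1) * (G1 s)\<^sup>2 = 1" if s: "s > - rmax"
proof -
  have d1: "((\<lambda>s. G1 s * f (\<gamma> s)) has_real_derivative G2 s * f (\<gamma> s) + \<gamma> s powr (q - 1) * G1 s * G1 s) (at s)"
    by (intro DERIV_mult G1_deriv s DERIV_chain2[OF f_deriv \<gamma>_deriv] \<gamma>_pos)
  have d2: "((\<lambda>s. G1 s * f (\<gamma> s)) has_real_derivative 1) (at s)"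
  proof -
    have "\<forall>\<^sub>F x in nhds s. x \<in> {- rmax<..}" by (rule eventually_nhds_in_open) (use s in auto)
    then have "\<forall>\<^sub>F x in nhds s. G1 x * f (\<gamma> x) = x" by eventually_elim (simp add: G1_f)
    then show ?thesis by (simp add: DERIV_cong_ev)
  qed
  show ?thesis using DERIV_unique[OF d1 d2] by (simp add: power2_eq_square mult.assoc)
qed

lemma V1d_deriv: "(V1d has_real_derivative - (k x powr (q - 1) * V1 x)) (at x)"
proof -
  let ?p = "\<theta> x"
  have G: "G1 (amp ?p) \<noteq> 0" using G1_pos[OF amp_gt, of ?p] by simp
  have 1: "((\<lambda>x. - sin (\<theta> x)) has_real_derivative - cos ?p * (1 / G1 (amp ?p))) (at x)"
    using DERIV_chain2[OF DERIV_sin \<theta>_deriv, of x, THEN DERIV_minus] by simp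
  have 2: "((\<lambda>x. f (k x)) has_real_derivative k x powr (q - 1) * kd x) (at x)"
    by (rule DERIV_chain2[OF f_deriv[OF k_pos] k_deriv])
  have 3: "((\<lambda>x. T (\<theta> x)) has_real_derivative G2 (amp ?p) * - cos ?p * (1 / G1 (amp ?p))) (at x)"
    by (rule DERIV_chain2[OF T_deriv \<theta>_deriv])
  have "(V1d has_real_derivative - cos ?p * (1 / G1 (amp ?p)) - (k x powr (q - 1) * kd x * T ?p + G2 (amp ?p) * - cos ?p * (1 / G1 (amp ?p)) * f (k x))) (at x)"
    unfolding V1d_def[abs_def] by (intro DERIV_diff 1 DERIV_mult 2 3)
  moreover have "- cos ?p * (1 / G1 (amp ?p)) - (k x powr (q - 1) * kd x * T ?p + G2 (amp ?p) * - cos ?p * (1 / G1 (amp ?p)) * f (k x))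
     = - (k x powr (q - 1) * V1 x)"
  proof -
    have "- cos ?p * (1 / G1 (amp ?p)) - (G2 (amp ?p) * - cos ?p * (1 / G1 (amp ?p)) * f (k x)) = - (cos ?p / G1 (amp ?p)) * (1 - G2 (amp ?p) * f (k x))"
      by (simp add: algebra_simps)
    also have "1 - G2 (amp ?p) * f (k x) = k x powr (q - 1) * (G1 (amp ?p))\<^sup>2"
      using G_relation[OF amp_gt, of ?p] by (simp add: k_def)
    also have "- (cos ?p / G1 (amp ?p)) * (k x powr (q - 1) * (G1 (amp ?p))\<^sup>2) = - (k x powr (q - 1) * (G1 (amp ?p) * cos ?p))"
      using G by (simp add: power2_eq_square)
    finally show ?thesis unfolding V1_def kd_def by (simp add: algebra_simps)
  qed
  ultimately show ?thesis by simp
qed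

lemma kdd_deriv: "((\<lambda>x. - f (k x)) has_real_derivative - (k x powr (q - 1) * kd x)) (at x)"
  using DERIV_minus[OF DERIV_chain2[OF f_deriv[OF k_pos] k_deriv]] .

text \<open>The counterpart of \<open>- V1\<close> that is symmetric about the maximum of the orbit,
  as \<open>V1\<close> is about the minimum; \<open>per' r / 2\<close> is the value of
  \<open>T\<close> at half a turn.\<close>

definition "p2 x = - V1 x + per' r / 2 * kd x"
definition "p2d x = - V1d x - per' r / 2 * f (k x)"

lemma p2_deriv: "(p2 has_real_derivative p2d x) (at x)"
  unfolding p2_def[abs_def] p2d_def
  using DERIV_add[OF DERIV_minus[OF V1_deriv[of x]] DERIV_cmult[OF kd_deriv[of x], of "per' r / 2"]] by simp

lemma p2d_deriv: "(p2d has_real_derivative - (k x powr (q - 1) * p2 x)) (at x)"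
  unfolding p2d_def[abs_def] p2_def
  using DERIV_add[OF DERIV_minus[OF V1d_deriv[of x]] DERIV_cmult[OF kdd_deriv[of x], of "per' r / 2"]]
  by (simp add: algebra_simps)

text \<open>Scaling \<open>k\<close> to \<open>\<lambda> k(\<lambda> powr ((q - 1) / 2) x)\<close>
  and differentiating at 1 gives \<open>k + (q - 1) / 2 * x * k'\<close>, a solution with right-hand
  side 1 that is not periodic. Over a period it gains a multiple of \<open>kd\<close>, and so does
  \<open>V1\<close>; \<open>wc\<close> is the factor that makes the gains cancel.\<close>

definition "wc = (q - 1) * per r / (2 * per' r)"
definition "w x = k x + (q - 1) / 2 * (x * kd x) - wc * V1 x"
definition "wd x = kd x + (q - 1) / 2 * (kd x - x * f (k x)) - wc * V1d x"

lemma w_deriv: "(w has_real_derivative wd x) (at x)"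
proof -
  have "((\<lambda>x. x * kd x) has_real_derivative kd x - x * f (k x)) (at x)"
    using DERIV_mult[OF DERIV_ident kd_deriv[of x]] by (simp add: mult.commute)
  then show ?thesis unfolding w_def[abs_def] wd_def
    by (intro DERIV_diff DERIV_add DERIV_cmult k_deriv V1_deriv)
qed

lemma wd_deriv: "(wd has_real_derivative 1 - k x powr (q - 1) * w x) (at x)"
proof -
  have 1: "((\<lambda>x. x * f (k x)) has_real_derivative f (k x) + x * (k x powr (q - 1) * kd x)) (at x)"
    using DERIV_mult[OF DERIV_ident DERIV_chain2[OF f_deriv[OF k_pos] k_deriv], of x] by (simp add: mult.commute)
  have "(wd has_real_derivative - f (k x) + (q - 1) / 2 * (- f (k x) - (f (k x) + x * (k x powr (q - 1) * kd x)))
      - wc * (- (k x powr (q - 1) * V1 x))) (at x)"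
    unfolding wd_def[abs_def] by (intro DERIV_diff DERIV_add DERIV_cmult kd_deriv 1 V1d_deriv)
  moreover have "q * f (k x) = k x powr (q - 1) * k x - 1"
    using q k_pos[of x] powr_add[of "k x" "q - 1" 1] by (simp add: f_def)
  moreover have "- F + (q - 1) / 2 * (- F - (F + x * (a * y))) - wc * (- (a * v)) = - (q * F) - a * ((q - 1) / 2 * (x * y) - wc * v)"
    for F a y v by (simp add: field_simps)
  ultimately have "(wd has_real_derivative - (k x powr (q - 1) * k x - 1) - k x powr (q - 1) * ((q - 1) / 2 * (x * kd x) - wc * V1 x)) (at x)"
    by simp
  moreover have "- (a * y - 1) - a * (b - v) = 1 - a * (y + b - v)" for a b y v :: real by (simp add: algebra_simps)
  ultimately show ?thesis unfolding w_def by metis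
qed

lemma w_periodic: "periodic (per r) w"
proof -
  have c: "wc * per' r = (q - 1) / 2 * per r" using per'_pos[OF r] by (simp add: wc_def)
  have "w (x + per r) = w x" for x
  proof -
    have "V1 (x + per r) = V1 x + per' r * kd x"
      by (simp add: V1_def kd_def \<theta>_shift T_shift) (simp add: algebra_simps)
    moreover have "k (x + per r) = k x" "kd (x + per r) = kd x" using k_periodic kd_periodic by (auto simp: periodic_def)
    ultimately have "w (x + per r) = w x + ((q - 1) / 2 * per r - wc * per' r) * kd x"
      unfolding w_def by (simp add: algebra_simps)
    then show ?thesis using c by simp
  qed
  then show ?thesis by (simp add: periodic_def)
qed

text \<open>The contributions of the end value \<open>\<gamma> (- r)\<close> from \<open>V1\<close>
  and from \<open>x * kd x\<close> cancel, again through the choice of \<open>wc\<close>. The result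
  is later recognised as a positive multiple of the derivative of the mass.\<close>

lemma integral_w: "(w has_integral (3 - q) / 2 * area r + (q - 1) / 2 * per r * area' r / per' r) {0..per r}"
proof -
  have "(V1 has_integral \<gamma> (- r) * per' r - area' r) {0..per r}"
    unfolding V1_def[abs_def]
  proof (rule orbit_integral)
    have cT: "continuous_on S T" for S using DERIV_isCont[OF T_deriv] by (intro continuous_at_imp_continuous_on) simp
    show "continuous_on UNIV (\<lambda>\<phi>. G1 (amp \<phi>) * cos \<phi> + r * sin \<phi> * T \<phi>)"
      by (intro continuous_intros cont_G1[OF r_abs] cT)
    have "((\<lambda>\<phi>. \<gamma> (amp \<phi>) * T \<phi>) has_real_derivative G1 (amp \<phi>) * (r * sin \<phi>) * T \<phi> + G2 (amp \<phi>) * - cos \<phi> * \<gamma> (amp \<phi>)) (at \<phi>)" for \<phi>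
      by (rule DERIV_mult[OF \<gamma>_amp_deriv T_deriv])
    then have i1: "((\<lambda>\<phi>. G1 (amp \<phi>) * (r * sin \<phi>) * T \<phi> + G2 (amp \<phi>) * - cos \<phi> * \<gamma> (amp \<phi>)) has_integral
        \<gamma> (amp (2 * pi)) * T (2 * pi) - \<gamma> (amp 0) * T 0) {0..2 * pi}"
      by (intro has_integral_of_derivative) auto
    have i2: "((\<lambda>\<phi>. ((G1 (amp \<phi>))\<^sup>2 + \<gamma> (amp \<phi>) * G2 (amp \<phi>)) * - cos \<phi>) has_integral area' r) {0..2 * pi}"
      unfolding area'_def
      by (intro integrable_integral integrable_continuous_real continuous_intros cont_G1 cont_G2 cont_\<gamma> r_abs)
    have "((\<lambda>\<phi>. (G1 (amp \<phi>) * (r * sin \<phi>) * T \<phi> + G2 (amp \<phi>) * - cos \<phi> * \<gamma> (amp \<phi>)) - ((G1 (amp \<phi>))\<^sup>2 + \<gamma> (amp \<phi>) * G2 (amp \<phi>)) * - cos \<phi>)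
       has_integral \<gamma> (- r) * per' r - area' r) {0..2 * pi}"
      using has_integral_diff[OF i1 i2] by (simp add: T_0 T_2pi)
    then show "((\<lambda>\<phi>. (G1 (amp \<phi>) * cos \<phi> + r * sin \<phi> * T \<phi>) * G1 (amp \<phi>)) has_integral \<gamma> (- r) * per' r - area' r) {0..2 * pi}"
      by (simp add: power2_eq_square algebra_simps)
  qed
  moreover have "((\<lambda>x. x * kd x) has_integral per r * \<gamma> (- r) - area r) {0..per r}"
  proof -
    have "((\<lambda>x. x * k x) has_real_derivative k x + x * kd x) (at x)" for x
      using DERIV_mult[OF DERIV_ident k_deriv[of x]] by (simp add: mult.commute)
    then have "((\<lambda>x. k x + x * kd x) has_integral per r * k (per r) - 0 * k 0) {0..per r}"
      by (intro has_integral_of_derivative[OF less_imp_le[OF per_pos[OF r_abs]]])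
    from has_integral_diff[OF this integral_k] show ?thesis by (simp add: k_def \<theta>_per)
  qed
  ultimately have "(w has_integral area r + (q - 1) / 2 * (per r * \<gamma> (- r) - area r) - wc * (\<gamma> (- r) * per' r - area' r)) {0..per r}"
    unfolding w_def[abs_def] by (intro has_integral_diff has_integral_add has_integral_mult_right integral_k)
  moreover have "wc * (\<gamma> (- r) * per' r - area' r) = (q - 1) / 2 * per r * \<gamma> (- r) - (q - 1) / 2 * per r * area' r / per' r"
    using per'_pos[OF r] by (simp add: wc_def field_simps)
  moreover have "a + (q - 1) / 2 * (per r * y - a) - ((q - 1) / 2 * per r * y - z) = (3 - q) / 2 * a + z" for a y z
    by (simp add: field_simps)
  ultimately show ?thesis by metis
qed

text \<open>In the angle, \<open>m\<close>, the quotient of \<open>V1\<close> and \<open>kd\<close>,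
  decreases strictly on the half turn. With \<open>z\<close> the angle where it equals
  \<open>T pi / 2\<close>, it is positive up to \<open>z\<close>, so \<open>V1 > 0\<close>, and
  below \<open>T pi\<close> from \<open>z\<close> on, so \<open>p2 > 0\<close>. Symmetry about 0 and
  about \<open>pi\<close> extends this to full arcs. The argument needs \<open>T pi > 0\<close>,
  that is, the increase of the period.\<close>

lemma conjugate_points:
  obtains a b where "a \<le> b" "b \<le> a + per r" "kd a \<noteq> 0" "\<And>x. x \<in> {a..b} \<Longrightarrow> 0 < V1 x" "\<And>x. x \<in> {b..a + per r} \<Longrightarrow> 0 < p2 x"
proof -
  let ?V = "\<lambda>\<phi>. G1 (amp \<phi>) * cos \<phi> + r * sin \<phi> * T \<phi>"
  let ?p = "\<lambda>\<phi>. - ?V \<phi> + T pi * (r * sin \<phi>)"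
  \<comment> \<open>A zero of \<open>Z\<close> is a point where the quotient takes the value halfway
    between the two bounds 0 and \<open>T pi\<close>; either bound is then respected
    strictly.\<close>
  define Z where "Z \<phi> = ?V \<phi> - T pi / 2 * (r * sin \<phi>)" for \<phi>
  have Tpi: "T pi > 0" using T_pi per'_pos[OF r] by simp
  have cT: "continuous_on S T" for S using DERIV_isCont[OF T_deriv] by (intro continuous_at_imp_continuous_on) simp
  have "continuous_on {0..pi} Z" unfolding Z_def by (intro continuous_intros cont_G1[OF r_abs] cT)
  moreover have "Z pi \<le> 0" "0 \<le> Z 0" using G1_pos[OF amp_gt, of 0] G1_pos[OF amp_gt, of pi] by (auto simp: Z_def)
  ultimately obtain z where z: "0 \<le> z" "z \<le> pi" "Z z = 0" using IVT2'[of Z pi 0 0] by auto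
  have "z \<noteq> 0" "z \<noteq> pi" using z(3) G1_pos[OF amp_gt, of 0] G1_pos[OF amp_gt, of pi] by (auto simp: Z_def)
  then have z': "0 < z" "z < pi" using z by auto
  define m where "m \<phi> = G1 (amp \<phi>) * cos \<phi> / (r * sin \<phi>) + T \<phi>" for \<phi>
  have m: "?V \<phi> = r * sin \<phi> * m \<phi>" if "0 < \<phi>" "\<phi> < pi" for \<phi>
    using r sin_gt_zero[OF that] by (simp add: m_def field_simps)
  \<comment> \<open>The constant Wronskian of \<open>V1\<close> and \<open>kd\<close> in disguise:
    all terms with \<open>G2\<close> cancel.\<close>
  have m_deriv: "(m has_real_derivative - G1 (amp \<phi>) / (r * (sin \<phi>)\<^sup>2)) (at \<phi>)" if "0 < \<phi>" "\<phi> < pi" for \<phi>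
  proof -
    have s: "sin \<phi> > 0" by (rule sin_gt_zero[OF that])
    have 1: "((\<lambda>\<phi>. G1 (amp \<phi>) * cos \<phi>) has_real_derivative G2 (amp \<phi>) * (r * sin \<phi>) * cos \<phi> + - sin \<phi> * G1 (amp \<phi>)) (at \<phi>)"
      by (rule DERIV_mult[OF G1_amp_deriv DERIV_cos])
    note 2 = r_sin_deriv
    have "(m has_real_derivative ((G2 (amp \<phi>) * (r * sin \<phi>) * cos \<phi> + - sin \<phi> * G1 (amp \<phi>)) * (r * sin \<phi>) - G1 (amp \<phi>) * cos \<phi> * (r * cos \<phi>)) / (r * sin \<phi> * (r * sin \<phi>))
        + G2 (amp \<phi>) * - cos \<phi>) (at \<phi>)"
      unfolding m_def[abs_def] by (intro DERIV_add DERIV_divide 1 2 T_deriv) (use s r in auto)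
    moreover have "((g2 * (r * s) * c + - s * g1) * (r * s) - g1 * c * (r * c)) / (r * s * (r * s)) + g2 * - c
        = - g1 * (s\<^sup>2 + c\<^sup>2) / (r * s\<^sup>2)" if "s > 0" for g1 g2 s c
      using that r by (simp add: field_simps power2_eq_square)
    from this[OF s, of "G2 (amp \<phi>)" "cos \<phi>" "G1 (amp \<phi>)"]
    have "((G2 (amp \<phi>) * (r * sin \<phi>) * cos \<phi> + - sin \<phi> * G1 (amp \<phi>)) * (r * sin \<phi>) - G1 (amp \<phi>) * cos \<phi> * (r * cos \<phi>)) / (r * sin \<phi> * (r * sin \<phi>))
        + G2 (amp \<phi>) * - cos \<phi> = - G1 (amp \<phi>) / (r * (sin \<phi>)\<^sup>2)" by (simp only: sin_cos_squared_add mult_1_right)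
    ultimately show ?thesis by metis
  qed
  have m_less: "m \<psi> < m \<phi>" if "0 < \<phi>" "\<phi> < \<psi>" "\<psi> < pi" for \<phi> \<psi>
  proof (rule DERIV_neg_imp_decreasing[OF that(2)])
    fix x assume "\<phi> \<le> x" "x \<le> \<psi>"
    then have x: "0 < x" "x < pi" using that by auto
    have "- G1 (amp x) / (r * (sin x)\<^sup>2) < 0" using G1_pos[OF amp_gt, of x] r sin_gt_zero[OF x] by (simp add: divide_neg_pos)
    then show "\<exists>y. (m has_real_derivative y) (at x) \<and> y < 0" using m_deriv[OF x] by blast
  qed
  have mz: "m z = T pi / 2"
  proof -
    have "r * sin z * m z = T pi / 2 * (r * sin z)" using z(3) m[OF z'] unfolding Z_def by linarith
    moreover have "r * sin z \<noteq> 0" using r sin_gt_zero[OF z'] by simp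
    ultimately show ?thesis by (metis mult.commute mult_cancel_left)
  qed
  have V_half: "?V \<phi> > 0" if "0 \<le> \<phi>" "\<phi> \<le> z" for \<phi>
  proof (cases "\<phi> = 0")
    case True
    then show ?thesis using G1_pos[OF amp_gt, of 0] by simp
  next
    case False
    then have p: "0 < \<phi>" "\<phi> < pi" using that z' by auto
    have "m \<phi> > 0" using m_less[of \<phi> z] that p z' mz Tpi by (cases "\<phi> = z") auto
    then show ?thesis unfolding m[OF p] using r sin_gt_zero[OF p] by simp
  qed
  have V_even: "?V (- \<phi>) = ?V \<phi>" for \<phi> by (simp add: T_odd)
  have V_pos': "?V \<phi> > 0" if "- z \<le> \<phi>" "\<phi> \<le> z" for \<phi>
    using V_half[of \<phi>] V_half[of "- \<phi>"] V_even[of \<phi>] that by (cases "\<phi> \<ge> 0") auto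
  have p_half: "?p \<phi> > 0" if "z \<le> \<phi>" "\<phi> \<le> pi" for \<phi>
  proof (cases "\<phi> = pi")
    case True
    then show ?thesis using G1_pos[OF amp_gt, of pi] by simp
  next
    case False
    then have p: "0 < \<phi>" "\<phi> < pi" using that z' by auto
    have "m \<phi> < T pi" using m_less[of z \<phi>] that p z' mz Tpi by (cases "\<phi> = z") auto
    then have "0 < r * sin \<phi> * (T pi - m \<phi>)" using r sin_gt_zero[OF p] by simp
    then show ?thesis unfolding m[OF p] by (simp add: algebra_simps)
  qed
  have p_even: "?p (2 * pi - \<phi>) = ?p \<phi>" for \<phi>
  proof -
    have "T (2 * pi - \<phi>) = 2 * T pi - T \<phi>" using T_shift[of "- \<phi>"] T_pi by (simp add: T_odd)
    moreover have "sin (2 * pi - \<phi>) = - sin \<phi>" "cos (2 * pi - \<phi>) = cos \<phi>" by simp_all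
    ultimately show ?thesis by (simp only:) (simp add: algebra_simps)
  qed
  have p_pos': "?p \<phi> > 0" if "z \<le> \<phi>" "\<phi> \<le> 2 * pi - z" for \<phi>
  proof (cases "\<phi> \<le> pi")
    case False
    have "0 < ?p (2 * pi - \<phi>)" by (rule p_half) (use that False in auto)
    then show ?thesis unfolding p_even .
  qed (use p_half that in blast)
  have time_eq: "time (- z) + per r = time (2 * pi - z)" using time_shift[of "- z"] by simp
  show ?thesis
  proof (rule that[of "time (- z)" "time z"])
    show "time (- z) \<le> time z" using time_strict[of "- z" z] z' by simp
    show "time z \<le> time (- z) + per r" unfolding time_eq using time_strict[of z "2 * pi - z"] z' by simp
    show "kd (time (- z)) \<noteq> 0" using sin_gt_zero[OF z'] r by (simp add: kd_def \<theta>_time)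
    show "0 < V1 x" if "x \<in> {time (- z)..time z}" for x
    proof -
      have "- z \<le> \<theta> x" "\<theta> x \<le> z" using that \<theta>_mono[of "time (- z)" x] \<theta>_mono[of x "time z"] by (auto simp: \<theta>_time)
      then show ?thesis unfolding V1_def by (rule V_pos')
    qed
    show "0 < p2 x" if "x \<in> {time z..time (- z) + per r}" for x
    proof -
      have "z \<le> \<theta> x" "\<theta> x \<le> 2 * pi - z"
        using that \<theta>_mono[of "time z" x] \<theta>_mono[of x "time (2 * pi - z)"] unfolding time_eq by (auto simp: \<theta>_time)
      then show ?thesis using p_pos'[of "\<theta> x"] unfolding p2_def V1_def kd_def T_pi by simp
    qed
  qed
qed

end

section \<open>Classification of steady states\<close>

text \<open>Contains the real powers of \<open>k\<close> and is closed under differentiation as soon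
  as \<open>k\<close> and \<open>w\<close> satisfy second-order equations of the right form, so its
  members are smooth although nothing but equations is known about \<open>k\<close> and
  \<open>w\<close>.\<close>

inductive_set ode_algebra :: "(real \<Rightarrow> real) \<Rightarrow> (real \<Rightarrow> real) \<Rightarrow> (real \<Rightarrow> real) \<Rightarrow> (real \<Rightarrow> real) \<Rightarrow> (real \<Rightarrow> real) set"
  for k k' w w' where
  const: "(\<lambda>_. c) \<in> ode_algebra k k' w w'"
| powr: "(\<lambda>x. k x powr s) \<in> ode_algebra k k' w w'"
| k': "k' \<in> ode_algebra k k' w w'"
| w: "w \<in> ode_algebra k k' w w'"
| w': "w' \<in> ode_algebra k k' w w'"
| add: "u \<in> ode_algebra k k' w w' \<Longrightarrow> v \<in> ode_algebra k k' w w' \<Longrightarrow> (\<lambda>x. u x + v x) \<in> ode_algebra k k' w w'"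
| mult: "u \<in> ode_algebra k k' w w' \<Longrightarrow> v \<in> ode_algebra k k' w w' \<Longrightarrow> (\<lambda>x. u x * v x) \<in> ode_algebra k k' w w'"

lemma ode_algebra_smooth:
  assumes pos: "\<And>x. k x > 0" and k: "\<And>x. (k has_real_derivative k' x) (at x)"
    "\<And>x. (k' has_real_derivative D - A * k x powr q) (at x)"
    and w: "\<And>x. (w has_real_derivative w' x) (at x)" "\<And>x. (w' has_real_derivative \<kappa> - B * k x powr (q - 1) * w x) (at x)"
    and u: "u \<in> ode_algebra k k' w w'"
  shows "smooth u"
proof (rule smooth_closed_family[OF u])
  let ?A = "ode_algebra k k' w w'"
  fix u assume "u \<in> ?A"
  then show "\<exists>u'\<in>?A. \<forall>x. (u has_real_derivative u' x) (at x)"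
  proof induction
    case (const c)
    show ?case by (intro bexI[of _ "\<lambda>_. 0"] ode_algebra.intros) auto
  next
    case (powr s)
    show ?case
      by (intro bexI[of _ "\<lambda>x. s * k x powr (s - 1) * k' x"] ode_algebra.intros)
         (use DERIV_fun_powr[OF k(1) pos, of s] in simp)
  next
    case k'
    show ?case
      by (intro bexI[of _ "\<lambda>x. D + (- A) * k x powr q"] ode_algebra.intros) (use k(2) in simp)
  next
    case w
    show ?case by (intro bexI[of _ w'] ode_algebra.intros) (use assms(4) in simp)
  next
    case w'
    show ?case
      by (intro bexI[of _ "\<lambda>x. \<kappa> + (- B) * k x powr (q - 1) * w x"] ode_algebra.intros) (use assms(5) in simp)
  next
    case (add u v)
    then obtain u' v' where "u' \<in> ?A" "v' \<in> ?A" "\<And>x. (u has_real_derivative u' x) (at x)" "\<And>x. (v has_real_derivative v' x) (at x)"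
      by blast
    then show ?case by (intro bexI[of _ "\<lambda>x. u' x + v' x"] ode_algebra.intros) (auto intro!: DERIV_add)
  next
    case (mult u v)
    then obtain u' v' where "u' \<in> ?A" "v' \<in> ?A" "\<And>x. (u has_real_derivative u' x) (at x)" "\<And>x. (v has_real_derivative v' x) (at x)"
      by blast
    then show ?case using mult.hyps
      by (intro bexI[of _ "\<lambda>x. u' x * v x + v' x * u x"] ode_algebra.intros) (auto intro!: DERIV_mult)
  qed
qed

text \<open>Gronwall's argument in both directions: the squared norm \<open>E\<close> of position
  and velocity satisfies \<open>|E'| \<le> (1 + L) * E\<close> and starts at 0.\<close>

lemma second_order_unique:
  fixes d d' e :: "real \<Rightarrow> real"
  assumes d: "\<And>x. (d has_real_derivative d' x) (at x)" "\<And>x. (d' has_real_derivative e x) (at x)"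
    and e: "\<And>x. \<bar>e x\<bar> \<le> L * \<bar>d x\<bar>" and L: "L \<ge> 0" and i: "d 0 = 0" "d' 0 = 0"
  shows "d x = 0"
proof -
  define C where "C = 1 + L"
  define E where "E x = (d x)\<^sup>2 + (d' x)\<^sup>2" for x
  define E' where "E' x = 2 * d x * d' x + 2 * d' x * e x" for x
  have Ed: "(E has_real_derivative E' x) (at x)" for x
    unfolding E_def[abs_def] E'_def by (auto intro!: derivative_eq_intros d)
  have bound: "\<bar>E' x\<bar> \<le> C * E x" for x
  proof -
    have "\<bar>E' x\<bar> \<le> 2 * (\<bar>d x\<bar> * \<bar>d' x\<bar>) + 2 * (\<bar>d' x\<bar> * \<bar>e x\<bar>)"
      unfolding E'_def using abs_triangle_ineq[of "2 * d x * d' x" "2 * d' x * e x"] by (simp add: abs_mult)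
    also have "\<dots> \<le> 2 * (\<bar>d x\<bar> * \<bar>d' x\<bar>) + 2 * (\<bar>d' x\<bar> * (L * \<bar>d x\<bar>))"
      by (intro add_left_mono mult_left_mono e) auto
    also have "\<dots> = C * (2 * \<bar>d x\<bar> * \<bar>d' x\<bar>)" unfolding C_def by (simp add: algebra_simps)
    also have "\<dots> \<le> C * E x"
    proof (rule mult_left_mono)
      have "0 \<le> (\<bar>d x\<bar> - \<bar>d' x\<bar>)\<^sup>2" by simp
      then show "2 * \<bar>d x\<bar> * \<bar>d' x\<bar> \<le> E x" unfolding E_def power2_diff by simp
    qed (use L in \<open>simp add: C_def\<close>)
    finally show ?thesis .
  qed
  have "E x * exp (- C * x) \<le> E 0 * exp (- C * 0)" if "x \<ge> 0"
  proof (rule DERIV_nonpos_imp_nonincreasing[OF that])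
    fix y
    have "((\<lambda>x. E x * exp (- C * x)) has_real_derivative (E' y - C * E y) * exp (- C * y)) (at y)"
      by (auto intro!: derivative_eq_intros Ed simp: algebra_simps)
    moreover have "(E' y - C * E y) * exp (- C * y) \<le> 0" using bound[of y] by (intro mult_nonpos_nonneg) auto
    ultimately show "\<exists>z. ((\<lambda>x. E x * exp (- C * x)) has_real_derivative z) (at y) \<and> z \<le> 0" by blast
  qed
  moreover have "E x * exp (C * x) \<le> E 0 * exp (C * 0)" if "x \<le> 0"
  proof (rule DERIV_nonneg_imp_nondecreasing[OF that])
    fix y
    have "((\<lambda>x. E x * exp (C * x)) has_real_derivative (E' y + C * E y) * exp (C * y)) (at y)"
      by (auto intro!: derivative_eq_intros Ed simp: algebra_simps)
    moreover have "(E' y + C * E y) * exp (C * y) \<ge> 0" using bound[of y] by (intro mult_nonneg_nonneg) auto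
    ultimately show "\<exists>z. ((\<lambda>x. E x * exp (C * x)) has_real_derivative z) (at y) \<and> z \<ge> 0" by blast
  qed
  moreover have "E 0 = 0" using i by (simp add: E_def)
  ultimately have "E x * exp (- C * x) \<le> 0 \<or> E x * exp (C * x) \<le> 0" by (cases "x \<ge> 0") simp_all
  then have "E x \<le> 0" using exp_gt_zero[of "- C * x"] exp_gt_zero[of "C * x"]
    by (metis mult_le_0_iff not_le)
  then show ?thesis unfolding E_def by (simp add: sum_power2_le_zero_iff)
qed

lemma periodic_bounds:
  fixes k :: "real \<Rightarrow> real"
  assumes "T > 0" "periodic T k" "continuous_on UNIV k"
  obtains x0 x1 where "\<And>x. k x0 \<le> k x" "\<And>x. k x \<le> k x1"
proof -
  have c: "continuous_on {0..T} k" using assms(3) continuous_on_subset by blast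
  obtain x0 where x0: "x0 \<in> {0..T}" "\<forall>y\<in>{0..T}. k x0 \<le> k y"
    using continuous_attains_inf[OF _ _ c] assms(1) by auto
  obtain x1 where x1: "x1 \<in> {0..T}" "\<forall>y\<in>{0..T}. k y \<le> k x1"
    using continuous_attains_sup[OF _ _ c] assms(1) by auto
  have "\<exists>y\<in>{0..T}. k y = k x" for x
  proof -
    obtain j :: int where j: "0 \<le> x + of_int j * T" "x + of_int j * T < 0 + T" using periodic_representative[OF assms(1)] by blast
    then show ?thesis using periodic_int[OF assms(2), of x j] by (intro bexI[of _ "x + of_int j * T"]) auto
  qed
  then have "k x0 \<le> k x" "k x \<le> k x1" for x
    using x0(2) x1(2) by (metis (no_types))+
  then show ?thesis by (rule that)
qed

section \<open>The orbits are the profiles\<close>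

context exponent
begin

text \<open>Periodicity and positivity confine both solutions to a compact interval inside the
  positive axis, where the force is Lipschitz.\<close>

lemma ode_unique:
  assumes k1: "\<And>x. (k1 has_real_derivative k1' x) (at x)" "\<And>x. (k1' has_real_derivative - f (k1 x)) (at x)"
      "\<And>x. k1 x > 0" "periodic T1 k1" "T1 > 0"
    and k2: "\<And>x. (k2 has_real_derivative k2' x) (at x)" "\<And>x. (k2' has_real_derivative - f (k2 x)) (at x)"
      "\<And>x. k2 x > 0" "periodic T2 k2" "T2 > 0"
    and init: "k1 0 = k2 0" "k1' 0 = k2' 0"
  shows "k1 x = k2 x"
proof -
  have c: "continuous_on UNIV k1" "continuous_on UNIV k2"
    by (intro continuous_at_imp_continuous_on ballI DERIV_isCont[OF k1(1)] DERIV_isCont[OF k2(1)])+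
  obtain x1 y1 where b1: "\<And>x. k1 x1 \<le> k1 x" "\<And>x. k1 x \<le> k1 y1" by (rule periodic_bounds[OF k1(5,4) c(1)]) (rule that)
  obtain x2 y2 where b2: "\<And>x. k2 x2 \<le> k2 x" "\<And>x. k2 x \<le> k2 y2" by (rule periodic_bounds[OF k2(5,4) c(2)]) (rule that)
  define m where "m = min (k1 x1) (k2 x2)"
  define M where "M = max (k1 y1) (k2 y2)"
  have m: "m > 0" "m \<le> k1 x" "m \<le> k2 x" "k1 x \<le> M" "k2 x \<le> M" for x
    using b1[of x] b2[of x] k1(3)[of x1] k2(3)[of x2] by (simp_all add: m_def M_def min_le_iff_disj le_max_iff_disj)
  have lip: "\<bar>f a - f b\<bar> \<le> M powr (q - 1) * \<bar>a - b\<bar>" if "m \<le> a" "m \<le> b" "a \<le> M" "b \<le> M" for a b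
  proof -
    have "norm (f a - f b) \<le> M powr (q - 1) * norm (a - b)"
    proof (rule field_differentiable_bound[of "{m..M}" f "\<lambda>x. x powr (q - 1)"])
      fix z assume "z \<in> {m..M}"
      then have z: "0 < z" "z \<le> M" using m(1) by auto
      show "(f has_field_derivative z powr (q - 1)) (at z within {m..M})"
        by (rule has_field_derivative_at_within[OF f_deriv[OF z(1)]])
      show "norm (z powr (q - 1)) \<le> M powr (q - 1)" using powr_mono2[of "q - 1" z M] z q by simp
    next
      show "convex {m..M}" by simp
      show "a \<in> {m..M}" "b \<in> {m..M}" using that by auto
    qed
    then show ?thesis by simp
  qed
  have "k1 x - k2 x = 0"
  proof (rule second_order_unique[where d = "\<lambda>x. k1 x - k2 x" and d' = "\<lambda>x. k1' x - k2' x" and e = "\<lambda>x. - f (k1 x) - - f (k2 x)" and L = "M powr (q - 1)"])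
    show "\<bar>- f (k1 x) - - f (k2 x)\<bar> \<le> M powr (q - 1) * \<bar>k1 x - k2 x\<bar>" for x
      using lip[OF m(2,3) m(4,5), of x x] by (simp add: abs_minus_commute)
    show "((\<lambda>x. k1 x - k2 x) has_real_derivative k1' x - k2' x) (at x)"
      "((\<lambda>x. k1' x - k2' x) has_real_derivative - f (k1 x) - - f (k2 x)) (at x)" for x
      by (rule DERIV_diff[OF k1(1) k2(1)], rule DERIV_diff[OF k1(2) k2(2)])
  qed (simp_all add: init)
  then show ?thesis by simp
qed

lemma orbit_of_minimum: "0 < \<alpha> \<Longrightarrow> \<alpha> < 1 \<Longrightarrow> orbit q (- g \<alpha>)"
  by unfold_locales (use g_neg[of \<alpha>] g_gt[of \<alpha>] in auto)

lemma orbit_unique: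
  assumes \<alpha>: "0 < \<alpha>" "\<alpha> < 1"
    and k: "\<And>x. (k has_real_derivative k' x) (at x)" "\<And>x. (k' has_real_derivative - f (k x)) (at x)"
      "\<And>x. k x > 0" "periodic T k" "T > 0" "k 0 = \<alpha>" "k' 0 = 0"
  shows "k = orbit.k q (- g \<alpha>)"
proof
  interpret o: orbit q "- g \<alpha>" by (rule orbit_of_minimum[OF \<alpha>])
  fix x
  show "k x = o.k x"
    by (rule ode_unique[OF k(1-5) o.k_deriv o.kd_deriv o.k_pos o.k_periodic per_pos[OF o.r_abs]])
       (simp_all add: k o.k_0 o.kd_0 \<gamma>_g \<alpha>)
qed

lemma is_profile_orbit:
  assumes \<alpha>: "0 < \<alpha>" "\<alpha> < 1"
  shows "is_profile q \<alpha> (orbit.k q (- g \<alpha>))"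
proof -
  interpret o: orbit q "- g \<alpha>" by (rule orbit_of_minimum[OF \<alpha>])
  have d: "deriv o.k = o.kd" "deriv o.kd = (\<lambda>x. - f (o.k x))"
    using DERIV_imp_deriv o.k_deriv o.kd_deriv by blast+
  \<comment> \<open>The algebra contains powers only; by positivity the orbit is its own first
    power. The slots for \<open>w\<close> are filled with 0.\<close>
  have k1: "o.k = (\<lambda>x. o.k x powr 1)" using o.k_pos by (auto simp: less_imp_le)
  have "o.k \<in> ode_algebra o.k o.kd (\<lambda>_. 0) (\<lambda>_. 0)" by (subst k1) (rule ode_algebra.powr)
  then have "smooth o.k"
    by (rule ode_algebra_smooth[rotated 5, where D = "1 / q" and A = "1 / q" and \<kappa> = 0 and q = q and B = 0])
       (use o.k_pos o.k_deriv o.kd_deriv in \<open>auto simp: f_def diff_divide_distrib\<close>)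
  then show ?thesis unfolding is_profile_def
    using o.k_pos o.k_periodic per_pos[OF o.r_abs] d o.k_0 o.kd_0 \<alpha> by (auto simp: f_def \<gamma>_g)
qed

lemma profile_eq:
  assumes \<alpha>: "0 < \<alpha>" "\<alpha> < 1"
  shows "profile q \<alpha> = orbit.k q (- g \<alpha>)"
  unfolding profile_def
proof (rule the_equality)
  show "is_profile q \<alpha> (orbit.k q (- g \<alpha>))" by (rule is_profile_orbit[OF \<alpha>])
  fix k assume k: "is_profile q \<alpha> k"
  then have s: "smooth k" "\<And>x. deriv (deriv k) x = - f (k x)"
    unfolding is_profile_def f_def by (auto simp: add_eq_0_iff)
  obtain T where "T > 0" "periodic T k" using k unfolding is_profile_def by blast
  then show "k = orbit.k q (- g \<alpha>)"
    using orbit_unique[OF \<alpha> smooth_has_derivative[OF s(1)], of T] smooth_derivative[OF s(1), of 1] s(2) k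
    unfolding is_profile_def by simp
qed

lemma profile_period_eq:
  assumes \<alpha>: "0 < \<alpha>" "\<alpha> < 1"
  shows "profile_period q \<alpha> = per (- g \<alpha>)"
proof -
  interpret o: orbit q "- g \<alpha>" by (rule orbit_of_minimum[OF \<alpha>])
  show ?thesis unfolding profile_period_def profile_eq[OF \<alpha>]
    using o.is_least_period_k by (intro the_equality) (auto simp: is_least_period_def intro!: antisym)
qed

lemma profile_area_eq:
  assumes \<alpha>: "0 < \<alpha>" "\<alpha> < 1"
  shows "profile_area q \<alpha> = area (- g \<alpha>)"
proof -
  interpret o: orbit q "- g \<alpha>" by (rule orbit_of_minimum[OF \<alpha>])
  show ?thesis unfolding profile_area_def profile_period_eq[OF \<alpha>] profile_eq[OF \<alpha>]
    by (rule integral_unique[OF o.integral_k])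
qed

end

text \<open>Dividing the constant flux \<open>C\<close> by \<open>h powr n\<close> yields the
  derivative of the periodic function \<open>y\<close>, which has the sign of \<open>C\<close>
  throughout; hence \<open>C = 0\<close> and \<open>y\<close> is a constant \<open>D\<close>. For
  nonpositive \<open>D\<close> the second derivative would be negative everywhere, against
  periodicity of the first.\<close>

lemma steady_state_second_order:
  assumes B: "B > 0" and q: "q = m - n + 1" "1 < q" and h: "pos_periodic_steady_state m n B h" "periodic X h" "X > 0"
  obtains D where "D > 0" "\<And>x. (h has_real_derivative deriv h x) (at x)"
    "\<And>x. (deriv h has_real_derivative D - B / q * h x powr q) (at x)"
proof -
  have pos: "h x > 0" and C4: "C_k 4 h"
    and ss: "((\<lambda>y. h y powr n * (deriv ^^ 3) h y + B * h y powr m * deriv h y) has_real_derivative 0) (at x)" for x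
    using h(1) unfolding pos_periodic_steady_state_def by auto
  define h1 h2 h3 where "h1 = deriv h" and "h2 = (deriv ^^ 2) h" and "h3 = (deriv ^^ 3) h"
  have d: "(h has_real_derivative h1 x) (at x)" "(h1 has_real_derivative h2 x) (at x)" "(h2 has_real_derivative h3 x) (at x)" for x
    using C_k_derivative[OF C4, of 0] C_k_derivative[OF C4, of 1] C_k_derivative[OF C4, of 2]
    by (simp_all add: h1_def h2_def h3_def numeral_eq_Suc)
  have p1: "periodic X h1" by (rule periodic_derivative[OF h(2) d(1)])
  have p2: "periodic X h2" by (rule periodic_derivative[OF p1 d(2)])
  define C where "C = h 0 powr n * h3 0 + B * h 0 powr m * h1 0"
  have const: "h x powr n * h3 x + B * h x powr m * h1 x = C" for x
    unfolding C_def using ss unfolding h3_def[symmetric] h1_def[symmetric]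
    by (intro DERIV_isconst_all[of "\<lambda>y. h y powr n * h3 y + B * h y powr m * h1 y"]) simp
  define y where "y x = h2 x + B / q * h x powr q" for x
  have yd: "(y has_real_derivative C * h x powr (- n)) (at x)" for x
  proof -
    have "(y has_real_derivative h3 x + B / q * (q * h x powr (q - 1) * h1 x)) (at x)"
      unfolding y_def[abs_def] using DERIV_add[OF d(3)[of x] DERIV_cmult[OF DERIV_fun_powr[OF d(1) pos, of q x], of "B / q"]] by simp
    moreover have "h3 x + B / q * (q * h x powr (q - 1) * h1 x) = C * h x powr (- n)"
    proof -
      have "h x powr n * h x powr (- n) = 1" using pos[of x] by (simp flip: powr_add)
      moreover have "h x powr m * h x powr (- n) = h x powr (q - 1)" using q by (simp flip: powr_add)
      moreover have "C * h x powr (- n) = h3 x * (h x powr n * h x powr (- n)) + B * (h x powr m * h x powr (- n)) * h1 x"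
        using const[of x] by (simp add: algebra_simps flip: const[of x])
      ultimately show ?thesis using q by simp
    qed
    ultimately show ?thesis by simp
  qed
  have yX: "y X = y 0" using p2[unfolded periodic_def, rule_format, of 0] h(2)[unfolded periodic_def, rule_format, of 0] by (simp add: y_def)
  have "C = 0"
  proof (rule ccontr)
    assume "C \<noteq> 0"
    then consider "C > 0" | "C < 0" by linarith
    then show False
    proof cases
      case 1
      have "\<exists>z. (y has_real_derivative z) (at x) \<and> 0 < z" for x
        using yd[of x] 1 mult_pos_pos[of C "h x powr (- n)"] pos[of x] by (intro exI[of _ "C * h x powr (- n)"]) simp
      then have "y 0 < y X" by (intro DERIV_pos_imp_increasing[OF h(3)])
      then show False using yX by simp
    next
      case 2
      have "\<exists>z. (y has_real_derivative z) (at x) \<and> z < 0" for x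
        using yd[of x] 2 mult_neg_pos[of C "h x powr (- n)"] pos[of x] by (intro exI[of _ "C * h x powr (- n)"]) simp
      then have "y X < y 0" by (intro DERIV_neg_imp_decreasing[OF h(3)])
      then show False using yX by simp
    qed
  qed
  then have yc: "y x = y 0" for x by (intro DERIV_isconst_all) (use yd in simp)
  define D where "D = y 0"
  have h2: "h2 x = D - B / q * h x powr q" for x using yc[of x] by (simp add: y_def D_def)
  have "D > 0"
  proof (rule ccontr)
    assume "\<not> D > 0"
    moreover have "B / q * h x powr q > 0" for x using pos[of x] B q by simp
    ultimately have neg: "h2 x < 0" for x using h2[of x] by (smt (verit))
    have "h1 X < h1 0" by (rule DERIV_neg_imp_decreasing[OF h(3)]) (use d(2) neg in blast)
    then show False using p1[unfolded periodic_def, rule_format, of 0] by simp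
  qed
  then show ?thesis using that[of D] d(1,2) h2 unfolding h1_def by simp
qed

definition wave_number :: "real \<Rightarrow> real \<Rightarrow> real \<Rightarrow> real" where
  "wave_number q X r = exponent.per q r / X"

text \<open>A steady state has the form \<open>c * k (b * (x - x0))\<close>, and matching powers in
  the equation forces \<open>B * c powr (q - 1) = b^2\<close>.\<close>

definition height :: "real \<Rightarrow> real \<Rightarrow> real \<Rightarrow> real \<Rightarrow> real" where
  "height B q X r = ((wave_number q X r)\<^sup>2 / B) powr (1 / (q - 1))"

text \<open>With its minimum moved to 0 and scaled to the normalised equation, the state is
  determined by its minimum value, which must lie below the equilibrium. Comparing least periods
  then fixes the wave number.\<close>

lemma steady_state_classification:
  assumes B: "B > 0" and qmn: "q = m - n + 1" "1 < q" "q < 2" and h: "pos_periodic_steady_state m n B h"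
    and nc: "\<not> h constant_on UNIV" and lp: "is_least_period h X"
  obtains r x0 where "orbit q r" "\<And>x. h x = height B q X r * orbit.k q r (wave_number q X r * (x - x0))"
proof -
  interpret exponent q by unfold_locales (use qmn in auto)
  have X: "X > 0" and perh: "periodic X h" using lp unfolding is_least_period_def by auto
  have pos: "h x > 0" for x using h unfolding pos_periodic_steady_state_def by auto
  obtain D where D: "D > 0" "\<And>x. (h has_real_derivative deriv h x) (at x)"
    "\<And>x. (deriv h has_real_derivative D - B / q * h x powr q) (at x)"
    using steady_state_second_order[OF B qmn(1,2) h perh X] by metis
  have "continuous_on UNIV h" using DERIV_isCont[OF D(2)] by (auto intro: continuous_at_imp_continuous_on)
  then obtain x0 where x0: "\<And>x. h x0 \<le> h x" using periodic_bounds[OF X perh] by metis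
  have "deriv h x0 = 0" by (rule DERIV_local_min[OF D(2), of 1]) (use x0 in auto)
  \<comment> \<open>\<open>c\<close> is the constant solution of the second-order equation, and
    \<open>b\<close> rescales the variable so that the equation becomes the normalised one.\<close>
  define c where "c = (q * D / B) powr (1 / q)"
  define b where "b = sqrt (q * D / c)"
  have c: "c > 0" "B * c powr q = q * D" using D(1) B q by (simp_all add: c_def powr_powr)
  have b: "b > 0" "b\<^sup>2 * c = q * D" using c D(1) q by (simp_all add: b_def)
  define k where "k x = h (x0 + x / b) / c" for x
  define k' where "k' x = deriv h (x0 + x / b) / (b * c)" for x
  have kd: "(k has_real_derivative k' x) (at x)" for x
  proof -
    have "((\<lambda>x. h (x0 + x / b)) has_real_derivative deriv h (x0 + x / b) * (1 / b)) (at x)"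
      by (rule DERIV_chain2[OF D(2)]) (use b in \<open>auto intro!: derivative_eq_intros\<close>)
    from DERIV_cdivide[OF this, of c] show ?thesis unfolding k_def[abs_def] k'_def by simp
  qed
  have kdd: "(k' has_real_derivative - f (k x)) (at x)" for x
  proof -
    have "((\<lambda>x. deriv h (x0 + x / b)) has_real_derivative (D - B / q * h (x0 + x / b) powr q) * (1 / b)) (at x)"
      by (rule DERIV_chain2[OF D(3)]) (use b in \<open>auto intro!: derivative_eq_intros\<close>)
    from DERIV_cdivide[OF this, of "b * c"]
    have "(k' has_real_derivative (D - B / q * h (x0 + x / b) powr q) / (b\<^sup>2 * c)) (at x)"
      unfolding k'_def[abs_def] by (simp add: power2_eq_square mult.assoc)
    moreover have "h (x0 + x / b) powr q = c powr q * k x powr q"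
      using c(1) pos[of "x0 + x / b"] by (simp add: k_def flip: powr_mult)
    moreover have "(D - B / q * (c powr q * z)) / (q * D) = - ((z - 1) / q)" for z
    proof -
      have "B / q * (c powr q * z) = D * z" using c(2) q by (simp add: field_simps)
      then show ?thesis using D(1) q by (simp add: field_simps)
    qed
    ultimately show ?thesis unfolding f_def b(2) by simp
  qed
  have kpos: "k x > 0" for x using pos c by (simp add: k_def)
  have bX: "b * X > 0" using b X by simp
  have perk: "periodic (b * X) k" unfolding periodic_def k_def
  proof
    fix x
    have "x0 + (x + b * X) / b = (x0 + x / b) + X" using b by (simp add: field_simps)
    then show "h (x0 + (x + b * X) / b) / c = h (x0 + x / b) / c"
      using perh[unfolded periodic_def, rule_format, of "x0 + x / b"] by (simp only:)
  qed
  have hk: "h x = c * k (b * (x - x0))" for x using b c by (simp add: k_def)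
  have k'0: "k' 0 = 0" by (simp add: k'_def \<open>deriv h x0 = 0\<close>)
  have kmin: "k 0 \<le> k x" for x using x0 c by (simp add: k_def divide_right_mono)
  \<comment> \<open>Otherwise the force is nonnegative throughout, so \<open>k'\<close> is monotone;
    being periodic and zero at 0 it vanishes, and \<open>h\<close> would be constant.\<close>
  have "k 0 < 1"
  proof (rule ccontr)
    assume "\<not> k 0 < 1"
    then have f_nonneg: "f (k x) \<ge> 0" for x using kmin[of x] q by (simp add: f_def ge_one_powr_ge_zero)
    have mono: "k' y \<le> k' x" if "x \<le> y" for x y
    proof (rule DERIV_nonpos_imp_nonincreasing[OF that])
      show "\<exists>y. (k' has_real_derivative y) (at x) \<and> y \<le> 0" for x
        using kdd[of x] f_nonneg[of x] by (intro exI[of _ "- f (k x)"]) simp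
    qed
    have perk': "periodic (b * X) k'" by (rule periodic_derivative[OF perk kd])
    have "k' x = 0" for x
    proof -
      obtain j :: int where j: "0 \<le> x + of_int j * (b * X)" "x + of_int j * (b * X) < 0 + b * X"
        using periodic_representative[OF bX] by blast
      have "k' (b * X) = 0" using perk'[unfolded periodic_def, rule_format, of 0] k'0 by simp
      then have "k' (x + of_int j * (b * X)) = 0" using mono[OF j(1)] mono[of "x + of_int j * (b * X)" "b * X"] j(2) k'0 by simp
      then show ?thesis using periodic_int[OF perk'] by simp
    qed
    then have "k x = k 0" for x by (intro DERIV_isconst_all) (use kd in metis)
    then have "h x = c * k 0" for x using hk by simp
    then show False using nc unfolding constant_on_def by blast
  qed
  then have \<alpha>: "0 < k 0" "k 0 < 1" using kpos by auto
  define r where "r = - g (k 0)"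
  interpret o: orbit q r unfolding r_def by (rule orbit_of_minimum[OF \<alpha>])
  have ko: "k = o.k" unfolding r_def by (rule orbit_unique[OF \<alpha> kd kdd kpos perk bX refl k'0])
  \<comment> \<open>Each least period yields a period of the other function, so both inequalities
    hold.\<close>
  have "per r \<le> b * X" by (rule o.least_period[OF bX]) (use perk ko in simp)
  moreover have "X \<le> per r / b"
  proof -
    have "periodic (per r / b) h" unfolding periodic_def hk ko
    proof
      fix x
      have "b * (x + per r / b - x0) = b * (x - x0) + per r" using b by (simp add: field_simps)
      then show "c * o.k (b * (x + per r / b - x0)) = c * o.k (b * (x - x0))"
        using o.k_periodic unfolding periodic_def by simp
    qed
    moreover have "per r / b > 0" using per_pos[OF o.r_abs] b by simp
    ultimately show ?thesis using lp unfolding is_least_period_def by blast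
  qed
  ultimately have "b * X = per r" using b by (simp add: field_simps)
  then have bw: "b = wave_number q X r" using X by (simp add: wave_number_def field_simps)
  have "b\<^sup>2 / B = c powr (q - 1)"
  proof -
    have "b\<^sup>2 * c = B * (c powr (q - 1) * c)" using b c powr_add[of c "q - 1" 1] by simp
    then show ?thesis using c B by (simp add: field_simps)
  qed
  then have ch: "c = height B q X r" unfolding height_def bw[symmetric] using c q by (simp add: powr_powr)
  have "orbit q r" unfolding r_def by (rule orbit_of_minimum[OF \<alpha>])
  moreover have "h x = height B q X r * o.k (wave_number q X r * (x - x0))" for x
    using hk[of x] unfolding ko ch bw .
  ultimately show ?thesis by (rule that)
qed

section \<open>Rescaling to a fixed period\<close>

locale scale = exponent +
  fixes B X :: real
  assumes B: "B > 0" and X: "X > 0"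
begin

definition "bb r = wave_number q X r"
definition "cc r = height B q X r"
definition "mass r = cc r / bb r * area r"
definition "mass' r = cc r / bb r * ((3 - q) / (q - 1) * (per' r / per r) * area r + area' r)"
text \<open>The energy of the rescaled orbit for the pure power potential, without the affine part
  of \<open>H\<close>.\<close>

definition "free_energy r = (cc r)\<^sup>2 * bb r * (action r / 2 - (q * action r + area r) / (q * (q + 1)))"

lemma bb_eq: "bb r = per r / X"
  by (simp add: bb_def wave_number_def)

lemma bb_pos: "\<bar>r\<bar> < rmax \<Longrightarrow> bb r > 0"
  using per_pos X by (simp add: bb_eq)

lemma cc_pos: "\<bar>r\<bar> < rmax \<Longrightarrow> cc r > 0"
  using bb_pos[of r] B by (simp add: cc_def height_def bb_def)

lemma cc_powr: "\<bar>r\<bar> < rmax \<Longrightarrow> B * cc r powr (q - 1) = (bb r)\<^sup>2"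
  using B q by (simp add: cc_def height_def bb_def powr_powr)

lemma cc_powr_q: "\<bar>r\<bar> < rmax \<Longrightarrow> B * cc r powr q = cc r * (bb r)\<^sup>2"
  using cc_powr[of r] cc_pos[of r] powr_add[of "cc r" "q - 1" 1] by simp

lemma mass_pos: "\<bar>r\<bar> < rmax \<Longrightarrow> mass r > 0"
  using bb_pos[of r] cc_pos[of r] area_pos[of r] by (simp add: mass_def)

lemma bb_deriv: "\<bar>r\<bar> < rmax \<Longrightarrow> (bb has_real_derivative bb r * (per' r / per r)) (at r)"
proof -
  assume r: "\<bar>r\<bar> < rmax"
  have "bb = (\<lambda>r. per r / X)" by (simp add: fun_eq_iff bb_eq)
  moreover have "per' r / X = bb r * (per' r / per r)" using per_pos[OF r] by (simp add: bb_eq)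
  ultimately show ?thesis using DERIV_cdivide[OF per_deriv[OF r], of X] by simp
qed

lemma cc_deriv: "\<bar>r\<bar> < rmax \<Longrightarrow> (cc has_real_derivative cc r * (2 / (q - 1) * (per' r / per r))) (at r)"
proof -
  assume r: "\<bar>r\<bar> < rmax"
  let ?y = "\<lambda>r. (bb r)\<^sup>2 / B"
  have y0: "?y r > 0" using bb_pos[OF r] B by simp
  have "((\<lambda>r. (bb r)\<^sup>2) has_real_derivative 2 * bb r * (bb r * (per' r / per r))) (at r)"
    by (auto intro!: derivative_eq_intros bb_deriv[OF r])
  from DERIV_cdivide[OF this, of B]
  have "(?y has_real_derivative 2 * (per' r / per r) * ?y r) (at r)" by (simp add: power2_eq_square mult_ac)
  from DERIV_fun_powr[OF this y0, of "1 / (q - 1)"]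
  have "((\<lambda>r. ?y r powr (1 / (q - 1))) has_real_derivative
     1 / (q - 1) * ?y r powr (1 / (q - 1) - 1) * (2 * (per' r / per r) * ?y r)) (at r)" by simp
  moreover have "Y powr (a - 1) * Y = Y powr a" if "Y > 0" for Y a :: real
    using that powr_add[of Y "a - 1" 1] by simp
  from this[OF y0] have "1 / (q - 1) * ?y r powr (1 / (q - 1) - 1) * (2 * (per' r / per r) * ?y r) = ?y r powr (1 / (q - 1)) * (2 / (q - 1) * (per' r / per r))"
    by (metis (no_types, opaque_lifting) mult.assoc mult.commute mult.left_commute times_divide_eq_left mult_1)
  moreover have "cc = (\<lambda>r. ?y r powr (1 / (q - 1)))" by (simp add: fun_eq_iff cc_def height_def bb_def)
  ultimately show ?thesis by simp
qed

lemma mass_deriv: "\<bar>r\<bar> < rmax \<Longrightarrow> (mass has_real_derivative mass' r) (at r)"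
proof -
  assume r: "\<bar>r\<bar> < rmax"
  define p where "p = per' r / per r"
  have b: "bb r \<noteq> 0" using bb_pos[OF r] by simp
  note cb = DERIV_divide[OF cc_deriv[OF r, folded p_def] bb_deriv[OF r, folded p_def] b]
  have "(c * (2 / (q - 1) * p) * y - c * (y * p)) / (y * y) = c / y * ((3 - q) / (q - 1) * p)" if "y \<noteq> 0" for c y :: real
    using that q by (simp add: divide_simps) (simp add: algebra_simps)
  note cb' = DERIV_cong[OF cb this[OF b, of "cc r"]]
  have "z * s * a + a' * z = z * (s * a + a')" for z s a a' :: real by (simp add: algebra_simps)
  from DERIV_cong[OF DERIV_mult[OF cb' area_deriv[OF r]] this]
  show ?thesis unfolding mass'_def p_def[symmetric] mass_def[abs_def] .
qed

text \<open>The algebraic core of the relation between the derivatives of energy and mass, with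
  common factors removed; \<open>e\<close> stands for \<open>r^2 / 2 - 1 / (q + 1)\<close>.\<close>

lemma energy_identity:
  fixes A A' P p J e :: real
  assumes A: "A = (q + 3) / 2 * J - (q + 1) * (e * P)" and A': "A' = - (q - 1) / 2 * r * P - (q + 1) * (e * (p * P))"
  shows "(q + 3) / (q - 1) * p * (J / 2 - (q * J + A) / (q * (q + 1))) + (r * P / 2 - (q * (r * P) + A') / (q * (q + 1)))
     = - (1 / q) * ((3 - q) / (q - 1) * p * A + A')"
proof -
  have ne: "q \<noteq> 0" "q - 1 \<noteq> 0" "q + 1 \<noteq> 0" using q by auto
  \<comment> \<open>Naming the reciprocals turns the claim into a polynomial identity modulo three
    relations.\<close>
  define i j k where "i = 1 / q" and "j = 1 / (q - 1)" and "k = 1 / (q + 1)"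
  have ij: "q * i = 1" "(q - 1) * j = 1" "(q + 1) * k = 1" using ne by (simp_all add: i_def j_def k_def)
  have "(q + 3) * j * p * (J / 2 - (q * J + A) * (i * k)) + (r * P / 2 - (q * (r * P) + A') * (i * k)) = - i * ((3 - q) * j * p * A + A')"
    using ij A A' by algebra
  moreover have "x / (q * (q + 1)) = x * (i * k)" "x / (q - 1) = x * j" for x by (simp_all add: i_def j_def k_def)
  ultimately show ?thesis by (simp add: i_def)
qed

text \<open>Steady states are critical at fixed mass, so along the family the energy changes by
  minus the multiplier times the change of mass. This is verified here by differentiation, the
  virial identity closing the computation.\<close>

lemma free_energy_deriv: "\<bar>r\<bar> < rmax \<Longrightarrow> (free_energy has_real_derivative - (cc r * (bb r)\<^sup>2 / q) * mass' r) (at r)"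
proof -
  assume r: "\<bar>r\<bar> < rmax"
  define p where "p = per' r / per r"
  let ?K = "action r / 2 - (q * action r + area r) / (q * (q + 1))"
  let ?K' = "r * per r / 2 - (q * (r * per r) + area' r) / (q * (q + 1))"
  have K: "((\<lambda>r. action r / 2 - (q * action r + area r) / (q * (q + 1))) has_real_derivative ?K') (at r)"
    by (rule DERIV_diff[OF DERIV_cdivide[OF action_deriv[OF r]]
          DERIV_cdivide[OF DERIV_add[OF DERIV_cmult[OF action_deriv[OF r]] area_deriv[OF r]]]])
  have c2: "((\<lambda>r. (cc r)\<^sup>2) has_real_derivative 2 * cc r * (cc r * (2 / (q - 1) * p))) (at r)"
    using DERIV_power[OF cc_deriv[OF r, folded p_def], of 2] by (simp add: mult_ac)
  have "(free_energy has_real_derivative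
     (2 * cc r * (cc r * (2 / (q - 1) * p)) * bb r + bb r * p * (cc r)\<^sup>2) * ?K + ?K' * ((cc r)\<^sup>2 * bb r)) (at r)"
    unfolding free_energy_def[abs_def] by (rule DERIV_mult[OF DERIV_mult[OF c2 bb_deriv[OF r, folded p_def]] K])
  moreover have "(2 * c * (c * (2 / (q - 1) * p)) * b + b * p * c\<^sup>2) * K + K' * (c\<^sup>2 * b) = c\<^sup>2 * b * ((q + 3) / (q - 1) * p * K + K')" for c b K K'
  proof -
    have "(q + 3) / (q - 1) = 4 / (q - 1) + 1" using q by (simp add: field_simps)
    then show ?thesis by (simp add: power2_eq_square algebra_simps)
  qed
  note this[of "cc r" "bb r" ?K ?K']
  moreover have "(q + 3) / (q - 1) * p * ?K + ?K' = - (1 / q) * ((3 - q) / (q - 1) * p * area r + area' r)"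
    by (rule energy_identity[OF virial_identity[OF r]])
       (use area'_eq[OF r] per_pos[OF r] in \<open>simp add: p_def\<close>)
  moreover have "c\<^sup>2 * b * (- (1 / q) * z) = - (c * b\<^sup>2 / q) * (c / b * z)" if "b \<noteq> 0" for c b z :: real
    using that q by (simp add: power2_eq_square)
  note this[of "bb r" "cc r" "(3 - q) / (q - 1) * p * area r + area' r"]
  ultimately show ?thesis using bb_pos[OF r] unfolding mass'_def p_def[symmetric] by simp
qed

text \<open>The last factor is the integral of \<open>w\<close>, since \<open>w\<close> is a
  multiple of the tangent to the family at fixed period; the other factors are positive.\<close>

lemma mass'_sign:
  assumes r: "0 < r" "r < rmax"
  shows "mass' r = cc r / bb r * (2 * per' r / (per r * (q - 1))) * ((3 - q) / 2 * area r + (q - 1) / 2 * per r * area' r / per' r)"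
proof -
  have ne: "per r \<noteq> 0" "per' r \<noteq> 0" "q - 1 \<noteq> 0" using per_pos[of r] per'_pos[OF r] r q by auto
  have "(3 - q) / (q - 1) * (d / p) * a + a' = 2 * d / (p * (q - 1)) * ((3 - q) / 2 * a + (q - 1) / 2 * p * a' / d)"
    if "p \<noteq> 0" "d \<noteq> 0" for p d a a' :: real
    using that ne(3) by (simp add: divide_simps)
  then show ?thesis unfolding mass'_def using ne by (simp add: mult.assoc)
qed

text \<open>With the height eliminated, the exponents \<open>3 - q\<close> and \<open>q - 1\<close>
  are exactly those for which the period enters through a constant factor only.\<close>

lemma mass_powr:
  assumes r: "\<bar>r\<bar> < rmax"
  shows "per r powr (3 - q) * area r powr (q - 1) = B * X powr (3 - q) * mass r powr (q - 1)"
proof -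
  have pos: "cc r > 0" "bb r > 0" "area r > 0" using cc_pos bb_pos area_pos r by auto
  have "mass r powr (q - 1) = cc r powr (q - 1) / bb r powr (q - 1) * area r powr (q - 1)"
    using pos by (simp add: mass_def powr_mult powr_divide)
  then have "B * mass r powr (q - 1) = (bb r)\<^sup>2 / bb r powr (q - 1) * area r powr (q - 1)"
    using cc_powr[OF r] by simp
  also have "(bb r)\<^sup>2 / bb r powr (q - 1) = bb r powr (3 - q)"
    using pos powr_diff[of "bb r" 2 "q - 1"] by simp
  finally have "B * mass r powr (q - 1) = bb r powr (3 - q) * area r powr (q - 1)" .
  moreover have "per r powr (3 - q) = X powr (3 - q) * bb r powr (3 - q)"
    using X per_pos[OF r] by (simp add: bb_eq flip: powr_mult)
  ultimately show ?thesis by (simp add: mult_ac)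
qed

lemma profile_E_eq:
  assumes "0 < \<alpha>" "\<alpha> < 1"
  shows "profile_E q \<alpha> = B * X powr (3 - q) * mass (- g \<alpha>) powr (q - 1)"
proof -
  have "\<bar>- g \<alpha>\<bar> < rmax" using g_neg[OF assms] g_gt[OF assms(1)] by simp
  then show ?thesis unfolding profile_E_def profile_period_eq[OF assms] profile_area_eq[OF assms] by (rule mass_powr)
qed

text \<open>The amplitude is \<open>- g \<alpha>\<close> and decreases in \<alpha> at the rate
  \<open>f \<alpha> / g \<alpha> > 0\<close>, hence the minus sign.\<close>

lemma profile_E_deriv:
  assumes \<alpha>: "0 < \<alpha>" "\<alpha> < 1" and D: "(profile_E q has_real_derivative D) (at \<alpha>)"
  obtains K where "K > 0" "D = - K * mass' (- g \<alpha>)"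
proof -
  have r: "\<bar>- g \<alpha>\<bar> < rmax" using g_neg[OF \<alpha>] g_gt[OF \<alpha>(1)] by simp
  have "((\<lambda>\<alpha>. mass (- g \<alpha>)) has_real_derivative mass' (- g \<alpha>) * - (f \<alpha> / g \<alpha>)) (at \<alpha>)"
    by (rule DERIV_chain2[where f = mass and g = "\<lambda>\<alpha>. - g \<alpha>", OF mass_deriv[OF r] DERIV_minus])
       (use g_deriv[OF \<alpha>(1)] \<alpha> in simp)
  from DERIV_cmult[OF DERIV_fun_powr[OF this mass_pos[OF r], of "q - 1"], of "B * X powr (3 - q)"]
  have d: "((\<lambda>\<alpha>. B * X powr (3 - q) * mass (- g \<alpha>) powr (q - 1)) has_real_derivative
     B * X powr (3 - q) * ((q - 1) * mass (- g \<alpha>) powr (q - 1 - 1) * (mass' (- g \<alpha>) * - (f \<alpha> / g \<alpha>)))) (at \<alpha>)" by simp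
  have "\<forall>\<^sub>F x in nhds \<alpha>. x \<in> {0<..<1}" by (rule eventually_nhds_in_open) (use \<alpha> in auto)
  then have "\<forall>\<^sub>F x in nhds \<alpha>. B * X powr (3 - q) * mass (- g x) powr (q - 1) = profile_E q x"
    by eventually_elim (simp add: profile_E_eq)
  then have "(profile_E q has_real_derivative
     B * X powr (3 - q) * ((q - 1) * mass (- g \<alpha>) powr (q - 1 - 1) * (mass' (- g \<alpha>) * - (f \<alpha> / g \<alpha>)))) (at \<alpha>)"
    using d DERIV_cong_ev[OF refl] by fast
  from DERIV_unique[OF D this]
  have "D = - (B * X powr (3 - q) * ((q - 1) * mass (- g \<alpha>) powr (q - 1 - 1)) * (f \<alpha> / g \<alpha>)) * mass' (- g \<alpha>)" by simp
  moreover have "B * X powr (3 - q) * ((q - 1) * mass (- g \<alpha>) powr (q - 1 - 1)) * (f \<alpha> / g \<alpha>) > 0"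
    using B X q mass_pos[OF r] divide_neg_neg[OF f_neg[OF \<alpha>] g_neg[OF \<alpha>]] by (intro mult_pos_pos) auto
  ultimately show ?thesis using that by blast
qed

text \<open>\<open>?\<Psi>\<close> is the energy of the state minus that of the constant of equal
  mass, and vanishes at amplitude 0. Its derivative is \<open>mass'\<close> times a factor that is
  negative because the mean \<open>mass / X\<close> lies below \<open>cc\<close>.\<close>

lemma constant_comparison:
  assumes r: "0 < r" "r < rmax" and neg: "\<And>s. 0 < s \<Longrightarrow> s < r \<Longrightarrow> mass' s < 0"
  shows "free_energy r + X * power_potential B q (mass r / X) > 0"
proof -
  let ?\<Psi> = "\<lambda>r. free_energy r + X * power_potential B q (mass r / X)"
  have d: "(?\<Psi> has_real_derivative B / q * mass' s * ((mass s / X) powr q - cc s powr q)) (at s)" if s: "\<bar>s\<bar> < rmax" for s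
  proof -
    have m: "mass s / X > 0" using mass_pos[OF s] X by simp
    have "((\<lambda>r. power_potential B q (mass r / X)) has_real_derivative B * (mass s / X) powr q / q * (mass' s / X)) (at s)"
      by (rule DERIV_chain2[OF power_potential_derivs(1)[OF m q(1)] DERIV_cdivide[OF mass_deriv[OF s]]])
    from DERIV_add[OF free_energy_deriv[OF s] DERIV_cmult[OF this, of X]]
    have "(?\<Psi> has_real_derivative - (cc s * (bb s)\<^sup>2 / q) * mass' s + X * (B * (mass s / X) powr q / q * (mass' s / X))) (at s)" .
    then show ?thesis using X unfolding cc_powr_q[OF s, symmetric] by (simp add: algebra_simps)
  qed
  have "?\<Psi> 0 < ?\<Psi> r"
  proof (rule DERIV_pos_imp_increasing_open[OF r(1)])
    show "continuous_on {0..r} ?\<Psi>"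
      by (intro continuous_at_imp_continuous_on ballI DERIV_isCont[OF d]) (use r in auto)
    fix s assume s: "0 < s" "s < r"
    then have s': "\<bar>s\<bar> < rmax" using r by simp
    have "mass s / X = cc s * (area s / per s)" using X per_pos[OF s'] by (simp add: mass_def bb_eq)
    also have "\<dots> < cc s * 1" using cc_pos[OF s'] area_less_per[of s] per_pos[OF s'] s r by (intro mult_strict_left_mono) auto
    finally have "(mass s / X) powr q < cc s powr q" using mass_pos[OF s'] X q by (intro powr_less_mono2) auto
    then have "B / q * mass' s * ((mass s / X) powr q - cc s powr q) > 0"
      using neg[OF s] B q by (intro mult_neg_neg mult_pos_neg) auto
    then show "\<exists>y. (?\<Psi> has_real_derivative y) (at s) \<and> 0 < y" using d[OF s'] by blast
  qed
  moreover have "?\<Psi> 0 = 0"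
  proof -
    have z: "\<bar>0\<bar> < rmax" using rmax_pos by simp
    have a: "area 0 = per 0" "action 0 = 0" by (simp_all add: area_def per_def action_def \<gamma>_0)
    have m: "mass 0 / X = cc 0" using X per_pos[OF z] by (simp add: mass_def bb_eq a)
    have "B * cc 0 powr (q + 1) = B * cc 0 powr q * cc 0" using cc_pos[OF z] by (simp add: powr_add)
    also have "\<dots> = (cc 0)\<^sup>2 * (bb 0)\<^sup>2" unfolding cc_powr_q[OF z] by (simp add: power2_eq_square)
    finally have "X * power_potential B q (mass 0 / X) = (cc 0)\<^sup>2 * bb 0 * (bb 0 * X) / (q * (q + 1))"
      unfolding m power_potential_def by (simp add: power2_eq_square)
    moreover have "bb 0 * X = per 0" using X by (simp add: bb_eq)
    ultimately show ?thesis unfolding free_energy_def a by simp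
  qed
  ultimately show ?thesis by simp
qed

text \<open>Adding \<open>D rc\<close> times the mass gives a function with derivative
  \<open>(D rc - D s) * mass' s\<close>. Both factors change sign at \<open>rc\<close>, so it
  decreases across the whole interval; at equal masses the added terms agree. \<open>D\<close>
  increases because the period does.\<close>

lemma free_energy_less:
  assumes r: "0 < r2" "r2 < rc" "rc < r1" "r1 < rmax" and m: "mass r1 = mass r2"
    and neg: "\<And>s. r2 < s \<Longrightarrow> s < rc \<Longrightarrow> mass' s < 0" and pos: "\<And>s. rc < s \<Longrightarrow> s < r1 \<Longrightarrow> mass' s > 0"
  shows "free_energy r1 < free_energy r2"
proof -
  define D where "D s = cc s * (bb s)\<^sup>2 / q" for s
  have D_less: "D s < D t" if "0 < s" "s < t" "t < rmax" for s t
  proof -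
    have "per s < per t"
    proof (rule DERIV_pos_imp_increasing[OF that(2)])
      fix x assume "s \<le> x" "x \<le> t"
      then show "\<exists>y. (per has_real_derivative y) (at x) \<and> 0 < y"
        using per_deriv[of x] per'_pos[of x] that by (intro exI[of _ "per' x"]) auto
    qed
    then have b: "bb s < bb t" "bb s > 0" using X bb_pos[of s] that by (auto simp: bb_eq divide_strict_right_mono)
    then have b2: "(bb s)\<^sup>2 < (bb t)\<^sup>2" by (intro power_strict_mono) auto
    then have "cc s < cc t" unfolding cc_def height_def bb_def[symmetric]
      using B q by (intro powr_less_mono2 divide_strict_right_mono) auto
    then have "cc s * (bb s)\<^sup>2 < cc t * (bb t)\<^sup>2"
      using b2 cc_pos[of s] that by (intro mult_strict_mono) auto
    then show ?thesis unfolding D_def using q by (simp add: divide_strict_right_mono)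
  qed
  let ?\<Phi> = "\<lambda>s. free_energy s + D rc * mass s"
  have d: "(?\<Phi> has_real_derivative (D rc - D s) * mass' s) (at s)" if "\<bar>s\<bar> < rmax" for s
    using DERIV_add[OF free_energy_deriv[OF that] DERIV_cmult[OF mass_deriv[OF that], of "D rc"]]
    unfolding D_def[symmetric] by (simp add: algebra_simps)
  have cont: "continuous_on {s..t} ?\<Phi>" if "0 < s" "t < rmax" for s t
    by (intro continuous_at_imp_continuous_on ballI DERIV_isCont[OF d]) (use that in auto)
  have "?\<Phi> rc < ?\<Phi> r2"
  proof (rule DERIV_neg_imp_decreasing_open[OF r(2)])
    fix s assume s: "r2 < s" "s < rc"
    have "(D rc - D s) * mass' s < 0" using D_less[of s rc] neg[OF s] s r by (intro mult_pos_neg) auto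
    then show "\<exists>y. (?\<Phi> has_real_derivative y) (at s) \<and> y < 0" using d[of s] s r by fastforce
  qed (use cont r in auto)
  moreover have "?\<Phi> r1 < ?\<Phi> rc"
  proof (rule DERIV_neg_imp_decreasing_open[OF r(3)])
    fix s assume s: "rc < s" "s < r1"
    have "(D rc - D s) * mass' s < 0" using D_less[of rc s] pos[OF s] s r by (intro mult_neg_pos) auto
    then show "\<exists>y. (?\<Phi> has_real_derivative y) (at s) \<and> y < 0" using d[of s] s r by fastforce
  qed (use cont r in auto)
  ultimately show ?thesis using m by simp
qed

end

section \<open>Rescaled orbits as steady states on the circle\<close>

locale scaled_orbit = scale q B X + orbit q r for q B X r +
  fixes x0 :: real
begin

abbreviation "b \<equiv> bb r"
abbreviation "c \<equiv> cc r"

definition "h x = c * k (b * (x - x0))"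
definition "hx x = c * b * kd (b * (x - x0))"

lemma b_pos: "b > 0" and c_pos: "c > 0"
  using bb_pos cc_pos r_abs by auto

lemma scaled_deriv:
  assumes "\<And>x. (F has_real_derivative F' x) (at x)"
  shows "((\<lambda>x. F (b * (x - x0))) has_real_derivative b * F' (b * (x - x0))) (at x)"
proof -
  have "((\<lambda>x. b * (x - x0)) has_real_derivative b) (at x)" by (auto intro!: derivative_eq_intros)
  from DERIV_chain2[OF assms this] show ?thesis by (simp add: mult.commute)
qed

lemma scaled_periodic: "periodic (per r) F \<Longrightarrow> periodic X (\<lambda>x. F (b * (x - x0)))"
  unfolding periodic_def
proof
  fix x assume F: "\<forall>x. F (x + per r) = F x"
  have "b * (x + X - x0) = b * (x - x0) + per r" using X by (simp add: bb_eq field_simps)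
  then show "F (b * (x + X - x0)) = F (b * (x - x0))" using F by simp
qed

lemma scaled_integral:
  assumes "(F has_integral I) {0..per r}" "periodic (per r) F"
  shows "((\<lambda>x. F (b * (x - x0))) has_integral I / b) {0..X}"
proof -
  have "((\<lambda>x. F (b * x)) has_integral I / b) {0..X}"
  proof -
    have e: "inverse b * per r = X" using per_pos[OF r_abs] X by (simp add: bb_eq)
    show ?thesis using has_integral_affinity'[of F I 0 "per r" b 0] assms(1) b_pos e
      by (simp add: cbox_interval divide_inverse mult.commute)
  qed
  moreover have "periodic X (\<lambda>x. F (b * x))"
    unfolding periodic_def
  proof
    fix x
    have "b * (x + X) = b * x + per r" using X by (simp add: bb_eq field_simps)
    then show "F (b * (x + X)) = F (b * x)" using assms(2) by (simp add: periodic_def)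
  qed
  ultimately have "((\<lambda>x. F (b * x)) has_integral I / b) {- x0..- x0 + X}" using periodic_has_integral_shift[OF X] by blast
  from has_integral_translate[OF this, of "- x0"] show ?thesis by simp
qed

lemma steady_state:
  assumes "energy_potential B q H"
  shows "circle_steady_state B q (c * b\<^sup>2 / q) X H h hx"
proof
  show "periodic X h" using scaled_periodic[OF k_periodic] by (simp add: periodic_def h_def)
  show "h x > 0" for x using c_pos k_pos by (simp add: h_def)
  show "(h has_real_derivative hx x) (at x)" for x
    unfolding h_def[abs_def] hx_def using DERIV_cmult[OF scaled_deriv[OF k_deriv], of c] by (simp add: mult.assoc)
  show "(hx has_real_derivative c * b\<^sup>2 / q - B / q * h x powr q) (at x)" for x
  proof -
    have d: "(hx has_real_derivative c * b * (b * - f (k (b * (x - x0))))) (at x)"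
      unfolding hx_def[abs_def] by (rule DERIV_cmult[OF scaled_deriv[OF kd_deriv]])
    have e1: "B / q * h x powr q = c * b\<^sup>2 / q * k (b * (x - x0)) powr q"
      using cc_powr_q[OF r_abs] c_pos k_pos[of "b * (x - x0)"] by (simp add: h_def powr_mult)
    have e2: "y * v * (v * - ((P - 1) / q)) = y * v\<^sup>2 / q - y * v\<^sup>2 / q * P" for y v P
      by (simp add: power2_eq_square diff_divide_distrib algebra_simps)
    show ?thesis using d unfolding f_def e1 e2 .
  qed
qed (use B X q assms in auto)

lemma coefficient: "B * h x powr (q - 1) = b\<^sup>2 * k (b * (x - x0)) powr (q - 1)"
  using cc_powr[OF r_abs] c_pos k_pos[of "b * (x - x0)"] by (simp add: h_def powr_mult mult.assoc[symmetric])

lemma scaled_second_deriv: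
  assumes "\<And>x. (F' has_real_derivative d - k x powr (q - 1) * F x) (at x)"
  shows "((\<lambda>x. b * F' (b * (x - x0))) has_real_derivative b\<^sup>2 * d - B * h x powr (q - 1) * F (b * (x - x0))) (at x)"
  using DERIV_cmult[OF scaled_deriv[OF assms], of b x] unfolding coefficient
  by (simp add: power2_eq_square algebra_simps)

lemma integral_h: "(h has_integral mass r) {0..X}"
  unfolding h_def[abs_def] mass_def
  using has_integral_mult_right[OF scaled_integral[OF integral_k k_periodic], of c] by simp

text \<open>The integral of \<open>w\<close> over one period before rescaling.\<close>

definition "W = (3 - q) / 2 * area r + (q - 1) / 2 * per r * area' r / per' r"
definition "ww x = w (b * (x - x0))"
definition "wwd x = b * wd (b * (x - x0))"

lemma ww_deriv: "(ww has_real_derivative wwd x) (at x)"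
  unfolding ww_def[abs_def] wwd_def by (rule scaled_deriv[OF w_deriv])

lemma wwd_deriv: "(wwd has_real_derivative b\<^sup>2 - B * h x powr (q - 1) * ww x) (at x)"
  using scaled_second_deriv[OF wd_deriv, of x] unfolding ww_def wwd_def[abs_def] by simp

lemma ww_periodic: "periodic X ww"
  unfolding ww_def[abs_def] by (rule scaled_periodic[OF w_periodic])

lemma integral_ww: "(ww has_integral W / b) {0..X}"
  unfolding ww_def[abs_def] W_def by (rule scaled_integral[OF integral_w w_periodic])

lemma stable:
  assumes H: "energy_potential B q H" and W: "W > 0"
  shows "energy_stable H X h"
proof -
  interpret s: circle_steady_state B q "c * b\<^sup>2 / q" X H h hx by (rule steady_state[OF H])
  obtain y z where yz: "y \<le> z" "z \<le> y + per r" "kd y \<noteq> 0" "\<And>x. x \<in> {y..z} \<Longrightarrow> 0 < V1 x" "\<And>x. x \<in> {z..y + per r} \<Longrightarrow> 0 < p2 x"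
    by (rule conjugate_points) (rule that)
  have bX: "b * X = per r" using X by (simp add: bb_eq)
  have V: "(V1d has_real_derivative 0 - k x powr (q - 1) * V1 x) (at x)" "(p2d has_real_derivative 0 - k x powr (q - 1) * p2 x) (at x)" for x
    using V1d_deriv[of x] p2d_deriv[of x] by simp_all
  show ?thesis
  proof (rule s.energy_stableI[where a = "x0 + y / b" and b = "x0 + z / b" and w = ww and w' = wwd and \<kappa> = "b\<^sup>2" and W = "W / b"
        and ?p1.0 = "\<lambda>x. V1 (b * (x - x0))" and ?p1'.0 = "\<lambda>x. b * V1d (b * (x - x0))"
        and ?p2.0 = "\<lambda>x. p2 (b * (x - x0))" and ?p2'.0 = "\<lambda>x. b * p2d (b * (x - x0))"])
    show "x0 + y / b \<le> x0 + z / b" using yz(1) b_pos by (simp add: divide_right_mono)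
    show "x0 + z / b \<le> x0 + y / b + X" proof -
      have "z / b \<le> (y + per r) / b" using yz(2) b_pos by (intro divide_right_mono) auto
      moreover have "per r / b = X" using per_pos[OF r_abs] X by (simp add: bb_eq)
      ultimately show ?thesis unfolding add_divide_distrib by linarith
    qed
    show "hx (x0 + y / b) \<noteq> 0" using yz(3) b_pos c_pos by (simp add: hx_def)
    show "0 < V1 (b * (x - x0))" if "x \<in> {x0 + y / b..x0 + z / b}" for x
      by (rule yz(4)) (use that b_pos in \<open>auto simp: field_simps\<close>)
    show "0 < p2 (b * (x - x0))" if "x \<in> {x0 + z / b..x0 + y / b + X}" for x
      by (rule yz(5)) (use that b_pos bX in \<open>auto simp: field_simps\<close>)
    show "((\<lambda>x. b * V1d (b * (x - x0))) has_real_derivative - (B * h x powr (q - 1) * V1 (b * (x - x0)))) (at x)" for x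
      using scaled_second_deriv[OF V(1), of x] by simp
    show "((\<lambda>x. b * p2d (b * (x - x0))) has_real_derivative - (B * h x powr (q - 1) * p2 (b * (x - x0)))) (at x)" for x
      using scaled_second_deriv[OF V(2), of x] by simp
  qed (use W b_pos in \<open>auto intro: ww_periodic ww_deriv wwd_deriv integral_ww scaled_deriv V1_deriv p2_deriv\<close>)
qed

text \<open>The destabilising direction is \<open>1 - s w\<close> with \<open>s\<close> chosen so that the mean vanishes; its second variation is
  \<open>- \<integral> B h\<^bsup>q - 1\<^esup> + b\<^sup>3 X\<^sup>2 / W\<close>.\<close>

lemma unstable:
  assumes H: "energy_potential B q H" and W: "W < 0"
  shows "energy_unstable H X h"
proof -
  interpret s: circle_steady_state B q "c * b\<^sup>2 / q" X H h hx by (rule steady_state[OF H])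
  \<comment> \<open>The integral of \<open>ww\<close> is \<open>W / b\<close>, so this factor gives
    \<open>1 - t * ww\<close> mean zero.\<close>
  define t where "t = b * X / W"
  define u where "u x = 1 + (- t) * ww x" for x
  let ?c = "\<lambda>x. B * h x powr (q - 1)"
  have ud: "deriv u = (\<lambda>x. (- t) * wwd x)"
  proof
    fix x show "deriv u x = (- t) * wwd x"
      unfolding u_def[abs_def] by (intro DERIV_imp_deriv) (auto intro!: derivative_eq_intros ww_deriv)
  qed
  have cw: "continuous_on S ww" "continuous_on S wwd" for S
    using DERIV_isCont[OF ww_deriv] DERIV_isCont[OF wwd_deriv] by (auto intro: continuous_at_imp_continuous_on)
  have cc: "continuous_on {0..X} ?c" by (intro continuous_intros s.cont_powr)
  have 1: "((\<lambda>x. b\<^sup>2 - ?c x * ww x) has_integral 0) {0..X}"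
    using has_integral_of_derivative[OF _ wwd_deriv, of 0 X] X periodic_derivative[OF ww_periodic ww_deriv]
    by (simp add: periodic_def) (metis add_0 cancel_comm_monoid_add_class.diff_cancel)
  have 2: "((\<lambda>x. wwd x * wwd x + (b\<^sup>2 - ?c x * ww x) * ww x) has_integral 0) {0..X}"
  proof -
    have "wwd X = wwd 0" "ww X = ww 0"
      using periodic_derivative[OF ww_periodic ww_deriv] ww_periodic unfolding periodic_def by (metis add_0)+
    then show ?thesis
      using has_integral_of_derivative[OF _ DERIV_mult[OF ww_deriv wwd_deriv], of 0 X] X by simp
  qed
  have c: "(?c has_integral integral {0..X} ?c) {0..X}" by (intro integrable_integral integrable_continuous_real cc)
  have k: "((\<lambda>x. b\<^sup>2) has_integral b\<^sup>2 * X) {0..X}" using has_integral_const_real[of "b\<^sup>2" 0 X] X by (simp add: mult.commute)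
  have "((\<lambda>x. - ?c x + 2 * t * (b\<^sup>2 - (b\<^sup>2 - ?c x * ww x)) + t\<^sup>2 * ((wwd x * wwd x + (b\<^sup>2 - ?c x * ww x) * ww x) - b\<^sup>2 * ww x)) has_integral
     - integral {0..X} ?c + 2 * t * (b\<^sup>2 * X - 0) + t\<^sup>2 * (0 - b\<^sup>2 * (W / b))) {0..X}"
    by (intro has_integral_add has_integral_neg has_integral_mult_right has_integral_diff c k 1 2 integral_ww)
  moreover have "- ?c x + 2 * t * (b\<^sup>2 - (b\<^sup>2 - ?c x * ww x)) + t\<^sup>2 * ((wwd x * wwd x + (b\<^sup>2 - ?c x * ww x) * ww x) - b\<^sup>2 * ww x)
     = (deriv u x)\<^sup>2 - ?c x * (u x)\<^sup>2" for x
    unfolding ud u_def by (simp add: power2_eq_square algebra_simps)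
  ultimately have Q: "integral {0..X} (\<lambda>x. (deriv u x)\<^sup>2 - ?c x * (u x)\<^sup>2) =
     - integral {0..X} ?c + 2 * t * (b\<^sup>2 * X - 0) + t\<^sup>2 * (0 - b\<^sup>2 * (W / b))"
    by (simp only: integral_unique)
  have "integral {0..X} ?c \<ge> 0" by (intro integral_nonneg integrable_continuous_real cc) (use B in auto)
  \<comment> \<open>The term linear in \<open>t\<close> is twice the negative of the quadratic one,
    so half of it survives; it has the sign of \<open>W\<close>.\<close>
  moreover have "2 * t * (b\<^sup>2 * X - 0) + t\<^sup>2 * (0 - b\<^sup>2 * (W / b)) = t * b\<^sup>2 * X"
    using W b_pos unfolding t_def by (simp add: power2_eq_square field_simps)
  moreover have "t * b\<^sup>2 * X < 0"
    using W b_pos X by (intro mult_neg_pos) (auto simp: t_def divide_pos_neg)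
  ultimately have neg: "integral {0..X} (\<lambda>x. (deriv u x)\<^sup>2 - ?c x * (u x)\<^sup>2) < 0" unfolding Q by linarith
  have "u \<in> ode_algebra h hx ww wwd"
    unfolding u_def[abs_def] by (intro ode_algebra.intros)
  then have "smooth u" by (rule ode_algebra_smooth[OF s.pos s.h s.h' ww_deriv wwd_deriv])
  moreover have "periodic X u" using ww_periodic by (simp add: periodic_def u_def)
  moreover have "integral {0..X} u = 0"
  proof -
    have "(u has_integral X + (- t) * (W / b)) {0..X}"
      unfolding u_def[abs_def] using has_integral_const_real[of "1::real" 0 X] X
      by (intro has_integral_add has_integral_mult_right integral_ww) simp
    then show ?thesis using W b_pos by (simp add: t_def integral_unique)
  qed
  ultimately show ?thesis using neg by (rule s.energy_unstableI)
qed

lemma energy_value: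
  assumes H: "energy_potential B q H" and H': "\<And>y. y > 0 \<Longrightarrow> H y = power_potential B q y + c0 * y + c1"
  shows "energy H X h = free_energy r - c0 * mass r - c1 * X"
proof -
  interpret s: circle_steady_state B q "c * b\<^sup>2 / q" X H h hx by (rule steady_state[OF H])
  have e: "B * c powr (q + 1) = c\<^sup>2 * b\<^sup>2"
    using cc_powr_q[OF r_abs] c_pos by (simp add: powr_add power2_eq_square mult.assoc[symmetric])
  have "(hx x)\<^sup>2 / 2 - H (h x) = c\<^sup>2 * b\<^sup>2 / 2 * (kd (b * (x - x0)))\<^sup>2 - c\<^sup>2 * b\<^sup>2 / (q * (q + 1)) * k (b * (x - x0)) powr (q + 1) - c0 * h x - c1" for x
  proof -
    have "power_potential B q (h x) = B * c powr (q + 1) * k (b * (x - x0)) powr (q + 1) / (q * (q + 1))"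
      using c_pos k_pos[of "b * (x - x0)"] by (simp add: power_potential_def h_def powr_mult)
    then show ?thesis unfolding e H'[OF s.pos] by (simp add: hx_def power_mult_distrib)
  qed
  moreover have "((\<lambda>x. c\<^sup>2 * b\<^sup>2 / 2 * (kd (b * (x - x0)))\<^sup>2 - c\<^sup>2 * b\<^sup>2 / (q * (q + 1)) * k (b * (x - x0)) powr (q + 1) - c0 * h x - c1)
     has_integral c\<^sup>2 * b\<^sup>2 / 2 * (action r / b) - c\<^sup>2 * b\<^sup>2 / (q * (q + 1)) * ((q * action r + area r) / b) - c0 * mass r - X * c1) {0..X}"
    using has_integral_const_real[of c1 0 X] X k_periodic kd_periodic
    by (intro has_integral_diff has_integral_mult_right integral_h
        scaled_integral[of "\<lambda>x. (kd x)\<^sup>2"] scaled_integral[of "\<lambda>x. k x powr (q + 1)"] integral_kd_sq integral_k_power)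
       (auto simp: periodic_def)
  ultimately have "energy H X h = c\<^sup>2 * b\<^sup>2 / 2 * (action r / b) - c\<^sup>2 * b\<^sup>2 / (q * (q + 1)) * ((q * action r + area r) / b) - c0 * mass r - X * c1"
    unfolding s.energy_h by (simp add: integral_unique)
  then show ?thesis unfolding free_energy_def using b_pos by (simp add: power2_eq_square right_diff_distrib)
qed

lemma inf_h: "(INF x. h x) = c * \<gamma> (- r)"
proof (rule cInf_eq_minimum)
  have "h x0 = c * \<gamma> (- r)" by (simp add: h_def k_0)
  then show "c * \<gamma> (- r) \<in> range h" by (metis rangeI)
  fix y assume "y \<in> range h"
  then obtain x where y: "y = c * k (b * (x - x0))" unfolding h_def by blast
  have "\<gamma> (- r) \<le> \<gamma> (amp (\<theta> (b * (x - x0))))"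
  proof (rule DERIV_nonneg_imp_nondecreasing[where f = \<gamma>])
    show "- r \<le> amp (\<theta> (b * (x - x0)))" using r mult_left_le[of "cos (\<theta> (b * (x - x0)))" r] by simp
    fix s assume "- r \<le> s"
    then have "s > - rmax" using r by simp
    then show "\<exists>y. (\<gamma> has_real_derivative y) (at s) \<and> 0 \<le> y" using \<gamma>_deriv G1_pos less_imp_le by blast
  qed
  then show "c * \<gamma> (- r) \<le> y" unfolding y k_def using c_pos by (intro mult_left_mono) auto
qed

end

section \<open>Comparison of the two steady states\<close>

theorem theorem9:
  fixes m n B q X :: real and H h1 h2 :: "real \<Rightarrow> real"
  assumes "B > 0"
    and "q = m - n + 1"
    and "1 < q" and "q < 2"
    and "energy_potential B q H"
    and "\<exists>\<alpha>crit \<in> {0<..<1}.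
           (\<forall>\<alpha> \<in> {0<..<\<alpha>crit}. \<exists>D<0. (profile_E q has_real_derivative D) (at \<alpha>)) \<and>
           (\<forall>\<alpha> \<in> {\<alpha>crit<..<1}. \<exists>D>0. (profile_E q has_real_derivative D) (at \<alpha>))"
    and "strict_mono_on {0<..<1} (\<lambda>\<alpha>. \<alpha> * profile_period q \<alpha> powr (2 / (q - 1)))"
    and "pos_periodic_steady_state m n B h1" and "\<not> h1 constant_on UNIV"
    and "pos_periodic_steady_state m n B h2" and "\<not> h2 constant_on UNIV"
    and "is_least_period h1 X" and "is_least_period h2 X"
    and "integral {0..X} h1 = integral {0..X} h2"
    and "(INF x. h1 x) < (INF x. h2 x)"
  shows "energy_stable H X h1 \<and>
         energy_unstable H X h2 \<and>
         energy H X h1 < energy H X h2 \<and>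
         energy H X h2 > energy H X (\<lambda>_. (1 / X) * integral {0..X} h2)"
proof -
  have X: "X > 0" using assms(12) unfolding is_least_period_def by simp
  interpret exponent q by unfold_locales (use assms(3,4) in auto)
  interpret scale q B X by unfold_locales (use assms(1) X in auto)
  obtain r1 x1 where r1: "orbit q r1" "\<And>x. h1 x = height B q X r1 * orbit.k q r1 (wave_number q X r1 * (x - x1))"
    by (rule steady_state_classification[OF assms(1-4) assms(8,9,12)]) (rule that)
  obtain r2 x2 where r2: "orbit q r2" "\<And>x. h2 x = height B q X r2 * orbit.k q r2 (wave_number q X r2 * (x - x2))"
    by (rule steady_state_classification[OF assms(1-4) assms(10,11,13)]) (rule that)
  interpret o1: scaled_orbit q B X r1 x1 by (rule scaled_orbit.intro[OF scale_axioms r1(1)])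
  interpret o2: scaled_orbit q B X r2 x2 by (rule scaled_orbit.intro[OF scale_axioms r2(1)])
  have h1: "h1 = o1.h" and h2: "h2 = o2.h"
    using r1(2) r2(2) by (auto simp: o1.h_def o2.h_def cc_def bb_def fun_eq_iff)

  \<comment> \<open>Amplitudes in the admissible range correspond to profile minima
    \<open>\<gamma> (- s)\<close> between 0 and 1.\<close>
  have min_interval: "0 < \<gamma> (- s)" "\<gamma> (- s) < 1" "- g (\<gamma> (- s)) = s" if "0 < s" "s < rmax" for s
  proof -
    have s: "- s > - rmax" using that by simp
    show "0 < \<gamma> (- s)" "- g (\<gamma> (- s)) = s" using \<gamma>_pos[OF s] g_\<gamma>[OF s] by auto
    then show "\<gamma> (- s) < 1" using g_pos[of "\<gamma> (- s)"] g_1 that(1)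
      by (cases "\<gamma> (- s)" "1::real" rule: linorder_cases) auto
  qed
  \<comment> \<open>The factor for which \<open>K * cc s\<close> is the power of the period in the
    hypothesis, so that the monotone quantity is \<open>K\<close> times the minimum of the steady
    state.\<close>
  define K where "K = (X\<^sup>2 * B) powr (1 / (q - 1))"
  have K: "K > 0" using X B by (simp add: K_def)
  have scaled_min: "\<gamma> (- s) * profile_period q (\<gamma> (- s)) powr (2 / (q - 1)) = K * (cc s * \<gamma> (- s))"
    if s: "0 < s" "s < rmax" for s
  proof -
    have "K * cc s = (X\<^sup>2 * B * ((bb s)\<^sup>2 / B)) powr (1 / (q - 1))"
      unfolding K_def cc_def height_def bb_def[symmetric] using X B by (subst powr_mult) auto
    also have "X\<^sup>2 * B * ((bb s)\<^sup>2 / B) = (per s)\<^sup>2" using X B by (simp add: bb_eq power_divide)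
    also have "(per s)\<^sup>2 powr (1 / (q - 1)) = per s powr (2 / (q - 1))"
    proof -
      have "(per s)\<^sup>2 = per s powr 2" using per_pos[of s] s by simp
      then show ?thesis by (simp add: powr_powr)
    qed
    finally show ?thesis
      using profile_period_eq[OF min_interval(1,2)[OF s]] min_interval(3)[OF s] by (simp add: mult_ac)
  qed
  define \<alpha>1 where "\<alpha>1 = \<gamma> (- r1)"
  define \<alpha>2 where "\<alpha>2 = \<gamma> (- r2)"
  note a1 = min_interval[OF o1.r, folded \<alpha>1_def] and a2 = min_interval[OF o2.r, folded \<alpha>2_def]
  have "cc r1 * \<alpha>1 < cc r2 * \<alpha>2"
    using assms(15) unfolding h1 h2 o1.inf_h o2.inf_h \<alpha>1_def \<alpha>2_def .
  then have less: "\<alpha>1 * profile_period q \<alpha>1 powr (2 / (q - 1)) < \<alpha>2 * profile_period q \<alpha>2 powr (2 / (q - 1))"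
    unfolding scaled_min[OF o1.r, folded \<alpha>1_def] scaled_min[OF o2.r, folded \<alpha>2_def]
    using K by (rule mult_strict_left_mono)
  have "\<alpha>1 < \<alpha>2"
  proof (rule ccontr)
    assume "\<not> \<alpha>1 < \<alpha>2"
    then consider "\<alpha>1 = \<alpha>2" | "\<alpha>2 < \<alpha>1" by linarith
    then show False
    proof cases
      case 2
      then show False using less strict_mono_onD[OF assms(7), of \<alpha>2 \<alpha>1] a1 a2 by auto
    qed (use less in simp)
  qed
  \<comment> \<open>The amplitude is \<open>- g \<alpha>\<close>, so the order of the minima is
    reversed.\<close>
  then have r21: "r2 < r1" using g_strict_mono[OF a1(1), of \<alpha>2] a1(3) a2(3) by simp
  have mass: "mass r1 = mass r2"
    using assms(14) integral_unique[OF o1.integral_h] integral_unique[OF o2.integral_h] unfolding h1 h2 by simp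

  obtain \<alpha>c where ac: "0 < \<alpha>c" "\<alpha>c < 1"
    "\<forall>\<alpha>\<in>{0<..<\<alpha>c}. \<exists>D<0. (profile_E q has_real_derivative D) (at \<alpha>)"
    "\<forall>\<alpha>\<in>{\<alpha>c<..<1}. \<exists>D>0. (profile_E q has_real_derivative D) (at \<alpha>)"
    using assms(6) by auto
  define rc where "rc = - g \<alpha>c"
  have rc: "0 < rc" "rc < rmax" using g_neg[OF ac(1,2)] g_gt[OF ac(1)] by (auto simp: rc_def)
  \<comment> \<open>Amplitudes below \<open>rc\<close> belong to profile minima above
    \<open>\<alpha>c\<close>, where E increases; the sign flips in passing to the mass.\<close>
  have neg: "mass' s < 0" if s: "0 < s" "s < rc" for s
  proof -
    have s': "s < rmax" using s rc by simp
    note a = min_interval[OF s(1) s']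
    have "\<alpha>c < \<gamma> (- s)"
      using g_strict_mono[OF a(1), of \<alpha>c] a(3) s(2) unfolding rc_def by (cases "\<gamma> (- s)" \<alpha>c rule: linorder_cases) auto
    then obtain D where D: "D > 0" "(profile_E q has_real_derivative D) (at (\<gamma> (- s)))" using bspec[OF ac(4), of "\<gamma> (- s)"] a(1,2) by auto
    obtain L where "L > 0" "D = - L * mass' (- g (\<gamma> (- s)))" by (rule profile_E_deriv[OF a(1,2) D(2)])
    then show ?thesis using D(1) a(3) by (simp add: mult_less_0_iff)
  qed
  have pos: "mass' s > 0" if s: "rc < s" "s < rmax" for s
  proof -
    have s': "0 < s" using s rc by simp
    note a = min_interval[OF s' s(2)]
    have "\<gamma> (- s) < \<alpha>c"
      using g_strict_mono[OF ac(1), of "\<gamma> (- s)"] a(3) s(1) unfolding rc_def by (cases "\<gamma> (- s)" \<alpha>c rule: linorder_cases) auto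
    then obtain D where D: "D < 0" "(profile_E q has_real_derivative D) (at (\<gamma> (- s)))" using bspec[OF ac(3), of "\<gamma> (- s)"] a(1,2) by auto
    obtain L where "L > 0" "D = - L * mass' (- g (\<gamma> (- s)))" by (rule profile_E_deriv[OF a(1,2) D(2)])
    then show ?thesis using D(1) a(3) by (simp add: zero_less_mult_iff)
  qed
  have cont: "continuous_on {s..t} mass" if "0 < s" "t < rmax" for s t
    by (intro continuous_at_imp_continuous_on ballI DERIV_isCont[OF mass_deriv]) (use that in auto)
  \<comment> \<open>The mass is strictly monotone on either side of \<open>rc\<close>, so equal
    masses exclude two amplitudes on the same side.\<close>
  have "r2 < rc"
  proof (rule ccontr)
    assume n: "\<not> r2 < rc"
    have "mass r2 < mass r1"
    proof (rule DERIV_pos_imp_increasing_open[OF r21 _ cont[OF o2.r(1) o1.r(2)]])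
      fix s assume "r2 < s" "s < r1"
      then show "\<exists>y. (mass has_real_derivative y) (at s) \<and> 0 < y"
        using mass_deriv[of s] pos[of s] n o1.r o2.r by (intro exI[of _ "mass' s"]) auto
    qed
    then show False using mass by simp
  qed
  have "rc < r1"
  proof (rule ccontr)
    assume n: "\<not> rc < r1"
    have "mass r1 < mass r2"
    proof (rule DERIV_neg_imp_decreasing_open[OF r21 _ cont[OF o2.r(1) o1.r(2)]])
      fix s assume "r2 < s" "s < r1"
      then show "\<exists>y. (mass has_real_derivative y) (at s) \<and> y < 0"
        using mass_deriv[of s] neg[of s] n o1.r o2.r by (intro exI[of _ "mass' s"]) auto
    qed
    then show False using mass by simp
  qed
  \<comment> \<open>The factor between \<open>mass'\<close> and \<open>W\<close>, whose positivity
    transfers the sign.\<close>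
  have sgn: "cc s / bb s * (2 * per' s / (per s * (q - 1))) > 0" if "0 < s" "s < rmax" for s
    using that cc_pos[of s] bb_pos[of s] per_pos[of s] per'_pos[of s] q by simp
  have "o1.W > 0"
    using zero_less_mult_pos[OF pos[OF \<open>rc < r1\<close> o1.r(2), unfolded mass'_sign[OF o1.r]] sgn[OF o1.r]] unfolding o1.W_def .
  then have stable: "energy_stable H X h1" unfolding h1 by (rule o1.stable[OF assms(5)])
  have "o2.W < 0"
  proof -
    have "y < 0" if "a * y < 0" "a > 0" for a y :: real using that by (simp add: mult_less_0_iff)
    from this[OF neg[OF o2.r(1) \<open>r2 < rc\<close>, unfolded mass'_sign[OF o2.r]] sgn[OF o2.r]]
    show ?thesis unfolding o2.W_def .
  qed
  then have unstable: "energy_unstable H X h2" unfolding h2 by (rule o2.unstable[OF assms(5)])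

  obtain c0 c1 where H: "\<And>y. y > 0 \<Longrightarrow> H y = power_potential B q y + c0 * y + c1"
    using energy_potential_explicit[OF assms(5) q(1)] unfolding power_potential_def by blast
  have e1: "energy H X h1 = free_energy r1 - c0 * mass r1 - c1 * X" unfolding h1 by (rule o1.energy_value[OF assms(5) H])
  have e2: "energy H X h2 = free_energy r2 - c0 * mass r2 - c1 * X" unfolding h2 by (rule o2.energy_value[OF assms(5) H])
  have "free_energy r1 < free_energy r2"
    by (rule free_energy_less[OF o2.r(1) \<open>r2 < rc\<close> \<open>rc < r1\<close> o1.r(2) mass]) (use neg pos o1.r o2.r in auto)
  then have lt: "energy H X h1 < energy H X h2" unfolding e1 e2 mass by simp

  let ?m = "(1 / X) * integral {0..X} h2"
  have m: "?m = mass r2 / X" unfolding h2 integral_unique[OF o2.integral_h] by simp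
  have m_pos: "mass r2 / X > 0" using mass_pos[OF o2.r_abs] X by simp
  have "energy H X (\<lambda>_. ?m) = integral {0..X} (\<lambda>x. (0::real)\<^sup>2 / 2 - H ?m)"
  proof (rule energy_eqI[OF X _ _ negligible_empty])
    show "(\<lambda>_. 0) \<in> L2_circle X" by (rule L2_circle_continuous) (auto simp: periodic_def)
    have "primitive_on 0 X (\<lambda>_. ?m) (\<lambda>_. 0)" by (rule primitive_on_derivative) auto
    then show "has_weak_deriv X (\<lambda>_. ?m) (\<lambda>_. 0)" by (rule primitive_on_has_weak_deriv) (use X in auto)
  qed simp
  also have "\<dots> = - X * H (mass r2 / X)" unfolding m using X by simp
  \<comment> \<open>The constant has the same mass, so the affine part of \<open>H\<close>
    contributes as it does for \<open>h2\<close>.\<close>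
  also have "\<dots> = - X * power_potential B q (mass r2 / X) - c0 * mass r2 - c1 * X"
    unfolding H[OF m_pos] using X by (simp add: algebra_simps)
  finally have "energy H X (\<lambda>_. ?m) = - X * power_potential B q (mass r2 / X) - c0 * mass r2 - c1 * X" .
  moreover have "free_energy r2 + X * power_potential B q (mass r2 / X) > 0"
    by (rule constant_comparison[OF o2.r]) (use neg \<open>r2 < rc\<close> in auto)
  ultimately have "energy H X h2 > energy H X (\<lambda>_. ?m)" unfolding e2 by simp
  with stable unstable lt show ?thesis by blast
qed

end
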